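(* a) For $S(z)\in G_-$ and $F\in GW_0$, the action of $G_-$ on $GW_0$ (defined by $\mathcal L_{\widehat S F}=S(z)\mathcal L_F$) is given by $$(\widehat S(z)F)(\mathbf q)=F\big([S^{-1}(z)\mathbf q(z)]_+\big)+\frac12\sum_{k,l\ge 0}(W_{k,l}q_k,q_l),$$ where $[\cdot]_+$ denotes the power series truncation (the part with non-negative powers of $z$) and the operators $W_{k,l}\in\mathrm{End}(H)$ are defined by $$\sum_{k,l\ge 0}\frac{W_{k,l}}{z^kw^l}=\frac{(S^* )^{-1}(w)\,S^{-1}(z)-\mathrm{Id}}{z^{-1}+w^{-1}}.$$ b) The corresponding infinitesimal action of the Lie algebra $\mathfrak g_-$ on $GW_0$ is given by the genus zero restriction of the quantized Hamiltonians: for $l>0$ and $s_l\in\mathrm{End}(H)$ with $s_l^*=(-1)^{l+1}s_l$, the element $s_lz^{-l}\in\mathfrak g_-$ acts by $$F\longmapsto -\sum_{n\ge 0}\sum_{\beta}(s_lq_{l+n})^\beta\,\partial_{\beta,n}F-\frac12\sum_{n=0}^{l-1}(-1)^n(s_lq_{l-1-n},q_n),$$ where $(v)^\beta$ denotes the $\phi_\beta$-coordinate of $v\in H$.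
   Context: $H$ is an $N$-dimensional complex vector space with a symmetric non-degenerate bilinear form $(\cdot,\cdot)$ and a distinguished nonzero vector $\mathbf 1$; $\{\phi_\alpha\}_{\alpha=1}^N$ is a basis with $\phi_1=\mathbf 1$, $g_{\alpha,\beta}=(\phi_\alpha,\phi_\beta)$, $(g^{\alpha,\beta})=(g_{\alpha,\beta})^{-1}$, $\phi^\alpha=\sum_\beta g^{\alpha,\beta}\phi_\beta$. Variables: $t_n=\sum_\alpha t_n^\alpha\phi_\alpha\in H$, $n\ge0$; functions $F(t_0,t_1,\dots)$ are formal power series in the $t_n^\alpha$. Dilaton shift: $q_n^\alpha=t_n^\alpha-\delta_{\alpha,1}\delta_{n,1}$, $q_n=\sum_\alpha q_n^\alpha\phi_\alpha$, $\mathbf q(z)=\sum_{n\ge0}q_nz^n$, $\partial_{\alpha,n}=\partial/\partial q_n^\alpha$; $F(\mathbf q(z))$ means $F(\mathbf q)=F(q_0,q_1,\dots)$. Repeated Greek indices are summed. $GW_0$ is the set of all $F$ satisfying (DE) $\sum_{i\ge 0}q_i^\alpha\partial_{\alpha,i}F=2F$; (SE) $\sum_{i\ge 0}q_{i+1}^\alpha\partial_{\alpha,i}F=-\frac12(q_0,q_0)$; (TRR) $\partial_{\alpha,k+1}\partial_{\beta,l}\partial_{\gamma,m}F=\partial_{\alpha,k}\partial_{\mu,0}F\; g^{\mu,\nu}\;\partial_{\nu,0}\partial_{\beta,l}\partial_{\gamma,m}F$ for all $k,l,m\ge 0$ and all $\alpha,\beta,\gamma$. Let $\mathcal H=H((z^{-1}))$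 with symplectic form $\Omega(f,g)=\frac1{2\pi i}\oint(f(-z),g(z))\,dz$. Elements of $\mathcal H$ are written $\sum_{n\ge0}q_nz^n+\sum_{n\ge0}p_n(-z)^{-n-1}$ with $q_n=\sum_\alpha q_n^\alpha\phi_\alpha$, $p_n=\sum_\alpha p_n^\alpha\phi^\alpha$. For $F\in GW_0$ let $$\mathcal L_F=\Big\{\sum_{i\ge0}p_i(-z)^{-i-1}+\sum_{i\ge0}q_iz^i:\ p_i^\alpha=\frac{\partial F}{\partial q_i^\alpha}\Big\}$$ (the graph of $dF$). $G_-$ is the group of series $S(z)=\mathrm{Id}+\sum_{i>0}S_iz^{-i}$, $S_i\in\mathrm{End}(H)$, with $S^*(-z)S(z)=\mathrm{Id}$, where $^*$ is the adjoint with respect to $(\cdot,\cdot)$. Its Lie algebra is $\mathfrak g_-=\{\sum_{i>0}a_iz^{-i}:\ a_i^*=(-1)^{i+1}a_i\}$. $G_-$ acts on $\mathcal H$ preserving $\Omega$ and on $GW_0$ via cones: $\widehat SF$ is the function with $\mathcal L_{\widehat SF}=S(z)\mathcal L_F$. The substitution $\mathbf q(z)\mapsto[S^{-1}(z)\mathbf q(z)]_+$ in formal series is not always well-defined (it is when $S_1=0$); the formula in a) is understood whenever the substitution makes sense. The infinitesimal action of $a\in\mathfrak g_-$ on $F$ is the formal derivative at $\varepsilon=0$ of $\widehat{\exp(\varepsilon a)}F$. The quantized Hamiltonian of $a=s_lz^{-l}$ is obtained from $H_a(f)=\frac12\Omega(af,f)$ by the rule $p_i^\alpha p_j^\beta\mapsto\hbar\,\partial_{\alpha,i}\partial_{\beta,j}$,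 $p_i^\alpha q_j^\beta\mapsto q_j^\beta\partial_{\alpha,i}$, $q_i^\alpha q_j^\beta\mapsto\hbar^{-1}q_i^\alpha q_j^\beta$, and its genus zero restriction is the induced action on $F_0$ in $\exp(\hbar^{-1}F_0+F_1+\hbar F_2+\dots)$. *)

theory Defs
  imports
    "HOL-Analysis.Analysis"
    "HOL-Computational_Algebra.Formal_Laurent_Series"
    "HOL-Library.Multiset"
begin

section \<open>Formal power series in arbitrarily many variables\<close>

text \<open>
  A monomial in the variables \<open>'v\<close> is a finite multiset of variables; a formal power series assigns
  an arbitrary coefficient to every monomial.
\<close>

typedef ('v, 'k) mfps = "UNIV :: ('v multiset \<Rightarrow> 'k) set"
  morphisms mcoeff Abs_mfps
  by simp

lemma mcoeff_Abs [simp]: "mcoeff (Abs_mfps f) = f"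
  by (simp add: Abs_mfps_inverse)

lemma mfps_eqI: "(\<And>m. mcoeff f m = mcoeff g m) \<Longrightarrow> f = g"
  by (simp add: mcoeff_inject [symmetric] fun_eq_iff)

lemma finite_mset_splits: "finite {(a, b). a + b = (m :: 'v multiset)}"
proof -
  have "finite {d. d \<subseteq># m}"
  proof (rule finite_subset)
    show "{d. d \<subseteq># m} \<subseteq> mset ` {xs. set xs \<subseteq> set_mset m \<and> length xs \<le> size m}"
    proof
      fix d assume "d \<in> {d. d \<subseteq># m}"
      then have d: "d \<subseteq># m" by simp
      obtain xs where xs: "d = mset xs" by (metis ex_mset)
      have "set xs \<subseteq> set_mset m" "length xs \<le> size m"
        using set_mset_mono[OF d] size_mset_mono[OF d] xs by auto
      then show "d \<in> mset ` {xs. set xs \<subseteq> set_mset m \<and> length xs \<le> size m}"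
        using xs by blast
    qed
    show "finite (mset ` {xs. set xs \<subseteq> set_mset m \<and> length xs \<le> size m})"
      by (intro finite_imageI finite_lists_length_le) simp
  qed
  moreover have "{(a, b). a + b = m} \<subseteq> {d. d \<subseteq># m} \<times> {d. d \<subseteq># m}"
    by auto
  ultimately show ?thesis by (meson finite_SigmaI finite_subset)
qed

instantiation mfps :: (type, comm_ring_1) comm_ring_1
begin

definition "0 = Abs_mfps (\<lambda>_. 0)"
definition "1 = Abs_mfps (\<lambda>m. if m = {#} then 1 else 0)"
definition "f + g = Abs_mfps (\<lambda>m. mcoeff f m + mcoeff g m)"
definition "f - g = Abs_mfps (\<lambda>m. mcoeff f m - mcoeff g m)"
definition "- f = Abs_mfps (\<lambda>m. - mcoeff f m)"
definition "f * g = Abs_mfps (\<lambda>m. \<Sum>(a, b) | a + b = m. mcoeff f a * mcoeff g b)"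

instance
proof
  fix f g h :: "('a, 'b) mfps"
  show "f + g + h = f + (g + h)" "f + g = g + f" "0 + f = f" "- f + f = 0" "f - g = f + - g"
    by (simp_all add: plus_mfps_def zero_mfps_def uminus_mfps_def minus_mfps_def algebra_simps
        mcoeff_inverse)
  show "f * g = g * f"
  proof (rule mfps_eqI)
    fix m
    show "mcoeff (f * g) m = mcoeff (g * f) m"
      unfolding times_mfps_def mcoeff_Abs
      by (rule sum.reindex_bij_witness[of _ prod.swap prod.swap]) (auto simp: mult.commute add.commute)
  qed
  show "1 * f = f"
  proof (rule mfps_eqI)
    fix m
    have "mcoeff (1 * f) m =
        (\<Sum>(a, b) | a + b = m. if (a, b) = ({#}, m) then mcoeff f m else 0)"
      unfolding times_mfps_def one_mfps_def mcoeff_Abs by (rule sum.cong) auto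
    also have "\<dots> = mcoeff f m"
      by (subst sum.mono_neutral_right[of _ "{({#}, m)}"]) (auto simp: finite_mset_splits split: if_splits)
    finally show "mcoeff (1 * f) m = mcoeff f m" .
  qed
  show "(f + g) * h = f * h + g * h"
    by (rule mfps_eqI)
      (simp add: times_mfps_def plus_mfps_def distrib_right sum.distrib case_prod_unfold)
  show "f * g * h = f * (g * h)"
  proof (rule mfps_eqI)
    fix m
    have "mcoeff (f * g * h) m =
        (\<Sum>p | fst p + snd p = m. \<Sum>r | fst r + snd r = fst p.
          mcoeff f (fst r) * mcoeff g (snd r) * mcoeff h (snd p))"
      by (simp add: times_mfps_def case_prod_unfold sum_distrib_right)
    also have "\<dots> = (\<Sum>(p, r) \<in> Sigma {p. fst p + snd p = m} (\<lambda>p. {r. fst r + snd r = fst p}).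
          mcoeff f (fst r) * mcoeff g (snd r) * mcoeff h (snd p))"
      using finite_mset_splits by (subst sum.Sigma) (auto simp: case_prod_unfold)
    also have "\<dots> = (\<Sum>(p, r) \<in> Sigma {p. fst p + snd p = m} (\<lambda>p. {r. fst r + snd r = snd p}).
          mcoeff f (fst p) * (mcoeff g (fst r) * mcoeff h (snd r)))"
      by (rule sum.reindex_bij_witness[of _
            "\<lambda>(p, r). ((fst p + fst r, snd r), (fst p, fst r))"
            "\<lambda>(p, r). ((fst r, snd r + snd p), (snd r, snd p))"])
        (auto simp: add.assoc mult.assoc)
    also have "\<dots> = (\<Sum>p | fst p + snd p = m. \<Sum>r | fst r + snd r = snd p.
          mcoeff f (fst p) * (mcoeff g (fst r) * mcoeff h (snd r)))"
      using finite_mset_splits by (subst sum.Sigma) (auto simp: case_prod_unfold)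
    also have "\<dots> = mcoeff (f * (g * h)) m"
      by (simp add: times_mfps_def case_prod_unfold sum_distrib_left)
    finally show "mcoeff (f * g * h) m = mcoeff (f * (g * h)) m" .
  qed
  have "mcoeff (0 :: ('a, 'b) mfps) {#} \<noteq> mcoeff 1 {#}"
    by (simp add: zero_mfps_def one_mfps_def)
  then show "(0 :: ('a, 'b) mfps) \<noteq> 1" by metis
qed

end

definition mconst :: "'k \<Rightarrow> ('v, 'k :: comm_ring_1) mfps" where
  "mconst c = Abs_mfps (\<lambda>m. if m = {#} then c else 0)"

definition mvar :: "'v \<Rightarrow> ('v, 'k :: comm_ring_1) mfps" where
  "mvar x = Abs_mfps (\<lambda>m. if m = {#x#} then 1 else 0)"

definition mderiv :: "'v \<Rightarrow> ('v, 'k :: comm_ring_1) mfps \<Rightarrow> ('v, 'k) mfps" where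
  "mderiv x f = Abs_mfps (\<lambda>m. of_nat (Suc (count m x)) * mcoeff f (add_mset x m))"

definition mmap :: "('k \<Rightarrow> 'l) \<Rightarrow> ('v, 'k) mfps \<Rightarrow> ('v, 'l) mfps" where
  "mmap c f = Abs_mfps (\<lambda>m. c (mcoeff f m))"

text \<open>
  Infinite sums of formal power series are taken coefficient by coefficient, in the topology of the
  coefficient ring: absolute convergence for \<open>complex\<close>, adic convergence for \<open>complex fps\<close> and
  \<open>complex fls\<close>.  A sum with finitely many nonzero terms is always allowed.
\<close>

definition msummable ::
    "('i \<Rightarrow> ('v, 'k :: {comm_ring_1, t2_space}) mfps) \<Rightarrow> 'i set \<Rightarrow> bool" where
  "msummable f A \<longleftrightarrow> (\<forall>m. (\<lambda>i. mcoeff (f i) m) summable_on A)"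

definition msum ::
    "('i \<Rightarrow> ('v, 'k :: {comm_ring_1, t2_space}) mfps) \<Rightarrow> 'i set \<Rightarrow> ('v, 'k) mfps" where
  "msum f A = Abs_mfps (\<lambda>m. \<Sum>\<^sub>\<infinity>i\<in>A. mcoeff (f i) m)"


section \<open>The space \<open>H\<close> and the set \<open>GW\<^sub>0\<close>\<close>

text \<open>
  \<open>H\<close> is written in coordinates with respect to the basis \<open>\<phi>\<close>: it is \<open>complex ^ 'n\<close>, with
  \<open>\<phi>\<^sub>\<alpha> = axis \<alpha> 1\<close>; the form is given by its Gram matrix \<open>g\<close> and \<open>e\<close> is the index of the
  distinguished basis vector \<open>\<one>\<close>.  All notions are defined over a coefficient ring \<open>'k\<close>, so that
  they can be used both over \<open>complex\<close> and, for the formal parameter \<open>\<epsilon>\<close>, over \<open>complex fps\<close>.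
\<close>

definition bil :: "'k :: comm_ring_1 ^ 'n ^ 'n \<Rightarrow> 'k ^ 'n \<Rightarrow> 'k ^ 'n \<Rightarrow> 'k" where
  "bil g u v = (\<Sum>\<alpha>\<in>UNIV. \<Sum>\<beta>\<in>UNIV. g $ \<alpha> $ \<beta> * u $ \<alpha> * v $ \<beta>)"

definition symmetric_nondegenerate :: "'k :: comm_ring_1 ^ 'n ^ 'n \<Rightarrow> bool" where
  "symmetric_nondegenerate g \<longleftrightarrow>
     (\<forall>u v. bil g u v = bil g v u) \<and> (\<forall>u. (\<forall>v. bil g u v = 0) \<longrightarrow> u = 0)"

definition adj :: "'k :: comm_ring_1 ^ 'n ^ 'n \<Rightarrow> 'k ^ 'n ^ 'n \<Rightarrow> 'k ^ 'n ^ 'n" where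
  "adj g s = (THE t. \<forall>u v. bil g (s *v u) v = bil g u (t *v v))"

text \<open>The vector \<open>\<phi>\<^sup>\<alpha>\<close> of the dual basis.\<close>

definition dual_basis :: "'k :: comm_ring_1 ^ 'n ^ 'n \<Rightarrow> 'n \<Rightarrow> 'k ^ 'n" where
  "dual_basis g \<alpha> = (\<Sum>\<beta>\<in>UNIV. (matrix_inv g $ \<alpha> $ \<beta>) *s axis \<beta> 1)"

text \<open>The variable \<open>(n, \<alpha>)\<close> stands for \<open>t\<^sub>n\<^sup>\<alpha>\<close>.\<close>

type_synonym 'n var = "nat \<times> 'n"
type_synonym ('n, 'k) fun_t = "('n var, 'k) mfps"

definition dilaton :: "'n \<Rightarrow> 'n var \<Rightarrow> 'r :: comm_ring_1" where
  "dilaton e x = (if x = (1, e) then 1 else 0)"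

definition qvar :: "'n \<Rightarrow> nat \<Rightarrow> 'n \<Rightarrow> ('n, 'k :: comm_ring_1) fun_t" where
  "qvar e n \<alpha> = mvar (n, \<alpha>) - dilaton e (n, \<alpha>)"

definition qvec :: "'n \<Rightarrow> nat \<Rightarrow> ('n :: finite, 'k :: comm_ring_1) fun_t ^ 'n" where
  "qvec e n = (\<chi> \<alpha>. qvar e n \<alpha>)"

text \<open>
  The coefficients of the sums in the first two equations have only finitely many nonzero
  terms.  Since \<open>q\<close> and \<open>t\<close> differ by a constant, \<open>\<partial>\<^bsub>\<alpha>,n\<^esub>\<close> is also the derivative with respect to
  \<open>t\<^sub>n\<^sup>\<alpha>\<close>.
\<close>

definition DE :: "'n :: finite \<Rightarrow> ('n, 'k :: {comm_ring_1, t2_space}) fun_t \<Rightarrow> bool" where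
  "DE e F \<longleftrightarrow> msum (\<lambda>i. \<Sum>\<alpha>\<in>UNIV. qvar e i \<alpha> * mderiv (i, \<alpha>) F) UNIV = 2 * F"

definition SE ::
    "'k ^ 'n ^ 'n \<Rightarrow> 'n :: finite \<Rightarrow> ('n, 'k :: {comm_ring_1, inverse, t2_space}) fun_t \<Rightarrow> bool" where
  "SE g e F \<longleftrightarrow>
     msum (\<lambda>i. \<Sum>\<alpha>\<in>UNIV. qvar e (i + 1) \<alpha> * mderiv (i, \<alpha>) F) UNIV =
       - (mconst (inverse 2) * bil (map_matrix mconst g) (qvec e 0) (qvec e 0))"

definition TRR :: "'k ^ 'n ^ 'n \<Rightarrow> ('n :: finite, 'k :: comm_ring_1) fun_t \<Rightarrow> bool" where
  "TRR g F \<longleftrightarrow> (\<forall>k l m \<alpha> \<beta> \<gamma>.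
     mderiv (k + 1, \<alpha>) (mderiv (l, \<beta>) (mderiv (m, \<gamma>) F)) =
     (\<Sum>\<mu>\<in>UNIV. \<Sum>\<nu>\<in>UNIV. mderiv (k, \<alpha>) (mderiv (0, \<mu>) F) * mconst (matrix_inv g $ \<mu> $ \<nu>) *
        mderiv (0, \<nu>) (mderiv (l, \<beta>) (mderiv (m, \<gamma>) F))))"

definition GW0 ::
    "'k ^ 'n ^ 'n \<Rightarrow> 'n :: finite \<Rightarrow> ('n, 'k :: {comm_ring_1, inverse, t2_space}) fun_t set" where
  "GW0 g e = {F. DE e F \<and> SE g e F \<and> TRR g F}"


section \<open>The group \<open>G\<^sub>-\<close>\<close>

text \<open>\<open>A :: nat \<Rightarrow> 'k ^ 'n ^ 'n\<close> stands for the series \<open>\<Sum>i. A i z\<^sup>-\<^sup>i\<close>.\<close>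

type_synonym ('n, 'k) zseries = "nat \<Rightarrow> 'k ^ 'n ^ 'n"

definition sone :: "('n :: finite, 'k :: comm_ring_1) zseries" where
  "sone = (\<lambda>n. if n = 0 then mat 1 else 0)"

definition sprod :: "('n :: finite, 'k :: comm_ring_1) zseries \<Rightarrow> ('n, 'k) zseries \<Rightarrow> ('n, 'k) zseries" where
  "sprod A B = (\<lambda>n. \<Sum>i\<le>n. A i ** B (n - i))"

primrec spow :: "('n :: finite, 'k :: comm_ring_1) zseries \<Rightarrow> nat \<Rightarrow> ('n, 'k) zseries" where
  "spow A 0 = sone"
| "spow A (Suc k) = sprod A (spow A k)"

definition sinv :: "('n :: finite, 'k :: comm_ring_1) zseries \<Rightarrow> ('n, 'k) zseries" where
  "sinv A = (THE B. sprod A B = sone \<and> sprod B A = sone)"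

definition sadj ::
    "'k ^ 'n ^ 'n \<Rightarrow> ('n :: finite, 'k :: comm_ring_1) zseries \<Rightarrow> ('n, 'k) zseries" where
  "sadj g A = (\<lambda>i. adj g (A i))"

definition sflip :: "('n :: finite, 'k :: comm_ring_1) zseries \<Rightarrow> ('n, 'k) zseries" where
  "sflip A = (\<lambda>i. map_matrix (\<lambda>x. (- 1) ^ i * x) (A i))"  \<comment> \<open>the substitution \<open>z \<mapsto> -z\<close>\<close>

definition Gminus :: "'k ^ 'n ^ 'n \<Rightarrow> ('n :: finite, 'k :: comm_ring_1) zseries set" where
  "Gminus g = {S. S 0 = mat 1 \<and> sprod (sflip (sadj g S)) S = sone}"

text \<open>
  The family \<open>W\<close>, by comparison of the coefficients of \<open>z\<^sup>-\<^sup>k w\<^sup>-\<^sup>l\<close> after multiplying the generating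
  function by \<open>z\<^sup>-\<^sup>1 + w\<^sup>-\<^sup>1\<close>.
\<close>

definition is_W_family ::
    "'k ^ 'n ^ 'n \<Rightarrow> ('n :: finite, 'k :: comm_ring_1) zseries \<Rightarrow> (nat \<Rightarrow> nat \<Rightarrow> 'k ^ 'n ^ 'n) \<Rightarrow> bool" where
  "is_W_family g S W \<longleftrightarrow> (\<forall>k l.
     (if k > 0 then W (k - 1) l else 0) + (if l > 0 then W k (l - 1) else 0) =
     sinv (sadj g S) l ** sinv S k - (if k = 0 \<and> l = 0 then mat 1 else 0))"

definition Wop ::
    "'k ^ 'n ^ 'n \<Rightarrow> ('n :: finite, 'k :: comm_ring_1) zseries \<Rightarrow> nat \<Rightarrow> nat \<Rightarrow> 'k ^ 'n ^ 'n" where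
  "Wop g S = (THE W. is_W_family g S W)"


section \<open>The loop space, cones and the action on \<open>GW\<^sub>0\<close>\<close>

text \<open>\<open>f :: int \<Rightarrow> 'k ^ 'n\<close> stands for the Laurent series \<open>\<Sum>k. f k z\<^sup>k\<close> in \<open>z\<^sup>-\<^sup>1\<close>.\<close>

definition loop_space :: "(int \<Rightarrow> 'k :: comm_ring_1 ^ 'n) set" where
  "loop_space = {f. \<exists>K. \<forall>k > K. f k = 0}"

text \<open>Multiplication by a series in \<open>z\<^sup>-\<^sup>1\<close>; the index set is finite for \<open>f\<close> in the loop space.\<close>

definition lact ::
    "('n :: finite, 'k :: comm_ring_1) zseries \<Rightarrow> (int \<Rightarrow> 'k ^ 'n) \<Rightarrow> int \<Rightarrow> 'k ^ 'n" where
  "lact S f = (\<lambda>k. \<Sum>i | f (k + int i) \<noteq> 0. S i *v f (k + int i))"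

text \<open>
  A formal function \<open>F\<close> can only be evaluated at formal points, so the points of a cone are taken to
  be formal families of elements of the loop space, that is, formal power series in the parameters
  \<open>t\<^sub>n\<^sup>\<alpha>\<close> whose coefficients lie in the loop space.  These parameters are unrelated to the
  coordinates of the point, but there are enough of them for the family \<open>univ_point\<close>, in which
  \<open>q\<^sub>n\<^sup>\<alpha>\<close> are independent variables.
\<close>

type_synonym ('n, 'k) family = "'n var multiset \<Rightarrow> int \<Rightarrow> 'k ^ 'n"

definition qpart :: "('n :: finite, 'k) family \<Rightarrow> nat \<Rightarrow> 'n \<Rightarrow> ('n, 'k) fun_t" where
  "qpart f n \<alpha> = Abs_mfps (\<lambda>m. f m (int n) $ \<alpha>)"

definition univ_point :: "'n \<Rightarrow> ('n :: finite, 'k :: comm_ring_1) family" where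
  "univ_point e = (\<lambda>m k. if k \<ge> 0 then (\<chi> \<alpha>. mcoeff (qvar e (nat k) \<alpha>) m) else 0)"

definition fam_act ::
    "('n :: finite, 'k :: comm_ring_1) zseries \<Rightarrow> ('n, 'k) family \<Rightarrow> ('n, 'k) family" where
  "fam_act S f = (\<lambda>m. lact S (f m))"

text \<open>
  The value \<open>F(q)\<close> of \<open>F\<close> at a family \<open>q\<close>: since \<open>F\<close> is a series in \<open>t\<close>, one substitutes
  \<open>q\<^sub>n\<^sup>\<alpha> + \<delta>\<^bsub>\<alpha>,1\<^esub> \<delta>\<^bsub>n,1\<^esub>\<close> for \<open>t\<^sub>n\<^sup>\<alpha>\<close>.  The substitution makes sense if the resulting
  series of monomials is summable.
\<close>

definition subst_term ::
    "'n \<Rightarrow> ('n :: finite, 'k :: comm_ring_1) fun_t \<Rightarrow> (nat \<Rightarrow> 'n \<Rightarrow> ('n, 'k) fun_t)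
      \<Rightarrow> 'n var multiset \<Rightarrow> ('n, 'k) fun_t" where
  "subst_term e F q s = mconst (mcoeff F s) * (\<Prod>x\<in>#s. q (fst x) (snd x) + dilaton e x)"

definition subst_ok ::
    "'n \<Rightarrow> ('n :: finite, 'k :: {comm_ring_1, t2_space}) fun_t \<Rightarrow> (nat \<Rightarrow> 'n \<Rightarrow> ('n, 'k) fun_t)
      \<Rightarrow> bool" where
  "subst_ok e F q \<longleftrightarrow> msummable (subst_term e F q) UNIV"

definition subst ::
    "'n \<Rightarrow> ('n :: finite, 'k :: {comm_ring_1, t2_space}) fun_t \<Rightarrow> (nat \<Rightarrow> 'n \<Rightarrow> ('n, 'k) fun_t)
      \<Rightarrow> ('n, 'k) fun_t" where
  "subst e F q = msum (subst_term e F q) UNIV"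

text \<open>The cone \<open>\<L>\<^sub>F\<close>, the graph of \<open>dF\<close>.\<close>

definition cone ::
    "'k ^ 'n ^ 'n \<Rightarrow> 'n \<Rightarrow> ('n :: finite, 'k :: {comm_ring_1, t2_space}) fun_t
      \<Rightarrow> ('n, 'k) family set" where
  "cone g e F = {f.
     (\<forall>m. f m \<in> loop_space) \<and>
     (\<forall>i \<alpha>. subst_ok e (mderiv (i, \<alpha>) F) (qpart f)) \<and>
     (\<forall>m i. f m (- int i - 1) =
        (- 1) ^ (i + 1) *s
          (\<Sum>\<alpha>\<in>UNIV. mcoeff (subst e (mderiv (i, \<alpha>) F) (qpart f)) m *s dual_basis g \<alpha>))}"

text \<open>
  The families whose \<open>q\<close>-part starts at \<open>-\<one> z\<close>, i.e. at \<open>t = 0\<close>.  The cone of a formal series in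
  \<open>t\<close> is a germ there.  If \<open>S\<^sub>1 \<one> \<noteq> 0\<close>, multiplication by \<open>S(z)\<close> moves this base point, and the
  transported cone has to be restricted to it again.
\<close>

definition based :: "'n \<Rightarrow> ('n :: finite, 'k :: comm_ring_1) family set" where
  "based e = {f. \<forall>n. f {#} (int n) = (if n = 1 then - axis e 1 else 0)}"

text \<open>\<open>is_hat g e S F G\<close>: \<open>G\<close> lies in \<open>GW\<^sub>0\<close> and \<open>\<L>\<^sub>G = S(z) \<L>\<^sub>F\<close> as germs.\<close>

definition is_hat ::
    "'k ^ 'n ^ 'n \<Rightarrow> 'n \<Rightarrow> ('n :: finite, 'k :: {comm_ring_1, inverse, t2_space}) zseries
      \<Rightarrow> ('n, 'k) fun_t \<Rightarrow> ('n, 'k) fun_t \<Rightarrow> bool" where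
  "is_hat g e S F G \<longleftrightarrow>
     G \<in> GW0 g e \<and> cone g e G \<inter> based e = (fam_act S ` cone g e F) \<inter> based e"

definition hat ::
    "'k ^ 'n ^ 'n \<Rightarrow> 'n \<Rightarrow> ('n :: finite, 'k :: {comm_ring_1, inverse, t2_space}) zseries
      \<Rightarrow> ('n, 'k) fun_t \<Rightarrow> ('n, 'k) fun_t" where
  "hat g e S F = (THE G. is_hat g e S F G)"


section \<open>The infinitesimal action and quantized Hamiltonians\<close>

text \<open>\<open>exp(\<epsilon> a)\<close> as a series in \<open>z\<^sup>-\<^sup>1\<close> over \<open>complex fps\<close>, the power series in \<open>\<epsilon>\<close>.\<close>

definition exp_eps :: "('n :: finite, complex) zseries \<Rightarrow> ('n, complex fps) zseries" where
  "exp_eps a = (\<lambda>n. \<chi> i j. Abs_fps (\<lambda>k. spow a k n $ i $ j / fact k))"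

definition hat_exp ::
    "complex ^ 'n ^ 'n \<Rightarrow> 'n \<Rightarrow> ('n :: finite, complex) zseries \<Rightarrow> ('n, complex) fun_t
      \<Rightarrow> ('n, complex fps) fun_t \<Rightarrow> bool" where
  "hat_exp g e a F = is_hat (map_matrix fps_const g) e (exp_eps a) (mmap fps_const F)"

definition inf_action ::
    "complex ^ 'n ^ 'n \<Rightarrow> 'n \<Rightarrow> ('n :: finite, complex) zseries \<Rightarrow> ('n, complex) fun_t
      \<Rightarrow> ('n, complex) fun_t" where
  "inf_action g e a F = mmap (\<lambda>c. fps_nth (fps_deriv c) 0)
     (hat (map_matrix fps_const g) e (exp_eps a) (mmap fps_const F))"

text \<open>
  \<open>\<Omega>(f, g)\<close> is the coefficient of \<open>z\<^sup>-\<^sup>1\<close> in \<open>(f(-z), g(z))\<close>; the index set is finite on the loop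
  space.
\<close>

definition Omega ::
    "complex ^ 'n ^ 'n \<Rightarrow> (int \<Rightarrow> complex ^ 'n :: finite) \<Rightarrow> (int \<Rightarrow> complex ^ 'n) \<Rightarrow> complex" where
  "Omega g f h = (\<Sum>i | f i \<noteq> 0 \<and> h (- 1 - i) \<noteq> 0. (- 1) powi i * bil g (f i) (h (- 1 - i)))"

definition Hamiltonian ::
    "complex ^ 'n ^ 'n \<Rightarrow> ('n :: finite, complex) zseries \<Rightarrow> (int \<Rightarrow> complex ^ 'n) \<Rightarrow> complex" where
  "Hamiltonian g a f = 1 / 2 * Omega g (lact a f) f"

text \<open>The Darboux coordinates \<open>p\<^sub>i\<^sup>\<alpha>\<close>, \<open>q\<^sub>i\<^sup>\<alpha>\<close> and the corresponding basis vectors.\<close>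

datatype 'n darboux = P nat 'n | Q nat 'n

fun darboux_vec :: "complex ^ 'n ^ 'n \<Rightarrow> 'n :: finite darboux \<Rightarrow> int \<Rightarrow> complex ^ 'n" where
  "darboux_vec g (P i \<alpha>) = (\<lambda>k. if k = - int i - 1 then (- 1) ^ (i + 1) *s dual_basis g \<alpha> else 0)"
| "darboux_vec g (Q i \<alpha>) = (\<lambda>k. if k = int i then axis \<alpha> 1 else 0)"

text \<open>
  The operators act on expressions \<open>u exp(\<Phi>)\<close> with \<open>\<Phi> = \<hbar>\<^sup>-\<^sup>1 F\<^sub>0 + F\<^sub>1 + \<hbar> F\<^sub>2 + \<dots>\<close>; such an
  expression is represented by \<open>u\<close>, and \<open>\<partial>(u exp(\<Phi>)) = (\<partial>u + u \<partial>\<Phi>) exp(\<Phi>)\<close>.  Coefficients are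
  in \<open>complex fls\<close>, the Laurent series in \<open>\<hbar>\<close>.
\<close>

definition total_potential ::
    "(nat \<Rightarrow> ('n, complex) fun_t) \<Rightarrow> ('n, complex fls) fun_t" where
  "total_potential Fg =
     Abs_mfps (\<lambda>m. fls_shift 1 (fps_to_fls (Abs_fps (\<lambda>k. mcoeff (Fg k) m))))"

definition exp_deriv ::
    "('n, complex fls) fun_t \<Rightarrow> 'n var \<Rightarrow> ('n, complex fls) fun_t \<Rightarrow> ('n, complex fls) fun_t" where
  "exp_deriv \<Phi> x u = mderiv x u + u * mderiv x \<Phi>"

fun quant_rule ::
    "'n \<Rightarrow> ('n, complex fls) fun_t \<Rightarrow> 'n darboux \<Rightarrow> 'n darboux
      \<Rightarrow> ('n, complex fls) fun_t \<Rightarrow> ('n, complex fls) fun_t" where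
  "quant_rule e \<Phi> (P i \<alpha>) (P j \<beta>) u =
     mconst fls_X * exp_deriv \<Phi> (i, \<alpha>) (exp_deriv \<Phi> (j, \<beta>) u)"
| "quant_rule e \<Phi> (P i \<alpha>) (Q j \<beta>) u = qvar e j \<beta> * exp_deriv \<Phi> (i, \<alpha>) u"
| "quant_rule e \<Phi> (Q j \<beta>) (P i \<alpha>) u = qvar e j \<beta> * exp_deriv \<Phi> (i, \<alpha>) u"
| "quant_rule e \<Phi> (Q i \<alpha>) (Q j \<beta>) u =
     mconst (inverse fls_X) * qvar e i \<alpha> * qvar e j \<beta> * u"

text \<open>
  A quadratic form \<open>h\<close> equals \<open>\<Sum>I J. c I J x\<^sub>I x\<^sub>J\<close>, where \<open>2 c I J = h(v\<^sub>I + v\<^sub>J) - h(v\<^sub>I) - h(v\<^sub>J)\<close>;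
  its quantization is obtained by applying the rule to every \<open>x\<^sub>I x\<^sub>J\<close>.
\<close>

definition quad_coeff ::
    "complex ^ 'n ^ 'n \<Rightarrow> ((int \<Rightarrow> complex ^ 'n) \<Rightarrow> complex) \<Rightarrow> 'n :: finite darboux \<Rightarrow> 'n darboux
      \<Rightarrow> complex" where
  "quad_coeff g h I J =
     (h (\<lambda>k. darboux_vec g I k + darboux_vec g J k) - h (darboux_vec g I) - h (darboux_vec g J)) / 2"

definition quantize ::
    "complex ^ 'n ^ 'n \<Rightarrow> 'n \<Rightarrow> ((int \<Rightarrow> complex ^ 'n) \<Rightarrow> complex) \<Rightarrow> ('n :: finite, complex fls) fun_t
      \<Rightarrow> ('n, complex fls) fun_t \<Rightarrow> ('n, complex fls) fun_t" where
  "quantize g e h \<Phi> u =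
     msum (\<lambda>(I, J). mconst (fls_const (quad_coeff g h I J)) * quant_rule e \<Phi> I J u) UNIV"

text \<open>
  If \<open>D exp(\<Phi>) = u exp(\<Phi>)\<close>, then \<open>u\<close> is the variation of \<open>\<Phi>\<close> and its \<open>\<hbar>\<^sup>-\<^sup>1\<close> coefficient is the
  variation of \<open>F\<^sub>0\<close>.
\<close>

definition genus0_action ::
    "complex ^ 'n ^ 'n \<Rightarrow> 'n \<Rightarrow> ('n :: finite, complex) zseries \<Rightarrow> (nat \<Rightarrow> ('n, complex) fun_t)
      \<Rightarrow> ('n, complex) fun_t" where
  "genus0_action g e a Fg =
     mmap (\<lambda>c. fls_nth c (- 1)) (quantize g e (Hamiltonian g a) (total_potential Fg) 1)"

end

theory Submission
  imports Defs
begin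

text \<open>
  Let \<open>R = S\<^sup>-\<^sup>1\<close>, and let \<open>T\<close> be the dilaton-shifted substitution \<open>q \<mapsto> [R q]\<^sub>+\<close>; the
  claimed answer is \<open>G = F \<circ> T + \<onehalf> \<Sum> (W\<^bsub>k,l\<^esub> q\<^sub>k, q\<^sub>l)\<close>.  The vector fields of DE and SE are compatible with
  \<open>T\<close> because multiplication by \<open>R\<close> commutes with multiplication by \<open>z\<^sup>-\<^sup>1\<close>, and the quadratic term compensates the
  right-hand side of SE by the recursion \<open>W\<^bsub>k-1,l\<^esub> + W\<^bsub>k,l-1\<^esub> = R\<^sub>l\<^sup>* R\<^sub>k - \<delta>\<close>.  For TRR, the chain rule
  expresses the derivatives of \<open>F \<circ> T\<close>, and the missing term is \<open>W\<^bsub>k,0\<^esub> = R\<^bsub>k+1\<^esub>\<close>.  The cones agree by the chain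
  rule and the identity \<open>W\<^bsub>k,n\<^esub> = (-1)\<^bsup>n+1\<^esup> \<Sum>\<^sub>j S\<^bsub>n+1+j\<^esub> R\<^bsub>k-j\<^esub>\<close>, which computes the negative part of
  \<open>S [R q]\<^sub>+\<close>.  A member of \<open>GW\<^sub>0\<close> is determined by its cone: the point with independent \<open>q\<close>
  recovers \<open>dF\<close>, and DE recovers \<open>F\<close>.  The infinitesimal action is the coefficient of \<open>\<epsilon>\<close> of the same
  formula over \<open>complex fps\<close>, where all substitutions converge because \<open>R\<close> is the identity modulo \<open>\<epsilon>\<close>.
\<close>

text \<open>The obstacle is convergence. If \<open>R 1\<close> does not kill the distinguished
  vector, the level-zero components of \<open>T\<close> have nonzero constant terms. A coefficient
  of \<open>F \<circ> T\<close> is then an infinite sum, and convergence is assumed for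
  \<open>F\<close> only, not for its derivatives or for products. Composition is therefore a
  relation \<open>has_comp\<close>, meaning summable with the given value, which is closed under
  sums and products; an equation for \<open>F\<close> passes through \<open>T\<close> by uniqueness
  of the value.

  Two facts keep this manageable. First, \<open>T x\<close> involves only variables of level at
  least that of \<open>x\<close>, so restricting to levels up to \<open>N\<close> makes sums over
  variables finite, while sums over monomials may stay infinite. Second, at a based point
  \<open>h\<close> all \<open>t\<close>-coordinates have constant term zero, so evaluation there is
  a finite sum in each coefficient, and evaluating \<open>F \<circ> T\<close> at \<open>h\<close>
  agrees with evaluating \<open>F\<close> at \<open>R h\<close>.

  All signs have one origin: the symplectic condition makes \<open>R_i\<close> equal to
  \<open>(-1)^i\<close> times the adjoint of \<open>S_i\<close>.\<close>

no_notation fps_nth (infixl \<open>$\<close> 75)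

text \<open>
  The common setting for absolutely convergent sums in \<open>complex\<close> and adically convergent sums in
  \<open>complex fps\<close>.  Class axioms cannot mention \<open>has_sum\<close> or a second type variable, so the product rule is
  stated with the definition unfolded and for index sets of natural numbers.
\<close>

class sum_ring = idom + ring_char_0 + inverse + topological_comm_monoid_add + t3_space +
  assumes inverse_two: "inverse 2 * 2 = 1"
  assumes has_sum_product_nat:
    "filterlim (sum f) (nhds x) (finite_subsets_at_top A) \<Longrightarrow>
     filterlim (sum h) (nhds y) (finite_subsets_at_top B) \<Longrightarrow>
     filterlim (sum (\<lambda>(a :: nat, b :: nat). f a * h b)) (nhds (x * y)) (finite_subsets_at_top (A \<times> B))"

text \<open>Enumerating the countable index sets by \<open>to_nat_on\<close> reduces this to the
  class axiom for sets of naturals. Countability suffices because sums run over multisets of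
  countably many variables.\<close>

lemma has_sum_product:
  fixes f :: "'i \<Rightarrow> 'k :: sum_ring" and h :: "'j \<Rightarrow> 'k"
  assumes f: "(f has_sum x) A" and h: "(h has_sum y) B" and "countable A" "countable B"
  shows "((\<lambda>(a, b). f a * h b) has_sum (x * y)) (A \<times> B)"
proof -
  define i where "i = to_nat_on A"
  define j where "j = to_nat_on B"
  have i: "inj_on i A" and j: "inj_on j B"
    using assms by (auto simp: i_def j_def)
  have "(f \<circ> inv_into A i has_sum x) (i ` A)"
    using f by (subst has_sum_reindex[OF i]) (auto simp: o_def i intro: has_sum_cong[THEN iffD1, rotated])
  moreover have "(h \<circ> inv_into B j has_sum y) (j ` B)"
    using h by (subst has_sum_reindex[OF j]) (auto simp: o_def j intro: has_sum_cong[THEN iffD1, rotated])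
  ultimately have "((\<lambda>(a, b). (f \<circ> inv_into A i) a * (h \<circ> inv_into B j) b) has_sum (x * y)) (i ` A \<times> j ` B)"
    unfolding has_sum_def by (rule has_sum_product_nat)
  also have "i ` A \<times> j ` B = map_prod i j ` (A \<times> B)" by auto
  finally have "((\<lambda>(a, b). (f \<circ> inv_into A i) a * (h \<circ> inv_into B j) b) \<circ> map_prod i j has_sum (x * y)) (A \<times> B)"
    by (subst (asm) has_sum_reindex) (auto intro!: map_prod_inj_on i j)
  then show ?thesis
    by (rule has_sum_cong[THEN iffD1, rotated]) (auto simp: i j)
qed

text \<open>The product rule with a one-point index set for the constant stands in for continuity of
  multiplication.\<close>

lemma has_sum_cmult:
  fixes f :: "'i \<Rightarrow> 'k :: sum_ring"
  assumes "(f has_sum x) A" "countable A"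
  shows "((\<lambda>a. c * f a) has_sum (c * x)) A"
proof -
  have "((\<lambda>(b, a). c * f a) has_sum (c * x)) ({()} \<times> A)"
    using assms by (intro has_sum_product) (auto intro: has_sum_finiteI)
  also have "{()} \<times> A = Pair () ` A" by auto
  finally show ?thesis
    by (subst (asm) has_sum_reindex) (auto simp: o_def inj_on_def)
qed

lemma has_sum_sum:
  fixes f :: "'a \<Rightarrow> 'i \<Rightarrow> 'k :: topological_comm_monoid_add"
  assumes "\<And>a. a \<in> A \<Longrightarrow> (f a has_sum s a) B"
  shows "((\<lambda>i. \<Sum>a\<in>A. f a i) has_sum (\<Sum>a\<in>A. s a)) B"
  using assms by (induction A rule: infinite_finite_induct) (auto intro: has_sum_add)

lemma multiset_cases_small:
  obtains "m = {#}" | y where "m = {#y#}" | "size m \<noteq> 0" "size m \<noteq> 1"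
  by (metis One_nat_def size_1_singleton_mset size_eq_0_iff_empty)

section \<open>The ring of formal power series\<close>

lemma mcoeff_0 [simp]: "mcoeff 0 m = 0" by (simp add: zero_mfps_def)
lemma mcoeff_1: "mcoeff 1 m = (if m = {#} then 1 else 0)" by (simp add: one_mfps_def)
lemma mcoeff_add [simp]: "mcoeff (f + h) m = mcoeff f m + mcoeff h m" by (simp add: plus_mfps_def)
lemma mcoeff_diff [simp]: "mcoeff (f - h) m = mcoeff f m - mcoeff h m" by (simp add: minus_mfps_def)
lemma mcoeff_uminus [simp]: "mcoeff (- f) m = - mcoeff f m" by (simp add: uminus_mfps_def)
lemma mcoeff_mconst: "mcoeff (mconst c) m = (if m = {#} then c else 0)" by (simp add: mconst_def)
lemma mcoeff_mvar: "mcoeff (mvar x) m = (if m = {#x#} then 1 else 0)" by (simp add: mvar_def)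
lemma mcoeff_mderiv: "mcoeff (mderiv x f) m = of_nat (Suc (count m x)) * mcoeff f (add_mset x m)"
  by (simp add: mderiv_def)
lemma mcoeff_mmap [simp]: "mcoeff (mmap c f) m = c (mcoeff f m)" by (simp add: mmap_def)

lemma mcoeff_times:
  "mcoeff (f * h) m = (\<Sum>p | fst p + snd p = m. mcoeff f (fst p) * mcoeff h (snd p))"
  by (simp add: times_mfps_def case_prod_unfold)

lemma finite_mset_splits' [simp]: "finite {p. fst p + snd p = (m :: 'v multiset)}"
  using finite_mset_splits[of m] by (simp add: case_prod_unfold)

lemma mcoeff_sum [simp]: "mcoeff (\<Sum>a\<in>A. f a) m = (\<Sum>a\<in>A. mcoeff (f a) m)"
  by (induction A rule: infinite_finite_induct) auto

lemma mcoeff_mconst_mult [simp]: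
  fixes f :: "('v, 'k :: comm_ring_1) mfps"
  shows "mcoeff (mconst c * f) m = c * mcoeff f m"
proof -
  have "mcoeff (mconst c * f) m =
      (\<Sum>p\<in>{({#}, m)}. mcoeff (mconst c :: ('v, 'k) mfps) (fst p) * mcoeff f (snd p))"
    unfolding mcoeff_times by (intro sum.mono_neutral_right) (auto simp: mcoeff_mconst)
  then show ?thesis by (simp add: mcoeff_mconst)
qed

lemma mcoeff_mvar_mult:
  "mcoeff (mvar x * f) m = (if x \<in># m then mcoeff f (m - {#x#}) else 0)"
proof (cases "x \<in># m")
  case True
  have "mcoeff (mvar x * f) m = (\<Sum>p\<in>{({#x#}, m - {#x#})}. mcoeff (mvar x) (fst p) * mcoeff f (snd p))"
    unfolding mcoeff_times using True by (intro sum.mono_neutral_right) (auto simp: mcoeff_mvar)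
  then show ?thesis using True by (simp add: mcoeff_mvar)
next
  case False
  then have "mcoeff (mvar x * f) m = 0"
    unfolding mcoeff_times by (intro sum.neutral) (auto simp: mcoeff_mvar)
  then show ?thesis using False by simp
qed

lemma mconst_0 [simp]: "mconst 0 = 0" by (rule mfps_eqI) (simp add: mcoeff_mconst)
lemma mconst_1 [simp]: "mconst 1 = 1" by (rule mfps_eqI) (simp add: mcoeff_mconst mcoeff_1)
lemma mconst_add: "mconst (a + b) = mconst a + mconst b" by (rule mfps_eqI) (simp add: mcoeff_mconst)
lemma mconst_diff: "mconst (a - b) = mconst a - mconst b" by (rule mfps_eqI) (simp add: mcoeff_mconst)
lemma mconst_uminus: "mconst (- a) = - mconst a" by (rule mfps_eqI) (simp add: mcoeff_mconst)
lemma mconst_mult: "mconst (a * b) = mconst a * mconst b" by (rule mfps_eqI) (simp add: mcoeff_mconst)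
lemma mconst_sum: "mconst (\<Sum>a\<in>A. f a) = (\<Sum>a\<in>A. mconst (f a))"
  by (rule mfps_eqI) (simp add: mcoeff_mconst)
lemma mconst_of_nat: "mconst (of_nat n) = of_nat n"
  by (induction n) (simp_all add: mconst_add)
lemma mconst_2: "mconst 2 = 2" using mconst_of_nat[of 2] by simp
lemma mcoeff_of_nat_mult [simp]: "mcoeff (of_nat n * f) m = of_nat n * mcoeff f m"
  using mcoeff_mconst_mult[of "of_nat n" f m] by (simp only: mconst_of_nat)

lemma dilaton_mconst: "dilaton e x = mconst (dilaton e x)"
  by (simp add: dilaton_def)

subsection \<open>Derivatives\<close>

lemma mderiv_0 [simp]: "mderiv x 0 = 0" by (rule mfps_eqI) (simp add: mcoeff_mderiv)
lemma mderiv_mconst [simp]: "mderiv x (mconst c) = 0"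
  by (rule mfps_eqI) (simp add: mcoeff_mderiv mcoeff_mconst)
lemma mderiv_add: "mderiv x (f + h) = mderiv x f + mderiv x h"
  by (rule mfps_eqI) (simp add: mcoeff_mderiv algebra_simps)
lemma mderiv_diff: "mderiv x (f - h) = mderiv x f - mderiv x h"
  by (rule mfps_eqI) (simp add: mcoeff_mderiv algebra_simps)
lemma mderiv_sum: "mderiv x (\<Sum>a\<in>A. f a) = (\<Sum>a\<in>A. mderiv x (f a))"
  by (rule mfps_eqI) (simp add: mcoeff_mderiv sum_distrib_left)
lemma mderiv_mvar: "mderiv x (mvar y) = (if x = y then 1 else 0)"
  by (rule mfps_eqI) (auto simp: mcoeff_mderiv mcoeff_mvar mcoeff_1)

text \<open>Each splitting of \<open>add_mset x m\<close> is weighted by the multiplicity of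
  \<open>x\<close> in one of its two parts. The two multiplicities add up to
  \<open>Suc (count m x)\<close>, and removing one \<open>x\<close> from the weighted part yields
  the two Leibniz terms.\<close>

lemma mderiv_mult: "mderiv x (f * h) = mderiv x f * h + f * mderiv x h"
proof (rule mfps_eqI)
  fix m
  define c where "c a = (of_nat (count a x) :: 'b)" for a
  have eq1: "(\<Sum>p | fst p + snd p = add_mset x m. c (fst p) * (mcoeff f (fst p) * mcoeff h (snd p))) =
      mcoeff (mderiv x f * h) m"
  proof -
    have "(\<Sum>p | fst p + snd p = add_mset x m. c (fst p) * (mcoeff f (fst p) * mcoeff h (snd p))) =
        (\<Sum>p | fst p + snd p = add_mset x m \<and> x \<in># fst p. c (fst p) * (mcoeff f (fst p) * mcoeff h (snd p)))"
      by (rule sum.mono_neutral_right) (auto simp: c_def not_in_iff)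
    also have "\<dots> = mcoeff (mderiv x f * h) m"
      unfolding mcoeff_times mcoeff_mderiv
      by (rule sum.reindex_bij_witness[of _ "\<lambda>p. (add_mset x (fst p), snd p)" "\<lambda>p. (fst p - {#x#}, snd p)"])
        (auto simp: c_def algebra_simps dest!: multi_member_split)
    finally show ?thesis .
  qed
  have eq2: "(\<Sum>p | fst p + snd p = add_mset x m. c (snd p) * (mcoeff f (fst p) * mcoeff h (snd p))) =
      mcoeff (f * mderiv x h) m"
  proof -
    have "(\<Sum>p | fst p + snd p = add_mset x m. c (snd p) * (mcoeff f (fst p) * mcoeff h (snd p))) =
        (\<Sum>p | fst p + snd p = add_mset x m \<and> x \<in># snd p. c (snd p) * (mcoeff f (fst p) * mcoeff h (snd p)))"
      by (rule sum.mono_neutral_right) (auto simp: c_def not_in_iff)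
    also have "\<dots> = mcoeff (f * mderiv x h) m"
      unfolding mcoeff_times mcoeff_mderiv
      by (rule sum.reindex_bij_witness[of _ "\<lambda>p. (fst p, add_mset x (snd p))" "\<lambda>p. (fst p, snd p - {#x#})"])
        (auto simp: c_def algebra_simps dest!: multi_member_split)
    finally show ?thesis .
  qed
  have cc: "of_nat (Suc (count m x)) = c (fst p) + c (snd p)" if "fst p + snd p = add_mset x m" for p
  proof -
    have "count (fst p) x + count (snd p) x = Suc (count m x)"
      using arg_cong[OF that, of "\<lambda>s. count s x"] by simp
    then show ?thesis unfolding c_def by (simp only: of_nat_add [symmetric])
  qed
  have "mcoeff (mderiv x (f * h)) m = (\<Sum>p | fst p + snd p = add_mset x m.
      of_nat (Suc (count m x)) * (mcoeff f (fst p) * mcoeff h (snd p)))"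
    by (simp only: mcoeff_mderiv mcoeff_times sum_distrib_left)
  also have "\<dots> = (\<Sum>p | fst p + snd p = add_mset x m. c (fst p) * (mcoeff f (fst p) * mcoeff h (snd p)) +
      c (snd p) * (mcoeff f (fst p) * mcoeff h (snd p)))"
    by (rule sum.cong) (simp_all only: mem_Collect_eq cc distrib_right)
  finally show "mcoeff (mderiv x (f * h)) m = mcoeff (mderiv x f * h + f * mderiv x h) m"
    by (simp add: sum.distrib eq1 eq2)
qed

lemma mderiv_mconst_mult: "mderiv x (mconst c * f) = mconst c * mderiv x f"
  by (simp add: mderiv_mult)

abbreviation pw :: "('v \<Rightarrow> ('w, 'k :: comm_ring_1) mfps) \<Rightarrow> 'v multiset \<Rightarrow> ('w, 'k) mfps" where
  "pw T s \<equiv> \<Prod>x\<in>#s. T x"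

text \<open>A Leibniz rule for derivations along a multiplicative map \<open>p\<close>. It serves
  twice: with \<open>p\<close> the identity for partial derivatives, and with \<open>p\<close> the
  reduction modulo \<open>\<epsilon>\<close> and \<open>d\<close> the coefficient of
  \<open>\<epsilon>\<close>. The set \<open>X\<close> may exceed the support of \<open>s\<close>, as
  the factor \<open>count s x\<close> kills the surplus terms.\<close>

lemma derivation_prod_mset:
  fixes d :: "'a :: comm_ring_1 \<Rightarrow> 'b :: comm_ring_1" and p :: "'a \<Rightarrow> 'b"
  assumes p: "p 1 = 1" "\<And>f h. p (f * h) = p f * p h"
  assumes d: "d 1 = 0" "\<And>f h. d (f * h) = d f * p h + p f * d h"
  assumes X: "finite X" "\<And>x. x \<in># s \<Longrightarrow> x \<notin> X \<Longrightarrow> d (T x) = 0"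
  shows "d (\<Prod>x\<in>#s. T x) = (\<Sum>x\<in>X. of_nat (count s x) * (d (T x) * (\<Prod>y\<in>#s - {#x#}. p (T y))))"
  using X(2)
proof (induction s)
  case empty
  then show ?case by (simp add: d)
next
  case (add z s)
  have pp: "p (\<Prod>x\<in>#s. T x) = (\<Prod>x\<in>#s. p (T x))" for s
    by (induction s) (simp_all add: p)
  have "d (\<Prod>x\<in>#add_mset z s. T x) = d (T z) * (\<Prod>x\<in>#s. p (T x)) +
     (\<Sum>x\<in>X. of_nat (count s x) * (d (T x) * (p (T z) * (\<Prod>y\<in>#s - {#x#}. p (T y)))))"
    using add by (simp add: d pp sum_distrib_left mult_ac)
  also have "(\<Sum>x\<in>X. of_nat (count s x) * (d (T x) * (p (T z) * (\<Prod>y\<in>#s - {#x#}. p (T y))))) =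
      (\<Sum>x\<in>X. of_nat (count s x) * (d (T x) * (\<Prod>y\<in>#add_mset z s - {#x#}. p (T y))))"
  proof (rule sum.cong[OF refl])
    fix x
    show "of_nat (count s x) * (d (T x) * (p (T z) * (\<Prod>y\<in>#s - {#x#}. p (T y)))) =
      of_nat (count s x) * (d (T x) * (\<Prod>y\<in>#add_mset z s - {#x#}. p (T y)))"
    proof (cases "x \<in># s")
      case True
      then obtain s' where "s = add_mset x s'" by (blast dest: multi_member_split)
      then show ?thesis by (simp add: add_mset_commute[of z x])
    qed (simp add: not_in_iff)
  qed
  also have "d (T z) * (\<Prod>x\<in>#s. p (T x)) =
      (\<Sum>x\<in>X. if x = z then d (T x) * (\<Prod>y\<in>#add_mset z s - {#x#}. p (T y)) else 0)"
    using add.prems[of z] X(1) by (auto simp: sum.delta')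
  finally show ?case
    by (simp add: sum.distrib [symmetric] algebra_simps if_distrib cong: if_cong)
       (rule sum.cong, auto simp: algebra_simps)
qed

lemma mderiv_1 [simp]: "mderiv x 1 = 0"
  using mderiv_mconst[of x 1] by simp

lemma mderiv_pw:
  assumes "finite X" "\<And>x. x \<in># s \<Longrightarrow> x \<notin> X \<Longrightarrow> mderiv y (T x) = 0"
  shows "mderiv y (pw T s) = (\<Sum>x\<in>X. of_nat (count s x) * (mderiv y (T x) * pw T (s - {#x#})))"
  by (rule derivation_prod_mset[where p = "\<lambda>x. x"]) (use assms in \<open>auto simp: mderiv_mult\<close>)

subsection \<open>Restriction to finitely many variables\<close>

text \<open>
  Setting the variables outside \<open>A\<close> to \<open>0\<close> is a ring homomorphism that commutes with the remaining
  derivatives.  After it the infinite sums over the variables become finite, and two series agree if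
  their images agree for all large finite \<open>A\<close>.
\<close>

definition trunc :: "'v set \<Rightarrow> ('v, 'k :: comm_ring_1) mfps \<Rightarrow> ('v, 'k) mfps" where
  "trunc A f = Abs_mfps (\<lambda>m. if set_mset m \<subseteq> A then mcoeff f m else 0)"

lemma mcoeff_trunc: "mcoeff (trunc A f) m = (if set_mset m \<subseteq> A then mcoeff f m else 0)"
  by (simp add: trunc_def)

lemma trunc_cong: "(\<And>m. set_mset m \<subseteq> A \<Longrightarrow> mcoeff f m = mcoeff h m) \<Longrightarrow> trunc A f = trunc A h"
  by (rule mfps_eqI) (simp add: mcoeff_trunc)
lemma trunc_eqD: "trunc A f = trunc A h \<Longrightarrow> set_mset m \<subseteq> A \<Longrightarrow> mcoeff f m = mcoeff h m"
  using mcoeff_trunc[of A f m] mcoeff_trunc[of A h m] by simp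
lemma trunc_0D: "trunc A f = 0 \<Longrightarrow> set_mset m \<subseteq> A \<Longrightarrow> mcoeff f m = 0"
  using mcoeff_trunc[of A f m] by (simp split: if_splits)

lemma trunc_0 [simp]: "trunc A 0 = 0" by (rule mfps_eqI) (simp add: mcoeff_trunc)
lemma trunc_add: "trunc A (f + h) = trunc A f + trunc A h" by (rule mfps_eqI) (simp add: mcoeff_trunc)
lemma trunc_diff: "trunc A (f - h) = trunc A f - trunc A h" by (rule mfps_eqI) (simp add: mcoeff_trunc)
lemma trunc_uminus: "trunc A (- f) = - trunc A f" by (rule mfps_eqI) (simp add: mcoeff_trunc)
lemma trunc_sum: "trunc A (\<Sum>i\<in>I. f i) = (\<Sum>i\<in>I. trunc A (f i))"
  by (rule mfps_eqI) (simp add: mcoeff_trunc)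
lemma trunc_mconst [simp]: "trunc A (mconst c) = mconst c"
  by (rule mfps_eqI) (simp add: mcoeff_trunc mcoeff_mconst)
lemma trunc_mult: "trunc A (f * h) = trunc A f * trunc A h"
proof (rule mfps_eqI)
  fix m
  show "mcoeff (trunc A (f * h)) m = mcoeff (trunc A f * trunc A h) m"
  proof (cases "set_mset m \<subseteq> A")
    case True
    then show ?thesis
      by (auto simp: mcoeff_trunc mcoeff_times intro!: sum.cong)
  next
    case False
    then have "mcoeff (trunc A f * trunc A h) m = 0"
      unfolding mcoeff_times by (intro sum.neutral) (auto simp: mcoeff_trunc)
    then show ?thesis using False by (simp add: mcoeff_trunc)
  qed
qed
lemma trunc_mderiv: "x \<in> A \<Longrightarrow> trunc A (mderiv x f) = mderiv x (trunc A f)"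
  by (rule mfps_eqI) (auto simp: mcoeff_trunc mcoeff_mderiv)
lemma trunc_trunc [simp]: "trunc A (trunc A f) = trunc A f"
  by (rule mfps_eqI) (auto simp: mcoeff_trunc)

section \<open>Summation in \<open>complex\<close> and in \<open>complex fps\<close>\<close>

text \<open>For complex families summability is absolute summability, so the product family is
  summable and iterated summation gives its value.\<close>

lemma has_sum_product_complex:
  fixes f :: "'i \<Rightarrow> complex" and h :: "'j \<Rightarrow> complex"
  assumes f: "(f has_sum x) A" and h: "(h has_sum y) B"
  shows "((\<lambda>(a, b). f a * h b) has_sum (x * y)) (A \<times> B)"
proof (rule has_sum_SigmaI)
  show "((\<lambda>b. case (a, b) of (a, b) \<Rightarrow> f a * h b) has_sum (f a * y)) B" for a
    using has_sum_cmult_right[OF h] by simp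
  show "((\<lambda>a. f a * y) has_sum (x * y)) A"
    using has_sum_cmult_left[OF f] by simp
  have "(\<lambda>a. norm (f a)) summable_on A" "(\<lambda>b. norm (h b)) summable_on B"
    using f h by (auto simp: summable_on_iff_abs_summable_on_complex[symmetric] dest: has_sum_imp_summable)
  then have "(\<lambda>p. norm (case p of (a, b) \<Rightarrow> f a * h b)) summable_on A \<times> B"
    by (subst Infinite_Sum.abs_summable_on_Sigma_iff)
      (auto simp: norm_mult infsum_cmult_right' abs_mult intro!: summable_on_cmult_right summable_on_cmult_left)
  then show "(\<lambda>(a, b). f a * h b) summable_on A \<times> B"
    by (rule abs_summable_summable)
qed

instance complex :: sum_ring
proof
  show "inverse 2 * 2 = (1 :: complex)" by simp
qed (use has_sum_product_complex in \<open>simp add: has_sum_def\<close>)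

text \<open>Convergence in this topology means that every coefficient is eventually constant, and a
  coefficient of a sum depends only on the same coefficient of the summands.\<close>

instance fps :: (ab_group_add) topological_comm_monoid_add
proof
  fix a b :: "'a fps"
  have 1: "\<forall>\<^sub>F x in nhds a \<times>\<^sub>F nhds b. fps_nth (fst x) n = fps_nth a n" for n
  proof -
    have "((\<lambda>x. x) \<longlongrightarrow> a) (nhds a)" by (rule filterlim_ident)
    then show ?thesis
      unfolding tendsto_fps_iff eventually_prod_filter
      by (intro exI[of _ "\<lambda>x. fps_nth x n = fps_nth a n"] exI[of _ "\<lambda>_. True"]) auto
  qed
  have 2: "\<forall>\<^sub>F x in nhds a \<times>\<^sub>F nhds b. fps_nth (snd x) n = fps_nth b n" for n
  proof -
    have "((\<lambda>x. x) \<longlongrightarrow> b) (nhds b)" by (rule filterlim_ident)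
    then show ?thesis
      unfolding tendsto_fps_iff eventually_prod_filter
      by (intro exI[of _ "\<lambda>_. True"] exI[of _ "\<lambda>x. fps_nth x n = fps_nth b n"]) auto
  qed
  show "((\<lambda>x. fst x + snd x) \<longlongrightarrow> a + b) (nhds a \<times>\<^sub>F nhds b)"
  proof (rule tendsto_fpsI)
    show "\<forall>\<^sub>F x in nhds a \<times>\<^sub>F nhds b. fps_nth (fst x + snd x) n = fps_nth (a + b) n" for n
      using 1[of n] 2[of n] by eventually_elim simp
  qed
qed

lemma has_sum_fps_iff:
  fixes f :: "'i \<Rightarrow> 'a :: ab_group_add fps"
  shows "(f has_sum x) A \<longleftrightarrow>
    (\<forall>n. finite {a \<in> A. fps_nth (f a) n \<noteq> 0} \<and> fps_nth x n = (\<Sum>a | a \<in> A \<and> fps_nth (f a) n \<noteq> 0. fps_nth (f a) n))"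
  using has_sum_fpsD[of f A x] has_sum_fpsI[of A f x] by blast

lemma summable_on_fps_iff:
  fixes f :: "'i \<Rightarrow> 'a :: ab_group_add fps"
  shows "f summable_on A \<longleftrightarrow> (\<forall>n. finite {a \<in> A. fps_nth (f a) n \<noteq> 0})"
proof
  assume "\<forall>n. finite {a \<in> A. fps_nth (f a) n \<noteq> 0}"
  then have "(f has_sum Abs_fps (\<lambda>n. \<Sum>a | a \<in> A \<and> fps_nth (f a) n \<noteq> 0. fps_nth (f a) n)) A"
    unfolding has_sum_fps_iff by simp
  then show "f summable_on A" by (rule has_sum_imp_summable)
qed (auto simp: summable_on_def has_sum_fps_iff)

lemma has_sum_fps_nth:
  fixes f :: "'i \<Rightarrow> 'a :: {ab_group_add, topological_space} fps"
  assumes "(f has_sum x) A"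
  shows "((\<lambda>a. fps_nth (f a) n) has_sum fps_nth x n) A"
  using has_sum_fpsD[OF assms, of n]
  by (intro has_sum_finite_neutralI[of "{a \<in> A. fps_nth (f a) n \<noteq> 0}"]) auto

lemma has_sum_product_fps:
  fixes f :: "'i \<Rightarrow> 'a :: field fps" and h :: "'j \<Rightarrow> 'a fps"
  assumes f: "(f has_sum x) A" and h: "(h has_sum y) B"
  shows "((\<lambda>(a, b). f a * h b) has_sum (x * y)) (A \<times> B)"
proof -
  define SA where "SA n = {a \<in> A. fps_nth (f a) n \<noteq> 0}" for n
  define SB where "SB n = {b \<in> B. fps_nth (h b) n \<noteq> 0}" for n
  have fin: "finite (SA n)" "finite (SB n)" for n
    using f h by (auto simp: has_sum_fps_iff SA_def SB_def)
  have nthx: "fps_nth x i = (\<Sum>a\<in>U. fps_nth (f a) i)" if "finite U" "SA i \<subseteq> U" "U \<subseteq> A" for i U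
    using f that unfolding has_sum_fps_iff
    by (auto simp: SA_def intro!: sum.mono_neutral_left)
  have nthy: "fps_nth y i = (\<Sum>a\<in>U. fps_nth (h a) i)" if "finite U" "SB i \<subseteq> U" "U \<subseteq> B" for i U
    using h that unfolding has_sum_fps_iff
    by (auto simp: SB_def intro!: sum.mono_neutral_left)
  have main: "finite {p \<in> A \<times> B. fps_nth (f (fst p) * h (snd p)) n \<noteq> 0} \<and> fps_nth (x * y) n =
      (\<Sum>p | p \<in> A \<times> B \<and> fps_nth (f (fst p) * h (snd p)) n \<noteq> 0. fps_nth (f (fst p) * h (snd p)) n)" for n
  proof -
    \<comment> \<open>Coefficient \<open>n\<close> of a product involves only coefficients up to
      \<open>n\<close> of the factors, so the finitely many terms with a nonzero coefficient in that
      range decide everything.\<close>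
    define U where "U = (\<Union>i\<le>n. SA i)"
    define V where "V = (\<Union>i\<le>n. SB i)"
    have UV: "finite U" "finite V" "U \<subseteq> A" "V \<subseteq> B" "\<And>i. i \<le> n \<Longrightarrow> SA i \<subseteq> U" "\<And>i. i \<le> n \<Longrightarrow> SB i \<subseteq> V"
      using fin by (auto simp: U_def V_def SA_def SB_def)
    have sub: "{p \<in> A \<times> B. fps_nth (f (fst p) * h (snd p)) n \<noteq> 0} \<subseteq> U \<times> V"
    proof
      fix p assume "p \<in> {p \<in> A \<times> B. fps_nth (f (fst p) * h (snd p)) n \<noteq> 0}"
      then have p: "p \<in> A \<times> B" "fps_nth (f (fst p) * h (snd p)) n \<noteq> 0" by auto
      then obtain i where "i \<le> n" "fps_nth (f (fst p)) i * fps_nth (h (snd p)) (n - i) \<noteq> 0"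
        unfolding fps_mult_nth by (metis (no_types, lifting) atLeastAtMost_iff sum.neutral)
      then have "fst p \<in> SA i" "snd p \<in> SB (n - i)"
        using p(1) by (auto simp: SA_def SB_def)
      moreover have "i \<le> n" "n - i \<le> n" using \<open>i \<le> n\<close> by auto
      ultimately show "p \<in> U \<times> V"
        unfolding U_def V_def mem_Times_iff by blast
    qed
    have "fps_nth (x * y) n = (\<Sum>i=0..n. (\<Sum>a\<in>U. fps_nth (f a) i) * (\<Sum>b\<in>V. fps_nth (h b) (n - i)))"
      unfolding fps_mult_nth by (intro sum.cong arg_cong2[where f = "(*)"] nthx nthy refl UV) auto
    also have "\<dots> = (\<Sum>i=0..n. \<Sum>p\<in>U \<times> V. fps_nth (f (fst p)) i * fps_nth (h (snd p)) (n - i))"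
      by (simp add: sum_product sum.cartesian_product case_prod_unfold)
    also have "\<dots> = (\<Sum>p\<in>U \<times> V. fps_nth (f (fst p) * h (snd p)) n)"
      unfolding fps_mult_nth by (rule sum.swap)
    also have "\<dots> = (\<Sum>p | p \<in> A \<times> B \<and> fps_nth (f (fst p) * h (snd p)) n \<noteq> 0. fps_nth (f (fst p) * h (snd p)) n)"
      using sub UV by (intro sum.mono_neutral_right) auto
    finally show ?thesis
      using sub UV by (auto intro: finite_subset)
  qed
  show ?thesis
    unfolding has_sum_fps_iff case_prod_unfold using main by blast
qed

instance fps :: (field_char_0) sum_ring
proof
  have "inverse (fps_const 2) * fps_const 2 = (1 :: 'a fps)"
    by (simp only: fps_const_inverse fps_const_mult) simp
  then show "inverse 2 * 2 = (1 :: 'a fps)"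
    by (simp only: fps_numeral_fps_const [symmetric])
qed (use has_sum_product_fps in \<open>simp add: has_sum_def\<close>)

section \<open>Substitution\<close>

lemma countable_multisets [simp]: "countable (UNIV :: 'v :: countable multiset set)"
proof -
  have "range mset = (UNIV :: 'v multiset set)" by (metis ex_mset surj_def)
  then show ?thesis by (metis countable_image countableI_type)
qed

section \<open>Composition of series, with possibly infinite sums over monomials\<close>

definition comp_ok :: "('v, 'k :: sum_ring) mfps \<Rightarrow> ('v \<Rightarrow> ('w, 'k) mfps) \<Rightarrow> bool" where
  "comp_ok F T \<longleftrightarrow> (\<forall>m. (\<lambda>s. mcoeff F s * mcoeff (pw T s) m) summable_on UNIV)"

definition mcomp :: "('v, 'k :: sum_ring) mfps \<Rightarrow> ('v \<Rightarrow> ('w, 'k) mfps) \<Rightarrow> ('w, 'k) mfps" where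
  "mcomp F T = Abs_mfps (\<lambda>m. \<Sum>\<^sub>\<infinity>s. mcoeff F s * mcoeff (pw T s) m)"

text \<open>Convergence and value in one predicate, so that the closure rules below establish both
  at once.\<close>

definition has_comp :: "('v, 'k :: sum_ring) mfps \<Rightarrow> ('v \<Rightarrow> ('w, 'k) mfps) \<Rightarrow> ('w, 'k) mfps \<Rightarrow> bool" where
  "has_comp F T G \<longleftrightarrow> (\<forall>m. ((\<lambda>s. mcoeff F s * mcoeff (pw T s) m) has_sum mcoeff G m) UNIV)"

lemma has_comp_iff: "has_comp F T G \<longleftrightarrow> comp_ok F T \<and> mcomp F T = G"
  unfolding has_comp_def comp_ok_def mcomp_def
  by (auto simp: has_sum_iff intro: mfps_eqI)

lemma has_comp_unique: "has_comp F T G \<Longrightarrow> has_comp F T G' \<Longrightarrow> G = G'"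
  by (simp add: has_comp_iff)

lemma has_comp_mcomp: "comp_ok F T \<Longrightarrow> has_comp F T (mcomp F T)"
  by (simp add: has_comp_iff)

lemma has_comp_add: "has_comp F T G \<Longrightarrow> has_comp F' T G' \<Longrightarrow> has_comp (F + F') T (G + G')"
  by (auto simp: has_comp_def distrib_right intro!: has_sum_add)

lemma has_comp_0: "has_comp 0 T 0"
  by (auto simp: has_comp_def)

lemma has_comp_sum:
  "(\<And>a. a \<in> A \<Longrightarrow> has_comp (F a) T (G a)) \<Longrightarrow> has_comp (\<Sum>a\<in>A. F a) T (\<Sum>a\<in>A. G a)"
  by (induction A rule: infinite_finite_induct) (auto intro: has_comp_add has_comp_0)

lemma has_comp_mconst: "has_comp (mconst c) T (mconst c)"
  unfolding has_comp_def
  by (intro allI has_sum_finite_neutralI[of "{{#}}"]) (auto simp: mcoeff_mconst mcoeff_1)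

lemma has_comp_mvar: "has_comp (mvar x) T (T x)"
  unfolding has_comp_def
  by (intro allI has_sum_finite_neutralI[of "{{#x#}}"]) (auto simp: mcoeff_mvar)

text \<open>The map \<open>pw T\<close> turns sums of multisets into products. The product of the
  two infinite sums is a sum over pairs of multisets, which is regrouped by the sum of the pair;
  every group is finite and adds up to one coefficient of \<open>F * F'\<close>.\<close>

lemma has_comp_mult:
  fixes F F' :: "('v :: countable, 'k :: sum_ring) mfps"
  assumes F: "has_comp F T G" and F': "has_comp F' T G'"
  shows "has_comp (F * F') T (G * G')"
  unfolding has_comp_def
proof
  fix m
  define h where "h p = mcoeff F (fst p) * mcoeff F' (snd p) * mcoeff (pw T (fst p + snd p)) m" for p
  have "((\<lambda>q. \<Sum>p | fst p + snd p = m.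
      (mcoeff F (fst q) * mcoeff (pw T (fst q)) (fst p)) * (mcoeff F' (snd q) * mcoeff (pw T (snd q)) (snd p)))
      has_sum mcoeff (G * G') m) (UNIV \<times> UNIV)"
    unfolding mcoeff_times
  proof (rule has_sum_sum)
    fix p assume "p \<in> {p. fst p + snd p = m}"
    show "((\<lambda>q. (mcoeff F (fst q) * mcoeff (pw T (fst q)) (fst p)) * (mcoeff F' (snd q) * mcoeff (pw T (snd q)) (snd p)))
      has_sum mcoeff G (fst p) * mcoeff G' (snd p)) (UNIV \<times> UNIV)"
      using has_sum_product[of "\<lambda>s. mcoeff F s * mcoeff (pw T s) (fst p)" UNIV _
          "\<lambda>s. mcoeff F' s * mcoeff (pw T s) (snd p)" UNIV] F F'
      unfolding has_comp_def case_prod_unfold by simp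
  qed
  also have "(\<lambda>q. \<Sum>p | fst p + snd p = m.
      (mcoeff F (fst q) * mcoeff (pw T (fst q)) (fst p)) * (mcoeff F' (snd q) * mcoeff (pw T (snd q)) (snd p))) = h"
    by (auto simp: h_def mcoeff_times sum_distrib_left mult_ac intro!: sum.cong)
  finally have "(h has_sum mcoeff (G * G') m) UNIV" by simp
  also have "UNIV = snd ` (SIGMA s:UNIV. {p. fst p + snd p = (s :: 'v multiset)})"
    by (force simp: image_iff)
  finally have "((\<lambda>q. h (snd q)) has_sum mcoeff (G * G') m) (SIGMA s:UNIV. {p. fst p + snd p = (s :: 'v multiset)})"
    by (subst (asm) has_sum_reindex) (auto simp: inj_on_def o_def)
  then show "((\<lambda>s. mcoeff (F * F') s * mcoeff (pw T s) m) has_sum mcoeff (G * G') m) UNIV"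
  proof (rule has_sum_SigmaD)
    fix s :: "'v multiset"
    show "((\<lambda>p. h (snd (s, p))) has_sum mcoeff (F * F') s * mcoeff (pw T s) m) {p. fst p + snd p = s}"
      by (rule has_sum_finiteI) (auto simp: h_def mcoeff_times sum_distrib_right intro!: sum.cong)
  qed
qed

lemma has_comp_mconst_mult:
  fixes F :: "('v :: countable, 'k :: sum_ring) mfps"
  shows "has_comp F T G \<Longrightarrow> has_comp (mconst c * F) T (mconst c * G)"
  by (intro has_comp_mult has_comp_mconst)

lemma has_comp_diff:
  fixes F :: "('v :: countable, 'k :: sum_ring) mfps"
  assumes "has_comp F T G" "has_comp F' T G'"
  shows "has_comp (F - F') T (G - G')"
proof -
  have "F - F' = F + mconst (-1) * F'" "G - G' = G + mconst (-1) * G'"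
    by (simp_all add: mconst_uminus)
  moreover have "has_comp (F + mconst (-1) * F') T (G + mconst (-1) * G')"
    using assms by (intro has_comp_add has_comp_mconst_mult)
  ultimately show ?thesis by (simp only:)
qed

lemma mcoeff_pw_mvar: "mcoeff (pw mvar s) m = (if m = s then 1 else 0)"
proof (induction s arbitrary: m)
  case empty
  then show ?case by (simp add: mcoeff_1)
next
  case (add x s)
  then show ?case by (auto simp: mcoeff_mvar_mult)
qed

lemma has_comp_ident: "has_comp F mvar F"
  unfolding has_comp_def
  by (intro allI, rule_tac B = "{m}" in has_sum_finite_neutralI) (auto simp: mcoeff_pw_mvar)

text \<open>Substitutions for which every coefficient of a composite is a finite sum, so that
  anything may be composed with them. Based points have this property; \<open>T\<close> fails it
  when it has constant terms.\<close>

definition finitary :: "('v \<Rightarrow> ('w, 'k :: comm_ring_1) mfps) \<Rightarrow> bool" where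
  "finitary T \<longleftrightarrow> (\<forall>m. finite {s. mcoeff (pw T s) m \<noteq> 0})"

lemma finitary_comp_ok: "finitary T \<Longrightarrow> comp_ok F T"
  unfolding comp_ok_def finitary_def
  by (auto intro!: finite_nonzero_values_imp_summable_on elim: rev_finite_subset)

text \<open>Because \<open>U\<close> is finitary, a coefficient of any composite with
  \<open>U\<close> is a combination of coefficients over one fixed finite set \<open>A\<close>. The
  infinite sum defining \<open>F \<circ> T\<close> can be exchanged with this finite one.\<close>

lemma has_comp_compose:
  fixes F :: "('v :: countable, 'k :: sum_ring) mfps" and T :: "'v \<Rightarrow> ('w :: countable, 'k) mfps"
  assumes F: "has_comp F T G" and U: "finitary U"
  shows "has_comp F (\<lambda>x. mcomp (T x) U) (mcomp G U)"
  unfolding has_comp_def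
proof
  fix m
  define A where "A = {s. mcoeff (pw U s) m \<noteq> 0}"
  have fin: "finite A" using U by (auto simp: A_def finitary_def)
  have ok: "comp_ok f U" for f using U by (rule finitary_comp_ok)
  have val: "mcoeff (mcomp f U) m = (\<Sum>s\<in>A. mcoeff f s * mcoeff (pw U s) m)" for f
  proof -
    have "((\<lambda>s. mcoeff f s * mcoeff (pw U s) m) has_sum (\<Sum>s\<in>A. mcoeff f s * mcoeff (pw U s) m)) UNIV"
      using fin by (intro has_sum_finite_neutralI[of A]) (auto simp: A_def)
    moreover have "((\<lambda>s. mcoeff f s * mcoeff (pw U s) m) has_sum mcoeff (mcomp f U) m) UNIV"
      using has_comp_mcomp[OF ok[of f]] unfolding has_comp_def by blast
    ultimately show ?thesis by (rule has_sum_unique[symmetric])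
  qed
  have pw: "mcomp (pw T s) U = pw (\<lambda>x. mcomp (T x) U) s" for s
  proof (induction s)
    case empty
    then show ?case using has_comp_mconst[of 1 U] by (simp add: has_comp_iff)
  next
    case (add x s)
    have "has_comp (T x * pw T s) U (mcomp (T x) U * mcomp (pw T s) U)"
      by (intro has_comp_mult has_comp_mcomp ok)
    then show ?case using add by (simp add: has_comp_iff)
  qed
  have "((\<lambda>s. \<Sum>s'\<in>A. mcoeff (pw U s') m * (mcoeff F s * mcoeff (pw T s) s')) has_sum
       (\<Sum>s'\<in>A. mcoeff (pw U s') m * mcoeff G s')) UNIV"
    using F unfolding has_comp_def by (intro has_sum_sum has_sum_cmult) auto
  also have "(\<Sum>s'\<in>A. mcoeff (pw U s') m * mcoeff G s') = mcoeff (mcomp G U) m"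
    by (simp add: val mult.commute)
  also have "(\<lambda>s. \<Sum>s'\<in>A. mcoeff (pw U s') m * (mcoeff F s * mcoeff (pw T s) s')) =
      (\<lambda>s. mcoeff F s * mcoeff (pw (\<lambda>x. mcomp (T x) U) s) m)"
    by (simp add: pw[symmetric] val sum_distrib_left mult_ac)
  finally show "((\<lambda>s. mcoeff F s * mcoeff (pw (\<lambda>x. mcomp (T x) U) s) m) has_sum mcoeff (mcomp G U) m) UNIV" .
qed

text \<open>Differentiating the monomial \<open>s\<close> by \<open>x\<close> leaves
  \<open>s - {#x#}\<close> with the factor \<open>count s x\<close>. Adding \<open>x\<close> is a
  bijection onto the multisets containing \<open>x\<close>, and on all others the factor
  vanishes.\<close>

lemma has_sum_mderiv_reindex:
  fixes F :: "('v, 'k :: sum_ring) mfps"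
  shows "((\<lambda>s. of_nat (count s x) * mcoeff F s * a (s - {#x#})) has_sum c) UNIV \<longleftrightarrow>
    ((\<lambda>s. mcoeff (mderiv x F) s * a s) has_sum c) UNIV"
proof -
  have "((\<lambda>s. of_nat (count s x) * mcoeff F s * a (s - {#x#})) has_sum c) UNIV \<longleftrightarrow>
      ((\<lambda>s. of_nat (count s x) * mcoeff F s * a (s - {#x#})) has_sum c) (range (add_mset x))"
  proof (rule has_sum_cong_neutral)
    fix s assume "s \<in> UNIV - range (add_mset x)"
    then have "x \<notin># s" by (auto dest!: multi_member_split)
    then show "of_nat (count s x) * mcoeff F s * a (s - {#x#}) = 0" by (simp add: not_in_iff)
  qed auto
  also have "\<dots> \<longleftrightarrow> ((\<lambda>s. mcoeff (mderiv x F) s * a s) has_sum c) UNIV"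
    by (subst has_sum_reindex) (auto simp: o_def mcoeff_mderiv inj_on_def)
  finally show ?thesis .
qed

text \<open>
  Absolute convergence of \<open>F \<circ> T\<close> at one point does not give convergence of \<open>(\<partial>F) \<circ> T\<close>; it does
  here because all Taylor coefficients of \<open>F \<circ> T\<close> converge.  The linear part of \<open>T\<close> is
  unitriangular, which allows to solve for the derivatives by induction on the rank.
\<close>

lemma comp_ok_mderiv:
  fixes F :: "('v :: countable, 'k :: sum_ring) mfps" and r :: "'v \<Rightarrow> nat"
  assumes ok: "comp_ok F T"
    and lin: "\<And>x y. mderiv y (T x) = mconst (l x y)"
    and fin: "\<And>y. finite {x. l x y \<noteq> 0}"
    and diag: "\<And>x. l x x = 1"
    and tri: "\<And>x y. l x y \<noteq> 0 \<Longrightarrow> x \<noteq> y \<Longrightarrow> r x < r y"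
  shows "comp_ok (mderiv y F) T"
    and "mderiv y (mcomp F T) = (\<Sum>x | l x y \<noteq> 0. mconst (l x y) * mcomp (mderiv x F) T)"
proof -
  have expand: "of_nat (Suc (count m y)) * (mcoeff F s * mcoeff (pw T s) (add_mset y m)) =
      (\<Sum>x | l x y \<noteq> 0. l x y * (of_nat (count s x) * mcoeff F s * mcoeff (pw T (s - {#x#})) m))" for y m s
  proof -
    have "mderiv y (pw T s) = (\<Sum>x | l x y \<noteq> 0. of_nat (count s x) * (mderiv y (T x) * pw T (s - {#x#})))"
      by (rule mderiv_pw) (use fin lin in auto)
    then have "mcoeff F s * mcoeff (mderiv y (pw T s)) m =
       (\<Sum>x | l x y \<noteq> 0. l x y * (of_nat (count s x) * mcoeff F s * mcoeff (pw T (s - {#x#})) m))"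
      by (simp add: lin sum_distrib_left mult_ac)
    then show ?thesis by (simp add: mcoeff_mderiv mult_ac)
  qed
  have lhs: "((\<lambda>s. of_nat (Suc (count m y)) * (mcoeff F s * mcoeff (pw T s) (add_mset y m))) has_sum
      mcoeff (mderiv y (mcomp F T)) m) UNIV" for y m
    using has_comp_mcomp[OF ok] unfolding has_comp_def mcoeff_mderiv by (intro has_sum_cmult) auto
  show ok': "comp_ok (mderiv y F) T" for y
  proof (induction y rule: measure_induct_rule[of r])
    case (less y)
    show ?case unfolding comp_ok_def
    proof
      fix m
      let ?X = "{x. l x y \<noteq> 0}"
      let ?a = "\<lambda>x s. of_nat (count s x) * mcoeff F s * mcoeff (pw T (s - {#x#})) m"
      define c where "c x = mcoeff (mcomp (mderiv x F) T) m" for x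
      have c: "(?a x has_sum c x) UNIV" if "x \<in> ?X - {y}" for x
      proof -
        have "comp_ok (mderiv x F) T" using less tri that by auto
        then show ?thesis
          unfolding has_sum_mderiv_reindex[where a = "\<lambda>s. mcoeff (pw T s) m"] c_def using has_comp_mcomp unfolding has_comp_def by blast
      qed
      \<comment> \<open>The coefficient of \<open>F \<circ> T\<close> at \<open>add_mset y m\<close>
        converges by assumption. Subtracting the terms of all \<open>x\<close> of smaller rank,
        which converge by induction, leaves exactly the term of \<open>y\<close>, since
        \<open>l y y\<close> is 1.\<close>
      have "((\<lambda>s. of_nat (Suc (count m y)) * (mcoeff F s * mcoeff (pw T s) (add_mset y m)) +
          (\<Sum>x\<in>?X - {y}. - l x y * ?a x s)) has_sum
          mcoeff (mderiv y (mcomp F T)) m + (\<Sum>x\<in>?X - {y}. - l x y * c x)) UNIV"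
        by (intro has_sum_add lhs has_sum_sum has_sum_cmult c) auto
      also have "(\<lambda>s. of_nat (Suc (count m y)) * (mcoeff F s * mcoeff (pw T s) (add_mset y m)) +
          (\<Sum>x\<in>?X - {y}. - l x y * ?a x s)) = ?a y"
        unfolding expand using fin[of y] diag[of y]
        by (subst sum.remove[of ?X y]) (auto simp: sum_negf)
      finally show "(\<lambda>s. mcoeff (mderiv y F) s * mcoeff (pw T s) m) summable_on UNIV"
        unfolding has_sum_mderiv_reindex[where a = "\<lambda>s. mcoeff (pw T s) m"] by (rule has_sum_imp_summable)
    qed
  qed
  show "mderiv y (mcomp F T) = (\<Sum>x | l x y \<noteq> 0. mconst (l x y) * mcomp (mderiv x F) T)"
  proof (rule mfps_eqI)
    fix m
    have "((\<lambda>s. \<Sum>x | l x y \<noteq> 0. l x y * (of_nat (count s x) * mcoeff F s * mcoeff (pw T (s - {#x#})) m)) has_sum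
        (\<Sum>x | l x y \<noteq> 0. l x y * mcoeff (mcomp (mderiv x F) T) m)) UNIV"
    proof (intro has_sum_sum has_sum_cmult)
      fix x
      show "((\<lambda>s. of_nat (count s x) * mcoeff F s * mcoeff (pw T (s - {#x#})) m) has_sum
        mcoeff (mcomp (mderiv x F) T) m) UNIV"
        unfolding has_sum_mderiv_reindex[where a = "\<lambda>s. mcoeff (pw T s) m"] using has_comp_mcomp[OF ok'] unfolding has_comp_def by blast
    qed auto
    from has_sum_unique[OF lhs[of m y, unfolded expand] this]
    show "mcoeff (mderiv y (mcomp F T)) m = mcoeff (\<Sum>x | l x y \<noteq> 0. mconst (l x y) * mcomp (mderiv x F) T) m"
      by simp
  qed
qed

section \<open>Linear changes of the variables\<close>

definition vars :: "nat \<Rightarrow> 'n var set" where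
  "vars N = {..N} \<times> UNIV"

definition up :: "nat \<Rightarrow> 'n var \<Rightarrow> 'n var" where
  "up d y = (fst y + d, snd y)"

definition q :: "'n \<Rightarrow> 'n var \<Rightarrow> ('n, 'k :: comm_ring_1) fun_t" where
  "q e x = qvar e (fst x) (snd x)"

text \<open>The left-hand sides of DE (\<open>d = 0\<close>) and SE (\<open>d = 1\<close>) as one
  family; \<open>d\<close> is the power of \<open>z^-1\<close> applied to \<open>q\<close>.\<close>

definition euler :: "'n :: finite \<Rightarrow> nat \<Rightarrow> ('n, 'k :: {comm_ring_1, t2_space}) fun_t \<Rightarrow> ('n, 'k) fun_t" where
  "euler e d F = msum (\<lambda>i. \<Sum>\<alpha>\<in>UNIV. qvar e (i + d) \<alpha> * mderiv (i, \<alpha>) F) UNIV"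

lemma finite_vars [simp]: "finite (vars N :: 'n :: finite var set)"
  by (simp add: vars_def)

lemma mem_vars [simp]: "x \<in> vars N \<longleftrightarrow> fst x \<le> N"
  by (cases x) (simp add: vars_def)

text \<open>The bound \<open>N \<ge> 1\<close> keeps the dilaton variable \<open>(1, e)\<close>
  inside \<open>vars N\<close>. At \<open>N = 0\<close> the truncation of \<open>q e (1, e)\<close>
  would be the constant -1, and variables outside \<open>vars N\<close> could no longer be
  dropped.\<close>

lemma vars_exhaust: "\<exists>N\<ge>1. set_mset (m :: 'n var multiset) \<subseteq> vars N"
proof (induction m)
  case (add x m)
  then obtain N where "N \<ge> 1" "set_mset m \<subseteq> vars N" by blast
  then show ?case by (intro exI[of _ "max N (fst x)"]) force
qed auto

lemma trunc_eqI:
  assumes "\<And>N. N \<ge> 1 \<Longrightarrow> K \<le> N \<Longrightarrow> trunc (vars N) f = trunc (vars N) h"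
  shows "f = h"
proof (rule mfps_eqI)
  fix m :: "'a var multiset"
  obtain N where N: "N \<ge> 1" "set_mset m \<subseteq> vars N" using vars_exhaust by blast
  have "set_mset m \<subseteq> vars (max N K)" using N by force
  then show "mcoeff f m = mcoeff h m"
    using trunc_eqD[OF assms[of "max N K"]] N by simp
qed

lemma sum_vars_cong_neutral:
  assumes "\<And>x. fst x \<le> M \<Longrightarrow> fst x > N \<Longrightarrow> f x = 0" "N \<le> M"
  shows "sum f (vars N) = sum f (vars M :: 'n :: finite var set)"
  by (rule sum.mono_neutral_left) (use assms in \<open>auto simp: not_le\<close>)

lemma sum_vars: "sum f (vars N) = (\<Sum>i\<le>N. \<Sum>\<alpha>\<in>UNIV. f (i, \<alpha> :: 'n :: finite))"
  by (simp add: vars_def sum.cartesian_product)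

lemma mcoeff_msum_finite:
  fixes f :: "'i \<Rightarrow> ('v, 'k :: {comm_ring_1, t2_space}) mfps"
  assumes "finite B" "B \<subseteq> A" "\<And>i. i \<in> A - B \<Longrightarrow> mcoeff (f i) m = 0"
  shows "mcoeff (msum f A) m = (\<Sum>i\<in>B. mcoeff (f i) m)"
proof -
  have "(\<Sum>\<^sub>\<infinity>i\<in>A. mcoeff (f i) m) = (\<Sum>\<^sub>\<infinity>i\<in>B. mcoeff (f i) m)"
    by (rule infsum_cong_neutral) (use assms in auto)
  then show ?thesis using assms by (simp add: msum_def)
qed


lemma mcoeff_q:
  "mcoeff (q e x :: ('n, 'k :: comm_ring_1) fun_t) m = (if m = {#x#} then 1 else if m = {#} \<and> x = (1, e) then -1 else 0)"
  by (auto simp: q_def qvar_def mcoeff_mvar dilaton_def mcoeff_1)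

lemma q_outside: "N \<ge> 1 \<Longrightarrow> fst x > N \<Longrightarrow> trunc (vars N) (q e x) = 0"
  by (rule mfps_eqI) (auto simp: mcoeff_trunc mcoeff_q)

lemma q_inside: "fst x \<le> N \<Longrightarrow> trunc (vars N) (q e x) = q e x"
  by (rule mfps_eqI) (auto simp: mcoeff_trunc mcoeff_q)

lemma mderiv_q: "mderiv y (q e x) = (if x = y then 1 else 0)"
  by (auto simp: q_def qvar_def mderiv_diff mderiv_mvar dilaton_def)

lemma trunc_euler:
  fixes F :: "('n :: finite, 'k :: {comm_ring_1, t2_space}) fun_t"
  assumes N: "N \<ge> 1"
  shows "trunc (vars N) (euler e d F) = trunc (vars N) (\<Sum>y\<in>vars N. q e (up d y) * mderiv y F)"
proof (rule trunc_cong)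
  fix m :: "'n var multiset" assume m: "set_mset m \<subseteq> vars N"
  let ?f = "\<lambda>i. \<Sum>\<alpha>\<in>UNIV. qvar e (i + d) \<alpha> * mderiv (i, \<alpha>) F"
  have "mcoeff (euler e d F) m = (\<Sum>i\<le>N. mcoeff (?f i) m)"
    unfolding euler_def
  proof (rule mcoeff_msum_finite)
    fix i assume "i \<in> UNIV - {..N}"
    then have "trunc (vars N) (qvar e (i + d) \<alpha>) = (0 :: ('n, 'k) fun_t)" for \<alpha>
      using q_outside[OF N, of "(i + d, \<alpha>)" e] by (simp add: q_def)
    then have "trunc (vars N) (?f i) = 0" by (simp add: trunc_sum trunc_mult)
    then show "mcoeff (?f i) m = 0" using m by (rule trunc_0D)
  qed auto
  then show "mcoeff (euler e d F) m = mcoeff (\<Sum>y\<in>vars N. q e (up d y) * mderiv y F) m"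
    by (simp add: sum_vars q_def up_def)
qed

lemma euler_add:
  fixes F :: "('n :: finite, 'k :: {comm_ring_1, t2_space}) fun_t"
  shows "euler e d (F + H) = euler e d F + euler e d H"
  by (rule trunc_eqI[of 0])
    (simp add: trunc_euler trunc_add mderiv_add distrib_left sum.distrib)

text \<open>Summation by parts: the index shift on coefficients is adjoint to the shift on
  \<open>q\<close>. The top \<open>d\<close> levels on the right have no partner, but there the
  shifted \<open>q\<close> is truncated to zero.\<close>

lemma shift_sum:
  fixes c :: "'n :: finite var \<Rightarrow> ('n, 'k :: comm_ring_1) fun_t"
  assumes N: "N \<ge> 1"
  shows "(\<Sum>y\<in>vars N. (if d \<le> fst y then c (fst y - d, snd y) else 0) * q e y) =
    (\<Sum>y\<in>vars N. c y * trunc (vars N) (q e (up d y)))"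
proof -
  have "(\<Sum>y\<in>vars N. (if d \<le> fst y then c (fst y - d, snd y) else 0) * q e y) =
      (\<Sum>y | fst y \<le> N \<and> d \<le> fst y. c (fst y - d, snd y) * q e y)"
  proof (rule sum.mono_neutral_cong_right)
    show "{y :: 'n var. fst y \<le> N \<and> d \<le> fst y} \<subseteq> vars N" by auto
  qed auto
  also have "\<dots> = (\<Sum>y | fst y + d \<le> N. c y * trunc (vars N) (q e (up d y)))"
    by (rule sum.reindex_bij_witness[of _ "up d" "\<lambda>y. (fst y - d, snd y)"])
      (auto simp: up_def q_inside)
  also have "\<dots> = (\<Sum>y\<in>vars N. c y * trunc (vars N) (q e (up d y)))"
  proof (rule sum.mono_neutral_left)
    show "{y :: 'n var. fst y + d \<le> N} \<subseteq> vars N" by auto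
  qed (use N in \<open>auto simp: up_def q_outside not_le\<close>)
  finally show ?thesis .
qed

lemma matrix_axis: "(A *v axis j 1) $ i = (A :: 'k :: comm_ring_1 ^ 'n ^ 'm) $ i $ j"
  by (simp add: matrix_vector_mult_def axis_def if_distrib cong: if_cong)

lemma axis_sum: "(\<Sum>i\<in>UNIV. axis k 1 $ i * x $ i) = (x :: 'k :: comm_ring_1 ^ 'm) $ k"
  by (simp add: axis_def if_distrib if_distribR cong: if_cong)

locale lin_subst =
  fixes R :: "nat \<Rightarrow> 'k :: sum_ring ^ 'n ^ 'n" and e :: "'n :: finite"
  assumes R0: "R 0 = mat 1"
begin

text \<open>The entry of the matrix of \<open>q \<mapsto> [R q]_+\<close>: the coefficient of
  \<open>z^k\<close> in \<open>R q\<close> is the sum of all \<open>R_i q_(k+i)\<close>.\<close>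

definition l :: "'n var \<Rightarrow> 'n var \<Rightarrow> 'k" where
  "l x y = (if fst x \<le> fst y then R (fst y - fst x) $ snd x $ snd y else 0)"

text \<open>Linear in \<open>q\<close>, hence only affine in \<open>t\<close>: the dilaton shift
  contributes the constant term found in \<open>mcoeff_L\<close>.\<close>

definition L :: "'n var \<Rightarrow> ('n, 'k) fun_t" where
  "L x = qpart (fam_act R (univ_point e)) (fst x) (snd x)"

text \<open>A series in \<open>t\<close> must be fed values of \<open>t\<close>, so the dilaton
  shift is undone after multiplication by \<open>R\<close>.\<close>

definition T :: "'n var \<Rightarrow> ('n, 'k) fun_t" where
  "T x = L x + dilaton e x"

lemma univ_point_empty: "univ_point e {#} = (\<lambda>k. if k = 1 then - axis e 1 else (0 :: 'k ^ 'n))"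
  by (auto simp: univ_point_def fun_eq_iff vec_eq_iff qvar_def mcoeff_mvar dilaton_def mcoeff_1 axis_def
      nat_eq_iff)

lemma univ_point_single:
  "univ_point e {#(n, \<alpha>)#} = (\<lambda>k. if k = int n then axis \<alpha> 1 else (0 :: 'k ^ 'n))"
  by (auto simp: univ_point_def fun_eq_iff vec_eq_iff qvar_def mcoeff_mvar dilaton_def mcoeff_1 axis_def)

lemma univ_point_else: "size m \<noteq> 0 \<Longrightarrow> size m \<noteq> 1 \<Longrightarrow> univ_point e m = (\<lambda>k. (0 :: 'k ^ 'n))"
  by (auto simp: univ_point_def fun_eq_iff vec_eq_iff qvar_def mcoeff_mvar dilaton_def mcoeff_1)

lemma lact_single:
  "lact A (\<lambda>k. if k = int n then v else 0) (int j) = (if j \<le> n then A (n - j) *v v else (0 :: 'k ^ 'n))"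
proof (cases "j \<le> n \<and> v \<noteq> 0")
  case True
  then have "{i. (if int j + int i = int n then v else 0) \<noteq> 0} = {n - j}" by auto
  then show ?thesis using True unfolding lact_def by simp
next
  case False
  then have "{i. (if int j + int i = int n then v else 0) \<noteq> 0} = {}" by auto
  then show ?thesis using False unfolding lact_def by auto
qed

lemma mcoeff_L:
  "mcoeff (L x) {#} = - l x (1, e)"
  "mcoeff (L x) {#y#} = l x y"
  "size m \<noteq> 0 \<Longrightarrow> size m \<noteq> 1 \<Longrightarrow> mcoeff (L x) m = 0"
proof -
  have axis': "(A *v (- axis \<alpha> 1)) $ \<mu> = - A $ \<mu> $ \<alpha>" for A :: "'k ^ 'n ^ 'n" and \<mu> \<alpha>
    by (simp add: matrix_vector_mult_def axis_def if_distrib cong: if_cong)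
  show "mcoeff (L x) {#} = - l x (1, e)"
    using lact_single[of R 1 "- axis e 1" "fst x"]
    by (simp add: L_def qpart_def fam_act_def univ_point_empty l_def axis')
  show "mcoeff (L x) {#y#} = l x y"
    using lact_single[of R "fst y" "axis (snd y) 1" "fst x"] univ_point_single[of "fst y" "snd y"]
    by (simp add: L_def qpart_def fam_act_def l_def matrix_axis)
  show "size m \<noteq> 0 \<Longrightarrow> size m \<noteq> 1 \<Longrightarrow> mcoeff (L x) m = 0"
    by (simp add: L_def qpart_def fam_act_def univ_point_else lact_def)
qed

text \<open>Entries depend on levels only through their difference, which is how multiplication by
  \<open>R\<close> commuting with \<open>z^-1\<close> appears in coordinates.\<close>

lemma l_up: "l (up d x) y = (if d \<le> fst y then l x (fst y - d, snd y) else 0)"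
  by (auto simp: l_def up_def add.commute)

lemma l_eq_0: "fst y < fst x \<Longrightarrow> l x y = 0"
  by (simp add: l_def)

lemma l_diag: "fst x = fst y \<Longrightarrow> l x y = (if x = y then 1 else 0)"
  by (cases x; cases y) (auto simp: l_def R0 mat_def)

lemma trunc_L:
  assumes N: "N \<ge> 1"
  shows "trunc (vars N) (L x) = (\<Sum>y\<in>vars N. mconst (l x y) * q e y)"
proof (rule mfps_eqI)
  fix m :: "'n var multiset"
  show "mcoeff (trunc (vars N) (L x)) m = mcoeff (\<Sum>y\<in>vars N. mconst (l x y) * q e y) m"
  proof (cases m rule: multiset_cases_small)
    case 1
    have "(\<Sum>y\<in>vars N. l x y * (if y = (1, e) then - 1 else 0)) = - l x (1, e)"
      using N by (simp add: if_distrib cong: if_cong)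
    then show ?thesis using 1 by (simp add: mcoeff_trunc mcoeff_L mcoeff_q)
  next
    case (2 z)
    have "(\<Sum>y\<in>vars N. l x y * (if z = y then 1 else 0)) = (if z \<in> vars N then l x z else 0)"
      by (simp add: if_distrib cong: if_cong)
    moreover have "mcoeff (q e y :: ('n, 'k) fun_t) {#z#} = (if z = y then 1 else 0)" for y
      by (simp add: mcoeff_q)
    ultimately show ?thesis using 2 by (simp add: mcoeff_trunc mcoeff_L)
  next
    case 3
    then have "mcoeff (q e y :: ('n, 'k) fun_t) m = 0" for y by (auto simp: mcoeff_q)
    then show ?thesis using 3 by (simp add: mcoeff_trunc mcoeff_L)
  qed
qed

lemma L_outside: "N \<ge> 1 \<Longrightarrow> fst x > N \<Longrightarrow> trunc (vars N) (L x) = 0"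
  unfolding trunc_L by (rule sum.neutral) (auto simp: l_eq_0)

lemma T_outside: "N \<ge> 1 \<Longrightarrow> fst x > N \<Longrightarrow> trunc (vars N) (T x) = 0"
  by (cases x) (auto simp: T_def trunc_add L_outside dilaton_def)

lemma mderiv_T: "mderiv y (T x) = mconst (l x y)"
proof (rule mfps_eqI)
  fix m
  have "mcoeff (dilaton e x :: ('n, 'k) fun_t) (add_mset y m) = 0"
    by (simp add: dilaton_def mcoeff_1)
  then show "mcoeff (mderiv y (T x)) m = mcoeff (mconst (l x y)) m"
    by (cases "m = {#}") (auto simp: mcoeff_mderiv T_def mcoeff_L mcoeff_mconst)
qed

text \<open>\<open>T\<close> does not lower levels, so a factor \<open>T x\<close> with
  \<open>x\<close> above level \<open>N\<close> contributes nothing to monomials in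
  \<open>vars N\<close>. This bounds the variables of \<open>s\<close>, not its size.\<close>

lemma pw_T_outside:
  assumes "N \<ge> 1" "set_mset m \<subseteq> vars N" "mcoeff (pw T s) m \<noteq> 0"
  shows "set_mset s \<subseteq> vars N"
proof -
  have *: "trunc (vars N) (pw T s) = 0" if "\<not> set_mset s \<subseteq> vars N" for s
    using that
  proof (induction s)
    case (add x s)
    then show ?case using T_outside[OF assms(1), of x] by (cases "set_mset s \<subseteq> vars N") (auto simp: trunc_mult not_le)
  qed auto
  show ?thesis
    using *[of s] assms by (metis mcoeff_0 mcoeff_trunc)
qed

text \<open>Since \<open>R 0\<close> is the identity, \<open>l\<close> is the identity on each
  level, and elsewhere it is nonzero only from a strictly lower level \<open>fst x\<close> to a
  higher \<open>fst y\<close>. The level is thus the rank required by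
  \<open>comp_ok_mderiv\<close>.\<close>

lemma chain_rule:
  assumes "comp_ok F T"
  shows "comp_ok (mderiv y F) T"
    and "mderiv y (mcomp F T) = (\<Sum>x\<in>vars (fst y). mconst (l x y) * mcomp (mderiv x F) T)"
proof -
  have fin: "finite {x. l x y \<noteq> 0}" for y
    by (rule finite_subset[of _ "vars (fst y)"]) (use l_eq_0[of y] in \<open>force simp: not_le[symmetric]\<close>, simp)
  have tri: "fst x < fst y" if "l x y \<noteq> 0" "x \<noteq> y" for x y
    using that l_eq_0[of y x] l_diag[of x y] by (cases "fst x" "fst y" rule: linorder_cases) auto
  note * = comp_ok_mderiv[of F T l fst, OF assms mderiv_T fin _ tri]
  show "comp_ok (mderiv y F) T" using *(1) by (simp add: l_diag)
  have "mderiv y (mcomp F T) = (\<Sum>x | l x y \<noteq> 0. mconst (l x y) * mcomp (mderiv x F) T)"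
    using *(2) by (simp add: l_diag)
  also have "\<dots> = (\<Sum>x\<in>vars (fst y). mconst (l x y) * mcomp (mderiv x F) T)"
    by (rule sum.mono_neutral_left) (use l_eq_0[of y] in \<open>force simp: not_le[symmetric]\<close>)+
  finally show "mderiv y (mcomp F T) = (\<Sum>x\<in>vars (fst y). mconst (l x y) * mcomp (mderiv x F) T)" .
qed

lemma has_comp_q: "has_comp (q e x) T (L x)"
proof -
  have "has_comp (q e x) T (T x - dilaton e x)"
    unfolding q_def qvar_def prod.collapse
    by (subst (1 2) dilaton_mconst) (intro has_comp_diff has_comp_mvar has_comp_mconst)
  then show ?thesis by (simp add: T_def)
qed

text \<open>The vector field of \<open>euler e d\<close> is multiplication of \<open>q\<close> by
  \<open>z^-d\<close>, which commutes with \<open>R\<close>; hence substitution by \<open>T\<close>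
  carries the field to itself.\<close>

lemma euler_comp:
  assumes ok: "comp_ok F T"
  shows "has_comp (euler e d F) T (euler e d (mcomp F T))"
  unfolding has_comp_def
proof
  fix m :: "'n var multiset"
  obtain N where N: "N \<ge> 1" "set_mset m \<subseteq> vars N" using vars_exhaust by blast
  define A where "A x = trunc (vars N) (mcomp (mderiv x F) T)" for x
  have "has_comp (\<Sum>y\<in>vars N. q e (up d y) * mderiv y F) T (\<Sum>y\<in>vars N. L (up d y) * mcomp (mderiv y F) T)"
    by (intro has_comp_sum has_comp_mult has_comp_q has_comp_mcomp chain_rule ok)
  then have "((\<lambda>s. mcoeff (\<Sum>y\<in>vars N. q e (up d y) * mderiv y F) s * mcoeff (pw T s) m) has_sum
      mcoeff (\<Sum>y\<in>vars N. L (up d y) * mcomp (mderiv y F) T) m) UNIV"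
    unfolding has_comp_def by blast
  \<comment> \<open>Inside the infinite sum the Euler field may be replaced by its finite part: by
    \<open>pw_T_outside\<close> only monomials over \<open>vars N\<close> contribute at
    \<open>m\<close>.\<close>
  also have "(\<lambda>s. mcoeff (\<Sum>y\<in>vars N. q e (up d y) * mderiv y F) s * mcoeff (pw T s) m) =
      (\<lambda>s. mcoeff (euler e d F) s * mcoeff (pw T s) m)"
  proof
    fix s
    show "mcoeff (\<Sum>y\<in>vars N. q e (up d y) * mderiv y F) s * mcoeff (pw T s) m =
        mcoeff (euler e d F) s * mcoeff (pw T s) m"
    proof (cases "mcoeff (pw T s) m = 0")
      case False
      then have "set_mset s \<subseteq> vars N" using pw_T_outside N by blast
      then show ?thesis
        using trunc_eqD[OF trunc_euler[OF N(1), of e d F]] by simp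
    qed simp
  qed
  also have "mcoeff (\<Sum>y\<in>vars N. L (up d y) * mcomp (mderiv y F) T) m = mcoeff (euler e d (mcomp F T)) m"
  proof -
    have "trunc (vars N) (\<Sum>y\<in>vars N. L (up d y) * mcomp (mderiv y F) T) =
        (\<Sum>x\<in>vars N. (\<Sum>y\<in>vars N. mconst (l (up d x) y) * q e y) * A x)"
      using N by (simp add: trunc_sum trunc_mult trunc_L A_def)
    \<comment> \<open>Here \<open>z^-d\<close> is moved past \<open>R\<close>: the shift leaves the
      row index of \<open>l\<close> and lands on \<open>q\<close>.\<close>
    also have "\<dots> = (\<Sum>x\<in>vars N. (\<Sum>y\<in>vars N. mconst (l x y) * trunc (vars N) (q e (up d y))) * A x)"
    proof -
      have "(\<Sum>y\<in>vars N. mconst (l (up d x) y) * q e y) = (\<Sum>y\<in>vars N. mconst (l x y) * trunc (vars N) (q e (up d y)))" for x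
        unfolding shift_sum[OF N(1), symmetric] by (rule sum.cong) (auto simp: l_up)
      then show ?thesis by simp
    qed
    also have "\<dots> = (\<Sum>y\<in>vars N. trunc (vars N) (q e (up d y)) * (\<Sum>x\<in>vars N. mconst (l x y) * A x))"
      by (simp add: sum_distrib_left sum_distrib_right mult_ac) (rule sum.swap)
    also have "\<dots> = (\<Sum>y\<in>vars N. trunc (vars N) (q e (up d y)) * trunc (vars N) (mderiv y (mcomp F T)))"
    proof (rule sum.cong[OF refl])
      fix y :: "'n var" assume "y \<in> vars N"
      then have "(\<Sum>x\<in>vars (fst y). mconst (l x y) * A x) = (\<Sum>x\<in>vars N. mconst (l x y) * A x)"
        by (intro sum_vars_cong_neutral) (auto simp: l_eq_0)
      then show "trunc (vars N) (q e (up d y)) * (\<Sum>x\<in>vars N. mconst (l x y) * A x) =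
          trunc (vars N) (q e (up d y)) * trunc (vars N) (mderiv y (mcomp F T))"
        by (simp add: chain_rule(2)[OF ok] trunc_sum trunc_mult A_def)
    qed
    also have "\<dots> = trunc (vars N) (euler e d (mcomp F T))"
      by (simp only: trunc_euler[OF N(1)] trunc_sum trunc_mult)
    finally have "trunc (vars N) (\<Sum>y\<in>vars N. L (up d y) * mcomp (mderiv y F) T) =
        trunc (vars N) (euler e d (mcomp F T))" .
    then show ?thesis using N(2) by (rule trunc_eqD)
  qed
  finally show "((\<lambda>s. mcoeff (euler e d F) s * mcoeff (pw T s) m) has_sum mcoeff (euler e d (mcomp F T)) m) UNIV" .
qed

end

section \<open>The transformed function lies in \<open>GW\<^sub>0\<close>\<close>

lemma half_double: "mconst (inverse 2) * (f + f) = (f :: ('v, 'k :: sum_ring) mfps)"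
proof -
  have "mconst (inverse 2) * (f + f) = mconst (inverse 2) * (mconst 2 * f)"
    by (simp only: mconst_2 mult_2)
  also have "\<dots> = mconst (inverse 2 * 2) * f"
    by (simp only: mconst_mult mult.assoc)
  also have "\<dots> = f"
    by (simp only: inverse_two mconst_1 mult_1_left)
  finally show ?thesis .
qed

lemma half_times_2: "mconst (inverse 2) * (2 * f) = (f :: ('v, 'k :: sum_ring) mfps)"
  using half_double[of f] by (simp only: mult_2)

lemma sum4_swap:
  "(\<Sum>a\<in>A. \<Sum>b\<in>B. \<Sum>c\<in>C. \<Sum>d\<in>D. f a b c d) = (\<Sum>c\<in>C. \<Sum>d\<in>D. \<Sum>a\<in>A. \<Sum>b\<in>B. f a b c d)"
proof -
  have "(\<Sum>a\<in>A. \<Sum>b\<in>B. \<Sum>c\<in>C. \<Sum>d\<in>D. f a b c d) = (\<Sum>a\<in>A. \<Sum>c\<in>C. \<Sum>b\<in>B. \<Sum>d\<in>D. f a b c d)"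
    by (rule sum.cong[OF refl], rule sum.swap)
  also have "\<dots> = (\<Sum>c\<in>C. \<Sum>a\<in>A. \<Sum>d\<in>D. \<Sum>b\<in>B. f a b c d)"
    by (subst sum.swap, intro sum.cong refl, rule sum.swap)
  also have "\<dots> = (\<Sum>c\<in>C. \<Sum>d\<in>D. \<Sum>a\<in>A. \<Sum>b\<in>B. f a b c d)"
    by (rule sum.cong[OF refl], rule sum.swap)
  finally show ?thesis .
qed

text \<open>
  \<open>w x y\<close> is the value of \<open>(W\<^bsub>k,l\<^esub> \<phi>\<^sub>\<alpha>, \<phi>\<^sub>\<beta>)\<close> for \<open>x = (k, \<alpha>)\<close>, \<open>y = (l, \<beta>)\<close>, and \<open>l (0, \<mu>) (k, \<alpha>)\<close> is an
  entry of \<open>R k\<close>.  The proof that the transformed function is in \<open>GW\<^sub>0\<close> only uses the recursion for \<open>W\<close>.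
\<close>

locale gw_transform = lin_subst R e
  for R :: "nat \<Rightarrow> 'k :: sum_ring ^ 'n ^ 'n" and e :: "'n :: finite" +
  fixes g :: "'k ^ 'n ^ 'n" and w :: "'n var \<Rightarrow> 'n var \<Rightarrow> 'k"
  assumes g_inv: "g ** matrix_inv g = mat 1"
    and w_sym: "w x y = w y x"
    and w_rec: "(if 1 \<le> fst x then w (fst x - 1, snd x) y else 0) + (if 1 \<le> fst y then w x (fst y - 1, snd y) else 0) =
      (\<Sum>\<mu>\<in>UNIV. \<Sum>\<nu>\<in>UNIV. g $ \<mu> $ \<nu> * l (0, \<mu>) x * l (0, \<nu>) y) -
      (if fst x = 0 \<and> fst y = 0 then g $ snd x $ snd y else 0)"
begin

section \<open>The quadratic term and its behaviour under the two Euler fields\<close>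

definition quad :: "('n, 'k) fun_t" where
  "quad = msum (\<lambda>(k, l). \<Sum>\<alpha>\<in>UNIV. \<Sum>\<beta>\<in>UNIV.
     mconst (w (k, \<alpha>) (l, \<beta>)) * (q e (k, \<alpha>) * q e (l, \<beta>))) UNIV"

definition half_quad :: "('n, 'k) fun_t" where
  "half_quad = mconst (inverse 2) * quad"

lemma trunc_quad:
  assumes N: "N \<ge> 1"
  shows "trunc (vars N) quad =
    (\<Sum>x\<in>vars N. \<Sum>y\<in>vars N. mconst (w x y) * (q e x * q e y))"
proof (rule mfps_eqI)
  fix m :: "'n var multiset"
  let ?V = "vars N :: 'n var set"
  let ?h = "\<lambda>k l. \<Sum>\<alpha>\<in>UNIV. \<Sum>\<beta>\<in>UNIV. mconst (w (k, \<alpha>) (l, \<beta>)) * (q e (k, \<alpha>) * q e (l, \<beta>))"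
  let ?f = "\<lambda>(k, l). ?h k l"
  have rhs: "trunc ?V (\<Sum>x\<in>?V. \<Sum>y\<in>?V. mconst (w x y) * (q e x * q e y)) =
    (\<Sum>x\<in>?V. \<Sum>y\<in>?V. mconst (w x y) * (q e x * q e y))"
    by (auto simp: trunc_sum trunc_mult q_inside intro!: sum.cong)
  show "mcoeff (trunc ?V quad) m = mcoeff (\<Sum>x\<in>?V. \<Sum>y\<in>?V. mconst (w x y) * (q e x * q e y)) m"
  proof (cases "set_mset m \<subseteq> ?V")
    case True
    have "mcoeff quad m = (\<Sum>i\<in>{..N} \<times> {..N}. mcoeff (?f i) m)"
      unfolding quad_def
    proof (rule mcoeff_msum_finite)
      fix i :: "nat \<times> nat" assume i: "i \<in> UNIV - {..N} \<times> {..N}"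
      obtain k l where kl: "i = (k, l)" by (cases i)
      have out: "trunc ?V (q e x) = (0 :: ('n, 'k) fun_t)" if "N < fst x" for x
        using q_outside[OF N that] .
      have "trunc ?V (q e (k, \<alpha>) * q e (l, \<beta>) :: ('n, 'k) fun_t) = 0" for \<alpha> \<beta>
        using i out[of "(k, \<alpha>)"] out[of "(l, \<beta>)"]
        by (auto simp: trunc_mult kl not_le)
      then have "trunc ?V (?f i) = 0"
        by (simp add: kl trunc_sum trunc_mult[of _ "mconst _"])
      then show "mcoeff (?f i) m = 0" using True by (rule trunc_0D)
    qed auto
    also have "\<dots> = mcoeff (\<Sum>k\<le>N. \<Sum>l\<le>N. ?h k l) m"
      unfolding mcoeff_sum[of ?f, symmetric] sum.cartesian_product[of ?h "{..N}" "{..N}"] ..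
    also have "(\<Sum>k\<le>N. \<Sum>l\<le>N. ?h k l) = (\<Sum>x\<in>?V. \<Sum>y\<in>?V. mconst (w x y) * (q e x * q e y))"
    proof -
      have "(\<Sum>k\<le>N. \<Sum>l\<le>N. ?h k l) = (\<Sum>k\<le>N. \<Sum>\<alpha>\<in>UNIV. \<Sum>l\<le>N. \<Sum>\<beta>\<in>UNIV.
          mconst (w (k, \<alpha>) (l, \<beta>)) * (q e (k, \<alpha>) * q e (l, \<beta>)))"
        by (rule sum.cong[OF refl], rule sum.swap)
      then show ?thesis by (simp add: sum_vars)
    qed
    finally show ?thesis using True by (simp add: mcoeff_trunc)
  next
    case False
    then show ?thesis using arg_cong[OF rhs, of "\<lambda>f. mcoeff f m"] unfolding mcoeff_trunc by simp
  qed
qed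

text \<open>By symmetry of \<open>w\<close> the two Leibniz terms coincide, which absorbs the factor
  1/2.\<close>

lemma trunc_mderiv_half_quad:
  assumes N: "N \<ge> 1" and z: "fst z \<le> N"
  shows "trunc (vars N) (mderiv z half_quad) = (\<Sum>y\<in>vars N. mconst (w z y) * q e y)"
proof -
  let ?V = "vars N :: 'n var set"
  have "mderiv z (mconst (w x y) * (q e x * q e y)) =
      (if x = z then mconst (w x y) * q e y else 0) + (if y = z then mconst (w x y) * q e x else 0)" for x y
    by (auto simp: mderiv_mult mderiv_q)
  then have "mderiv z (\<Sum>x\<in>?V. \<Sum>y\<in>?V. mconst (w x y) * (q e x * q e y)) =
      (\<Sum>x\<in>?V. \<Sum>y\<in>?V. (if x = z then mconst (w x y) * q e y else 0)) +
      (\<Sum>x\<in>?V. \<Sum>y\<in>?V. (if y = z then mconst (w x y) * q e x else 0))"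
    by (simp only: mderiv_sum sum.distrib)
  also have "(\<Sum>x\<in>?V. \<Sum>y\<in>?V. (if x = z then mconst (w x y) * q e y else 0)) =
      (\<Sum>y\<in>?V. mconst (w z y) * q e y)"
    using z by (subst sum.swap) simp
  also have "(\<Sum>x\<in>?V. \<Sum>y\<in>?V. (if y = z then mconst (w x y) * q e x else 0)) =
      (\<Sum>y\<in>?V. mconst (w z y) * q e y)"
    using z by (simp add: w_sym[of z])
  finally show ?thesis
    using z N by (simp add: trunc_mderiv half_quad_def trunc_mult trunc_quad mderiv_mconst_mult half_times_2)
qed

lemma mderiv2_half_quad: "mderiv y (mderiv z half_quad) = mconst (w z y)"
proof (rule trunc_eqI[of "max (fst y) (fst z)"])
  fix N :: nat assume N: "N \<ge> 1" "max (fst y) (fst z) \<le> N"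
  have "trunc (vars N) (mderiv y (mderiv z half_quad)) =
      mderiv y (trunc (vars N) (mderiv z half_quad))"
    using N by (simp add: trunc_mderiv)
  also have "\<dots> = mderiv y (\<Sum>x\<in>vars N. mconst (w z x) * q e x)"
    using N by (subst trunc_mderiv_half_quad) auto
  also have "\<dots> = mconst (w z y)"
    using N by (simp add: mderiv_sum mderiv_mult mderiv_q if_distrib cong: if_cong)
  finally show "trunc (vars N) (mderiv y (mderiv z half_quad)) = trunc (vars N) (mconst (w z y))"
    by simp
qed

lemma trunc_euler_half_quad:
  assumes N: "N \<ge> 1"
  shows "trunc (vars N) (euler e d half_quad) =
    (\<Sum>z\<in>vars N. trunc (vars N) (q e (up d z)) * (\<Sum>y\<in>vars N. mconst (w z y) * q e y))"
  unfolding trunc_euler[OF N] trunc_sum trunc_mult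
  by (rule sum.cong[OF refl]) (simp add: trunc_mderiv_half_quad[OF N])

lemma euler_0_half_quad: "euler e 0 half_quad = 2 * half_quad"
proof (rule trunc_eqI[of 0])
  fix N :: nat assume N: "N \<ge> 1"
  have "2 * half_quad = quad"
    using half_times_2[of quad] unfolding half_quad_def by (simp only: mult.left_commute)
  then have "trunc (vars N) (2 * half_quad) =
      (\<Sum>x\<in>vars N. q e x * (\<Sum>y\<in>vars N. mconst (w x y) * q e y))"
    by (simp add: trunc_quad[OF N] sum_distrib_left mult_ac)
  also have "\<dots> = trunc (vars N) (euler e 0 half_quad)"
    unfolding trunc_euler_half_quad[OF N] by (rule sum.cong) (simp_all add: up_def q_inside)
  finally show "trunc (vars N) (euler e 0 half_quad) = trunc (vars N) (2 * half_quad)" ..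
qed

definition bilq :: "('n \<Rightarrow> ('n, 'k) fun_t) \<Rightarrow> ('n, 'k) fun_t" where
  "bilq v = (\<Sum>\<alpha>\<in>UNIV. \<Sum>\<beta>\<in>UNIV. mconst (g $ \<alpha> $ \<beta>) * v \<alpha> * v \<beta>)"

text \<open>Substituting \<open>T\<close> into SE for \<open>F\<close> yields the square of
  \<open>L (0, _)\<close> instead of that of \<open>q_0\<close>. This is exactly the difference
  supplied by the quadratic term, and it is what forces the recursion \<open>w_rec\<close>.\<close>

lemma euler_1_half_quad:
  "euler e 1 half_quad = mconst (inverse 2) * (bilq (\<lambda>\<mu>. L (0, \<mu>)) - bilq (\<lambda>\<mu>. q e (0, \<mu>)))"
proof (rule trunc_eqI[of 0])
  fix N :: nat assume N: "N \<ge> 1"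
  let ?V = "vars N :: 'n var set"
  let ?t = "trunc ?V"
  define X where "X = ?t (euler e 1 half_quad)"
  have X1: "X = (\<Sum>y\<in>?V. (\<Sum>z\<in>?V. (if 1 \<le> fst z then mconst (w (fst z - 1, snd z) y) else 0) * q e z) * q e y)"
  proof -
    have "X = (\<Sum>y\<in>?V. (\<Sum>z\<in>?V. mconst (w z y) * ?t (q e (up 1 z))) * q e y)"
      unfolding X_def trunc_euler_half_quad[OF N]
      by (simp add: sum_distrib_left sum_distrib_right mult_ac) (rule sum.swap)
    then show ?thesis unfolding shift_sum[OF N, symmetric] .
  qed
  \<comment> \<open>By symmetry of \<open>w\<close> the shift may be placed on either index. Only
    the sum of both versions is known from \<open>w_rec\<close>, so \<open>X + X\<close> is computed
    and halved at the end.\<close>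
  have X2: "X = (\<Sum>z\<in>?V. (\<Sum>y\<in>?V. (if 1 \<le> fst y then mconst (w z (fst y - 1, snd y)) else 0) * q e y) * q e z)"
    unfolding X1 by (simp only: w_sym)
  have "X + X = (\<Sum>z\<in>?V. \<Sum>y\<in>?V. mconst (
      (if 1 \<le> fst z then w (fst z - 1, snd z) y else 0) + (if 1 \<le> fst y then w z (fst y - 1, snd y) else 0)) * (q e z * q e y))"
  proof -
    have "X = (\<Sum>z\<in>?V. \<Sum>y\<in>?V. mconst (if 1 \<le> fst z then w (fst z - 1, snd z) y else 0) * (q e z * q e y))"
      unfolding X1 sum_distrib_right by (subst sum.swap) (auto intro!: sum.cong)
    moreover have "X = (\<Sum>z\<in>?V. \<Sum>y\<in>?V. mconst (if 1 \<le> fst y then w z (fst y - 1, snd y) else 0) * (q e z * q e y))"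
      unfolding X2 sum_distrib_right by (auto intro!: sum.cong)
    ultimately show ?thesis
      by (simp only: mconst_add distrib_right sum.distrib)
  qed
  also have "\<dots> = (\<Sum>z\<in>?V. \<Sum>y\<in>?V. \<Sum>\<mu>\<in>UNIV. \<Sum>\<nu>\<in>UNIV.
        mconst (g $ \<mu> $ \<nu>) * (mconst (l (0, \<mu>) z) * q e z) * (mconst (l (0, \<nu>) y) * q e y)) -
      (\<Sum>z\<in>?V. \<Sum>y\<in>?V. mconst (if fst z = 0 \<and> fst y = 0 then g $ snd z $ snd y else 0) * (q e z * q e y))"
  proof -
    have "mconst ((\<Sum>\<mu>\<in>UNIV. \<Sum>\<nu>\<in>UNIV. g $ \<mu> $ \<nu> * l (0, \<mu>) z * l (0, \<nu>) y) -
        (if fst z = 0 \<and> fst y = 0 then g $ snd z $ snd y else 0)) * (q e z * q e y) =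
      (\<Sum>\<mu>\<in>UNIV. \<Sum>\<nu>\<in>UNIV. mconst (g $ \<mu> $ \<nu>) * (mconst (l (0, \<mu>) z) * q e z) * (mconst (l (0, \<nu>) y) * q e y)) -
      mconst (if fst z = 0 \<and> fst y = 0 then g $ snd z $ snd y else 0) * (q e z * q e y)" for z y
      unfolding mconst_diff left_diff_distrib
      by (simp only: mconst_sum sum_distrib_left sum_distrib_right mconst_mult mult_ac)
    then show ?thesis unfolding w_rec by (simp only: sum_subtractf)
  qed
  also have "(\<Sum>z\<in>?V. \<Sum>y\<in>?V. \<Sum>\<mu>\<in>UNIV. \<Sum>\<nu>\<in>UNIV.
        mconst (g $ \<mu> $ \<nu>) * (mconst (l (0, \<mu>) z) * q e z) * (mconst (l (0, \<nu>) y) * q e y)) =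
      ?t (bilq (\<lambda>\<mu>. L (0, \<mu>)))"
  proof -
    let ?h = "\<lambda>z y \<mu> \<nu>. mconst (g $ \<mu> $ \<nu>) * (mconst (l (0, \<mu>) z) * q e z) * (mconst (l (0, \<nu>) y) * q e y)"
    have "?t (bilq (\<lambda>\<mu>. L (0, \<mu>))) = (\<Sum>\<mu>\<in>UNIV. \<Sum>\<nu>\<in>UNIV. \<Sum>z\<in>?V. \<Sum>y\<in>?V. ?h z y \<mu> \<nu>)"
    proof -
      have "c * (\<Sum>z\<in>?V. f z) * (\<Sum>y\<in>?V. h y) = (\<Sum>z\<in>?V. \<Sum>y\<in>?V. c * f z * h y)"
        for c :: "('n, 'k) fun_t" and f h
        unfolding mult.assoc sum_product by (simp only: sum_distrib_left)
      then show ?thesis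
        unfolding bilq_def trunc_sum trunc_mult trunc_mconst trunc_L[OF N] by simp
    qed
    also have "\<dots> = (\<Sum>z\<in>?V. \<Sum>y\<in>?V. \<Sum>\<mu>\<in>UNIV. \<Sum>\<nu>\<in>UNIV. ?h z y \<mu> \<nu>)"
      by (rule sum4_swap)
    finally show ?thesis ..
  qed
  also have "(\<Sum>z\<in>?V. \<Sum>y\<in>?V. mconst (if fst z = 0 \<and> fst y = 0 then g $ snd z $ snd y else 0) * (q e z * q e y)) =
      ?t (bilq (\<lambda>\<mu>. q e (0, \<mu>)))"
  proof -
    have "(\<Sum>z\<in>?V. \<Sum>y\<in>?V. mconst (if fst z = 0 \<and> fst y = 0 then g $ snd z $ snd y else 0) * (q e z * q e y)) =
        (\<Sum>z\<in>vars 0. \<Sum>y\<in>vars 0. mconst (g $ snd z $ snd y) * (q e z * q e y))"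
      by (rule sum.mono_neutral_cong_right) (auto intro!: sum.mono_neutral_cong_right)
    also have "\<dots> = bilq (\<lambda>\<mu>. q e (0, \<mu>))"
      by (simp add: sum_vars bilq_def mult_ac)
    also have "\<dots> = ?t (bilq (\<lambda>\<mu>. q e (0, \<mu>)))"
      by (simp add: bilq_def trunc_sum trunc_mult q_inside)
    finally show ?thesis .
  qed
  finally have "X + X = ?t (bilq (\<lambda>\<mu>. L (0, \<mu>))) - ?t (bilq (\<lambda>\<mu>. q e (0, \<mu>)))" .
  then have "X = ?t (mconst (inverse 2) * (bilq (\<lambda>\<mu>. L (0, \<mu>)) - bilq (\<lambda>\<mu>. q e (0, \<mu>))))"
    using half_double[of X] by (simp add: trunc_mult trunc_diff)
  then show "?t (euler e 1 half_quad) = ?t (mconst (inverse 2) * (bilq (\<lambda>\<mu>. L (0, \<mu>)) - bilq (\<lambda>\<mu>. q e (0, \<mu>))))"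
    by (simp add: X_def)
qed

section \<open>DE, SE and TRR for the transformed function\<close>

definition transform :: "('n, 'k) fun_t \<Rightarrow> ('n, 'k) fun_t" where
  "transform F = mcomp F T + half_quad"

lemma DE_iff: "DE e F \<longleftrightarrow> euler e 0 F = 2 * F"
  by (simp add: DE_def euler_def)

lemma SE_iff: "SE g e F \<longleftrightarrow> euler e 1 F = - (mconst (inverse 2) * bilq (\<lambda>\<mu>. q e (0, \<mu>)))"
  by (simp add: SE_def euler_def bilq_def bil_def map_matrix_def qvec_def q_def)

lemma has_comp_bilq: "has_comp (bilq (\<lambda>\<mu>. q e (0, \<mu>))) T (bilq (\<lambda>\<mu>. L (0, \<mu>)))"
  unfolding bilq_def by (intro has_comp_sum has_comp_mult has_comp_mconst has_comp_q)

lemma DE_transform: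
  assumes "comp_ok F T" "DE e F"
  shows "DE e (transform F)"
proof -
  have "has_comp (mconst 2 * F) T (euler e 0 (mcomp F T))"
    using euler_comp[OF assms(1), of 0] assms(2) by (simp add: DE_iff mconst_2)
  moreover have "has_comp (mconst 2 * F) T (mconst 2 * mcomp F T)"
    by (intro has_comp_mconst_mult has_comp_mcomp assms)
  ultimately have "euler e 0 (mcomp F T) = 2 * mcomp F T"
    using has_comp_unique mconst_2 by metis
  then show ?thesis
    by (simp add: DE_iff transform_def euler_add euler_0_half_quad distrib_left)
qed

lemma SE_transform:
  assumes "comp_ok F T" "SE g e F"
  shows "SE g e (transform F)"
proof -
  have "has_comp (mconst (- inverse 2) * bilq (\<lambda>\<mu>. q e (0, \<mu>))) T (euler e 1 (mcomp F T))"
    using euler_comp[OF assms(1), of 1] assms(2) by (simp add: SE_iff mconst_uminus)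
  moreover have "has_comp (mconst (- inverse 2) * bilq (\<lambda>\<mu>. q e (0, \<mu>))) T (mconst (- inverse 2) * bilq (\<lambda>\<mu>. L (0, \<mu>)))"
    by (intro has_comp_mconst_mult has_comp_bilq)
  ultimately have "euler e 1 (mcomp F T) = mconst (- inverse 2) * bilq (\<lambda>\<mu>. L (0, \<mu>))"
    by (rule has_comp_unique)
  then show ?thesis
    unfolding SE_iff transform_def euler_add euler_1_half_quad by (simp add: mconst_uminus algebra_simps)
qed

lemma mderiv_mcomp2:
  assumes "comp_ok F T"
  shows "mderiv x (mderiv y (mcomp F T)) =
    (\<Sum>b\<in>vars (fst x). \<Sum>c\<in>vars (fst y). mconst (l b x) * mconst (l c y) * mcomp (mderiv b (mderiv c F)) T)"
proof -
  note ok = assms chain_rule(1)[OF assms]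
  have "mderiv x (mderiv y (mcomp F T)) = (\<Sum>c\<in>vars (fst y). \<Sum>b\<in>vars (fst x).
      mconst (l b x) * mconst (l c y) * mcomp (mderiv b (mderiv c F)) T)"
    by (simp add: chain_rule(2) ok mderiv_sum mderiv_mult sum_distrib_left mult_ac)
  also have "\<dots> = (\<Sum>b\<in>vars (fst x). \<Sum>c\<in>vars (fst y).
      mconst (l b x) * mconst (l c y) * mcomp (mderiv b (mderiv c F)) T)"
    by (rule sum.swap)
  finally show ?thesis .
qed

text \<open>At level zero only \<open>R 0\<close> enters, so differentiation by a level-zero
  variable commutes with substitution by \<open>T\<close>.\<close>

lemma level0_sum: "(\<Sum>c\<in>vars 0. mconst (l c (0, \<mu>)) * f c) = f (0, \<mu>)"
proof -
  have "mconst (l (0, \<alpha>) (0, \<mu>)) * f (0, \<alpha>) = (if \<alpha> = \<mu> then f (0, \<alpha>) else 0)" for \<alpha>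
    by (simp add: l_diag)
  then show ?thesis by (simp add: sum_vars)
qed

text \<open>At \<open>(k + 1, 0)\<close> both the second summand and the delta in
  \<open>w_rec\<close> drop out, leaving \<open>W_(k,0) = R_(k+1)\<close> with one index lowered by
  \<open>g\<close>.\<close>

lemma w_level0: "(\<Sum>\<mu>\<in>UNIV. w (k, \<alpha>) (0, \<mu>) * matrix_inv g $ \<mu> $ \<nu>) = l (0, \<nu>) (k + 1, \<alpha>)"
proof -
  have "w (k, \<alpha>) (0, \<mu>) = (\<Sum>\<sigma>\<in>UNIV. l (0, \<sigma>) (k + 1, \<alpha>) * g $ \<sigma> $ \<mu>)" for \<mu>
  proof -
    have *: "l (0, \<nu>) (0, \<mu>) = (if \<nu> = \<mu> then 1 else 0)" for \<nu> by (simp add: l_diag)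
    show ?thesis
      using w_rec[of "(k + 1, \<alpha>)" "(0, \<mu>)"]
      by (simp add: * if_distrib mult.commute cong: if_cong)
  qed
  then have "(\<Sum>\<mu>\<in>UNIV. w (k, \<alpha>) (0, \<mu>) * matrix_inv g $ \<mu> $ \<nu>) =
      (\<Sum>\<mu>\<in>UNIV. \<Sum>\<sigma>\<in>UNIV. l (0, \<sigma>) (k + 1, \<alpha>) * (g $ \<sigma> $ \<mu> * matrix_inv g $ \<mu> $ \<nu>))"
    by (simp add: sum_distrib_right mult.assoc)
  also have "\<dots> = (\<Sum>\<sigma>\<in>UNIV. l (0, \<sigma>) (k + 1, \<alpha>) * (g ** matrix_inv g) $ \<sigma> $ \<nu>)"
    by (subst sum.swap) (simp add: matrix_matrix_mult_def sum_distrib_left)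
  also have "\<dots> = l (0, \<nu>) (k + 1, \<alpha>)"
    by (simp add: g_inv mat_def if_distrib if_distribR cong: if_cong)
  finally show ?thesis .
qed

text \<open>The quadratic term is invisible in third derivatives but adds the constant
  \<open>w\<close> to the second derivatives on the right of TRR. This constant has to match the
  part of the chain rule on the left that TRR for \<open>F\<close> does not reach.\<close>

lemma TRR_transform:
  assumes ok: "comp_ok F T" and TRR: "TRR g F"
  shows "TRR g (transform F)"
  unfolding TRR_def
proof (intro allI)
  fix k l' m' :: nat and \<alpha> \<beta> \<gamma> :: 'n
  define x y where "x = (l', \<beta>)" and "y = (m', \<gamma>)"
  define gi where "gi = matrix_inv g"
  define C where "C f = mcomp f T" for f :: "('n, 'k) fun_t"
  define h where "h b c = (mconst (l b x) * mconst (l c y) :: ('n, 'k) fun_t)" for b c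
  note oks = ok chain_rule(1)[OF ok] chain_rule(1)[OF chain_rule(1)[OF ok]]
    chain_rule(1)[OF chain_rule(1)[OF chain_rule(1)[OF ok]]]
  have d3: "mderiv z (mderiv x (mderiv y (transform F))) = (\<Sum>b\<in>vars (fst x). \<Sum>c\<in>vars (fst y).
      h b c * (\<Sum>a\<in>vars (fst z). mconst (l a z) * C (mderiv a (mderiv b (mderiv c F)))))" for z
  proof -
    have "mderiv x (mderiv y (transform F)) = (\<Sum>b\<in>vars (fst x). \<Sum>c\<in>vars (fst y).
        h b c * C (mderiv b (mderiv c F))) + mconst (w y x)"
      by (simp only: transform_def mderiv_add mderiv2_half_quad mderiv_mcomp2[OF ok] h_def C_def)
    then show ?thesis
      by (simp add: mderiv_add mderiv_sum mderiv_mult chain_rule(2) oks h_def C_def)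
  qed
  have d2: "mderiv (k, \<alpha>) (mderiv (0, \<mu>) (transform F)) =
      (\<Sum>a\<in>vars k. mconst (l a (k, \<alpha>)) * C (mderiv a (mderiv (0, \<mu>) F))) + mconst (w (k, \<alpha>) (0, \<mu>))" for \<mu>
  proof -
    have "mderiv (k, \<alpha>) (mderiv (0, \<mu>) (transform F)) = (\<Sum>a\<in>vars k. mconst (l a (k, \<alpha>)) *
        (\<Sum>c\<in>vars 0. mconst (l c (0, \<mu>)) * C (mderiv a (mderiv c F)))) + mconst (w (0, \<mu>) (k, \<alpha>))"
      by (simp only: transform_def mderiv_add mderiv2_half_quad mderiv_mcomp2[OF ok] C_def fst_conv
          sum_distrib_left mult.assoc)
    then show ?thesis by (simp only: level0_sum w_sym)
  qed
  have key: "(\<Sum>a\<in>vars (k + 1). mconst (l a (k + 1, \<alpha>)) * C (mderiv a (mderiv b (mderiv c F)))) =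
      (\<Sum>\<mu>\<in>UNIV. \<Sum>\<nu>\<in>UNIV.
        ((\<Sum>a\<in>vars k. mconst (l a (k, \<alpha>)) * C (mderiv a (mderiv (0, \<mu>) F))) + mconst (w (k, \<alpha>) (0, \<mu>))) *
        mconst (gi $ \<mu> $ \<nu>) * C (mderiv (0, \<nu>) (mderiv b (mderiv c F))))" for b c
  proof -
    let ?D = "\<lambda>\<nu>. C (mderiv (0, \<nu>) (mderiv b (mderiv c F)))"
    have C_TRR: "C (mderiv (up 1 a) (mderiv b (mderiv c F))) =
        (\<Sum>\<mu>\<in>UNIV. \<Sum>\<nu>\<in>UNIV. C (mderiv a (mderiv (0, \<mu>) F)) * mconst (gi $ \<mu> $ \<nu>) * ?D \<nu>)" for a
    proof -
      have eq: "mderiv (up 1 a) (mderiv b (mderiv c F)) =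
        (\<Sum>\<mu>\<in>UNIV. \<Sum>\<nu>\<in>UNIV. mderiv a (mderiv (0, \<mu>) F) * mconst (gi $ \<mu> $ \<nu>) *
          mderiv (0, \<nu>) (mderiv b (mderiv c F)))"
        using TRR[unfolded TRR_def, rule_format, of "fst a" "snd a" "fst b" "snd b" "fst c" "snd c"]
        by (simp add: up_def gi_def)
      have "has_comp (mderiv (up 1 a) (mderiv b (mderiv c F))) T
        (\<Sum>\<mu>\<in>UNIV. \<Sum>\<nu>\<in>UNIV. C (mderiv a (mderiv (0, \<mu>) F)) * mconst (gi $ \<mu> $ \<nu>) * ?D \<nu>)"
        unfolding eq C_def by (intro has_comp_sum has_comp_mult has_comp_mconst has_comp_mcomp oks)
      then show ?thesis by (simp add: has_comp_iff C_def)
    qed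
    \<comment> \<open>The chain rule for \<open>(k + 1, \<alpha>)\<close> runs over levels up to
      \<open>k + 1\<close>. TRR for \<open>F\<close> applies to the raised variables
      \<open>up 1 a\<close>; level zero is left over.\<close>
    have "vars (k + 1) = vars 0 \<union> (up 1 ` vars k :: 'n var set)"
    proof -
      have "z \<in> vars 0 \<union> up 1 ` vars k" if "fst z \<le> k + 1" for z :: "'n var"
        using that by (cases "fst z"; cases z)
          (auto simp: up_def image_iff intro!: bexI[of _ "(fst z - 1, snd z)"])
      moreover have "fst z \<le> k + 1" if "z \<in> vars 0 \<union> up 1 ` vars k" for z :: "'n var"
        using that by (auto simp: up_def)
      ultimately show ?thesis unfolding set_eq_iff mem_vars by blast
    qed
    moreover have "vars 0 \<inter> (up 1 ` vars k :: 'n var set) = {}" by (auto simp: up_def)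
    moreover have "inj_on (up 1) (vars k :: 'n var set)" by (auto simp: inj_on_def up_def prod_eq_iff)
    ultimately have "(\<Sum>a\<in>vars (k + 1). mconst (l a (k + 1, \<alpha>)) * C (mderiv a (mderiv b (mderiv c F)))) =
        (\<Sum>a\<in>vars 0. mconst (l a (k + 1, \<alpha>)) * C (mderiv a (mderiv b (mderiv c F)))) +
        (\<Sum>a\<in>vars k. mconst (l a (k, \<alpha>)) * C (mderiv (up 1 a) (mderiv b (mderiv c F))))"
      by (simp add: sum.union_disjoint sum.reindex l_up)
    \<comment> \<open>The leftover carries the entries of \<open>R (k + 1)\<close>, which
      \<open>w_level0\<close> converts into the constants that \<open>half_quad\<close> contributes
      in \<open>d2\<close>.\<close>
    also have "(\<Sum>a\<in>vars 0. mconst (l a (k + 1, \<alpha>)) * C (mderiv a (mderiv b (mderiv c F)))) =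
        (\<Sum>\<mu>\<in>UNIV. \<Sum>\<nu>\<in>UNIV. mconst (w (k, \<alpha>) (0, \<mu>)) * mconst (gi $ \<mu> $ \<nu>) * ?D \<nu>)"
    proof -
      have "(\<Sum>a\<in>vars 0. mconst (l a (k + 1, \<alpha>)) * C (mderiv a (mderiv b (mderiv c F)))) =
          (\<Sum>\<nu>\<in>UNIV. \<Sum>\<mu>\<in>UNIV. mconst (w (k, \<alpha>) (0, \<mu>)) * mconst (gi $ \<mu> $ \<nu>) * ?D \<nu>)"
      proof -
        have "mconst (l (0, \<nu>) (k + 1, \<alpha>)) * ?D \<nu> =
            (\<Sum>\<mu>\<in>UNIV. mconst (w (k, \<alpha>) (0, \<mu>)) * mconst (gi $ \<mu> $ \<nu>) * ?D \<nu>)" for \<nu>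
          unfolding w_level0[symmetric] mconst_sum mconst_mult sum_distrib_right gi_def ..
        then show ?thesis by (simp add: sum_vars)
      qed
      also have "\<dots> = (\<Sum>\<mu>\<in>UNIV. \<Sum>\<nu>\<in>UNIV. mconst (w (k, \<alpha>) (0, \<mu>)) * mconst (gi $ \<mu> $ \<nu>) * ?D \<nu>)"
        by (rule sum.swap)
      finally show ?thesis .
    qed
    also have "(\<Sum>a\<in>vars k. mconst (l a (k, \<alpha>)) * C (mderiv (up 1 a) (mderiv b (mderiv c F)))) =
        (\<Sum>\<mu>\<in>UNIV. \<Sum>\<nu>\<in>UNIV. (\<Sum>a\<in>vars k. mconst (l a (k, \<alpha>)) * C (mderiv a (mderiv (0, \<mu>) F))) *
          mconst (gi $ \<mu> $ \<nu>) * ?D \<nu>)"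
    proof -
      have "(\<Sum>a\<in>vars k. mconst (l a (k, \<alpha>)) * C (mderiv (up 1 a) (mderiv b (mderiv c F)))) =
          (\<Sum>a\<in>vars k. \<Sum>\<mu>\<in>UNIV. \<Sum>\<nu>\<in>UNIV. mconst (l a (k, \<alpha>)) * C (mderiv a (mderiv (0, \<mu>) F)) *
            mconst (gi $ \<mu> $ \<nu>) * ?D \<nu>)"
        by (simp only: C_TRR sum_distrib_left mult.assoc)
      also have "\<dots> = (\<Sum>\<mu>\<in>UNIV. \<Sum>a\<in>vars k. \<Sum>\<nu>\<in>UNIV. mconst (l a (k, \<alpha>)) * C (mderiv a (mderiv (0, \<mu>) F)) *
            mconst (gi $ \<mu> $ \<nu>) * ?D \<nu>)"
        by (rule sum.swap)
      also have "\<dots> = (\<Sum>\<mu>\<in>UNIV. \<Sum>\<nu>\<in>UNIV. \<Sum>a\<in>vars k. mconst (l a (k, \<alpha>)) * C (mderiv a (mderiv (0, \<mu>) F)) *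
            mconst (gi $ \<mu> $ \<nu>) * ?D \<nu>)"
        by (rule sum.cong[OF refl], rule sum.swap)
      finally show ?thesis by (simp only: sum_distrib_right)
    qed
    finally show ?thesis
      by (simp only: sum.distrib distrib_right add.commute)
  qed
  have "mderiv (k + 1, \<alpha>) (mderiv x (mderiv y (transform F))) =
      (\<Sum>b\<in>vars (fst x). \<Sum>c\<in>vars (fst y). \<Sum>\<mu>\<in>UNIV. \<Sum>\<nu>\<in>UNIV. 
        mderiv (k, \<alpha>) (mderiv (0, \<mu>) (transform F)) * mconst (gi $ \<mu> $ \<nu>) *
        (h b c * C (mderiv (0, \<nu>) (mderiv b (mderiv c F)))))"
    unfolding d3 fst_conv key d2 by (simp only: sum_distrib_left mult_ac)
  also have "\<dots> = (\<Sum>\<mu>\<in>UNIV. \<Sum>\<nu>\<in>UNIV. \<Sum>b\<in>vars (fst x). \<Sum>c\<in>vars (fst y).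
        mderiv (k, \<alpha>) (mderiv (0, \<mu>) (transform F)) * mconst (gi $ \<mu> $ \<nu>) *
        (h b c * C (mderiv (0, \<nu>) (mderiv b (mderiv c F)))))"
    by (rule sum4_swap)
  also have "\<dots> = (\<Sum>\<mu>\<in>UNIV. \<Sum>\<nu>\<in>UNIV.
        mderiv (k, \<alpha>) (mderiv (0, \<mu>) (transform F)) * mconst (gi $ \<mu> $ \<nu>) *
        mderiv (0, \<nu>) (mderiv x (mderiv y (transform F))))"
    unfolding d3 fst_conv level0_sum by (simp only: sum_distrib_left)
  finally show "mderiv (k + 1, \<alpha>) (mderiv (l', \<beta>) (mderiv (m', \<gamma>) (transform F))) =
     (\<Sum>\<mu>\<in>UNIV. \<Sum>\<nu>\<in>UNIV. mderiv (k, \<alpha>) (mderiv (0, \<mu>) (transform F)) * mconst (matrix_inv g $ \<mu> $ \<nu>) *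
        mderiv (0, \<nu>) (mderiv (l', \<beta>) (mderiv (m', \<gamma>) (transform F))))"
    by (simp only: x_def y_def gi_def)
qed

lemma GW0_transform: "comp_ok F T \<Longrightarrow> F \<in> GW0 g e \<Longrightarrow> transform F \<in> GW0 g e"
  by (simp add: GW0_def DE_transform SE_transform TRR_transform)

end

section \<open>Adjoints, inverses and the family \<open>W\<close>\<close>

text \<open>The sign \<open>(-1)^i\<close> on any additive group, so that one set of rules covers
  scalars, vectors and matrices.\<close>

definition sg :: "nat \<Rightarrow> 'a :: ab_group_add \<Rightarrow> 'a" where
  "sg i A = (if even i then A else - A)"

lemma sg_0 [simp]: "sg 0 A = A" by (simp add: sg_def)
lemma sg_Suc: "sg (Suc i) A = - sg i A" by (simp add: sg_def)
lemma sg_sg: "sg i (sg j A) = sg (i + j) A" by (auto simp: sg_def)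
lemma sg_cancel: "sg i a = sg i b \<longleftrightarrow> a = b" by (simp add: sg_def)
lemma sg_zero [simp]: "sg i 0 = 0" by (simp add: sg_def)
lemma sg_add: "sg i (A + B) = sg i A + sg i B" by (simp add: sg_def)
lemma sg_sum: "sg i (\<Sum>a\<in>I. f a) = (\<Sum>a\<in>I. sg i (f a))" by (simp add: sg_def sum_negf)
lemma sg_add_same: "sg (i + (i + j)) A = sg j A" by (simp add: sg_def)
lemma sg_double [simp]: "sg (i + i) A = A" by (simp add: sg_def)

lemma map_matrix_sg: "map_matrix (\<lambda>x. (- 1) ^ i * x) A = sg i (A :: 'k :: comm_ring_1 ^ 'n ^ 'm)"
  by (simp add: sg_def map_matrix_def vec_eq_iff)

lemma matrix_minus_left: "(- A) ** B = - (A ** (B :: 'k :: comm_ring_1 ^ 'n ^ 'm))"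
  by (simp add: matrix_matrix_mult_def vec_eq_iff sum_negf)
lemma matrix_minus_right: "A ** (- B) = - (A ** (B :: 'k :: comm_ring_1 ^ 'n ^ 'm))"
  by (simp add: matrix_matrix_mult_def vec_eq_iff sum_negf)
lemma matrix_sg_left: "sg i A ** B = sg i (A ** (B :: 'k :: comm_ring_1 ^ 'n ^ 'm))"
  by (simp add: sg_def matrix_minus_left)
lemma matrix_sg_right: "A ** sg i B = sg i (A ** (B :: 'k :: comm_ring_1 ^ 'n ^ 'm))"
  by (simp add: sg_def matrix_minus_right)
lemma matrix_zero_left [simp]: "0 ** B = (0 :: 'k :: comm_ring_1 ^ 'n ^ 'm)"
  by (simp add: matrix_matrix_mult_def vec_eq_iff)
lemma matrix_add_rdistrib: "(A + B) ** C = A ** C + B ** (C :: 'k :: comm_ring_1 ^ 'n ^ 'm)"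
  by (simp add: matrix_matrix_mult_def vec_eq_iff distrib_right sum.distrib)
lemma matrix_sum_left: "(\<Sum>i\<in>I. f i) ** B = (\<Sum>i\<in>I. f i ** (B :: 'k :: comm_ring_1 ^ 'n ^ 'm))"
  by (induction I rule: infinite_finite_induct) (simp_all add: matrix_add_rdistrib)
lemma matrix_sum_right: "B ** (\<Sum>i\<in>I. f i) = (\<Sum>i\<in>I. B ** (f i :: 'k :: comm_ring_1 ^ 'n ^ 'm))"
  by (induction I rule: infinite_finite_induct) (simp_all add: matrix_add_ldistrib)
lemma transpose_minus: "transpose (- A) = - transpose A"
  by (simp add: transpose_def vec_eq_iff)
lemma transpose_add: "transpose (A + B) = transpose A + transpose B"
  by (simp add: transpose_def vec_eq_iff)
lemma transpose_0 [simp]: "transpose 0 = 0"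
  by (simp add: transpose_def vec_eq_iff)
lemma transpose_sum: "transpose (\<Sum>i\<in>I. f i) = (\<Sum>i\<in>I. transpose (f i))"
  by (simp add: transpose_def vec_eq_iff)
lemma matrix_vector_sum_left: "(\<Sum>i\<in>I. f i) *v v = (\<Sum>i\<in>I. f i *v (v :: 'k :: comm_ring_1 ^ 'n))"
  by (induction I rule: infinite_finite_induct) (simp_all add: matrix_vector_mult_add_rdistrib)
lemma matrix_vector_sum_right: "A *v (\<Sum>i\<in>I. f i) = (\<Sum>i\<in>I. A *v (f i :: 'k :: comm_ring_1 ^ 'n))"
  by (induction I rule: infinite_finite_induct) (simp_all add: matrix_vector_right_distrib)
lemma matrix_vector_minus_left: "(- A) *v v = - (A *v (v :: 'k :: comm_ring_1 ^ 'n))"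
  by (simp add: matrix_vector_mult_def vec_eq_iff sum_negf)
lemma matrix_vector_minus_right: "A *v (- v) = - (A *v (v :: 'k :: comm_ring_1 ^ 'n))"
  by (simp add: matrix_vector_mult_def vec_eq_iff sum_negf)
lemma matrix_vector_sg_left: "sg i A *v v = sg i (A *v (v :: 'k :: comm_ring_1 ^ 'n))"
  by (simp add: sg_def matrix_vector_minus_left)
lemma matrix_vector_sg_right: "A *v sg i v = sg i (A *v (v :: 'k :: comm_ring_1 ^ 'n))"
  by (simp add: sg_def matrix_vector_minus_right)

lemma matrix_eqI_bil:
  fixes M M' :: "'k :: comm_ring_1 ^ 'n ^ 'm"
  shows "(\<And>u v. (\<Sum>i\<in>UNIV. u $ i * (M *v v) $ i) = (\<Sum>i\<in>UNIV. u $ i * (M' *v v) $ i)) \<Longrightarrow> M = M'"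
proof -
  assume *: "\<And>u v. (\<Sum>i\<in>UNIV. u $ i * (M *v v) $ i) = (\<Sum>i\<in>UNIV. u $ i * (M' *v v) $ i)"
  have "M $ i $ j = M' $ i $ j" for i j
    using *[of "axis i 1" "axis j 1"] unfolding axis_sum unfolding matrix_axis .
  then show "M = M'" by (simp add: vec_eq_iff)
qed

lemma bil_eq: "bil g u v = (\<Sum>i\<in>UNIV. u $ i * (g *v v) $ i)"
  unfolding bil_def matrix_vector_mult_def by (simp add: sum_distrib_left mult_ac)

lemma bil_left: "bil g (s *v u) v = (\<Sum>i\<in>UNIV. u $ i * ((transpose s ** g) *v v) $ i)"
proof -
  have "bil g (s *v u) v = (\<Sum>i\<in>UNIV. \<Sum>j\<in>UNIV. u $ j * (s $ i $ j * (g *v v) $ i))"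
    unfolding bil_eq by (simp add: matrix_vector_mult_def[of s] sum_distrib_left sum_distrib_right mult_ac)
  also have "\<dots> = (\<Sum>j\<in>UNIV. u $ j * (transpose s *v (g *v v)) $ j)"
  proof -
    have "(transpose s *v x) $ j = (\<Sum>i\<in>UNIV. s $ i $ j * x $ i)" for x j
      by (simp add: matrix_vector_mult_def transpose_def del: transpose_matrix_vector)
    then show ?thesis by (subst sum.swap) (simp only: sum_distrib_left)
  qed
  finally show ?thesis by (simp add: matrix_vector_mul_assoc del: transpose_matrix_vector)
qed

lemma bil_right: "bil g u (t *v v) = (\<Sum>i\<in>UNIV. u $ i * ((g ** t) *v v) $ i)"
  unfolding bil_eq by (simp add: matrix_vector_mul_assoc)

lemma bil_mconst:
  fixes A g :: "'k :: comm_ring_1 ^ 'n ^ 'n :: finite"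
  shows "bil (map_matrix mconst g) (map_matrix mconst A *v qvec e k) (qvec e n) =
    (\<Sum>\<alpha>\<in>UNIV. \<Sum>\<beta>\<in>UNIV. mconst ((transpose A ** g) $ \<alpha> $ \<beta>) * (q e (k, \<alpha>) * q e (n, \<beta>)))"
proof -
  let ?q = "\<lambda>k \<alpha>. qvar e k \<alpha> :: ('n, 'k) fun_t"
  have "bil (map_matrix mconst g) (map_matrix mconst A *v qvec e k) (qvec e n) =
    (\<Sum>a\<in>UNIV. \<Sum>\<beta>\<in>UNIV. \<Sum>\<alpha>\<in>UNIV. mconst (A $ a $ \<alpha> * g $ a $ \<beta>) * (?q k \<alpha> * ?q n \<beta>))"
    by (simp add: bil_def map_matrix_def matrix_vector_mult_def qvec_def mconst_mult
        sum_distrib_left sum_distrib_right mult_ac)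
  also have "\<dots> = (\<Sum>\<alpha>\<in>UNIV. \<Sum>\<beta>\<in>UNIV. \<Sum>a\<in>UNIV. mconst (A $ a $ \<alpha> * g $ a $ \<beta>) * (?q k \<alpha> * ?q n \<beta>))"
    by (subst sum.swap, subst (2) sum.swap, subst sum.swap) (rule refl)
  finally show ?thesis
    by (simp add: q_def matrix_matrix_mult_def transpose_def mconst_sum sum_distrib_right)
qed

section \<open>The algebra of matrix series in \<open>z^-1\<close>\<close>

lemma sprod_assoc: "sprod (sprod A B) C = sprod A (sprod B C)"
proof
  fix n
  have "sprod (sprod A B) C n = (\<Sum>k\<le>n. \<Sum>i\<le>k. A i ** B (k - i) ** C (n - k))"
    by (simp add: sprod_def matrix_sum_left)
  also have "\<dots> = (\<Sum>k\<le>n. \<Sum>i\<le>k. A i ** (B (k - i) ** C (n - i - (k - i))))"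
    by (intro sum.cong refl) (simp add: matrix_mul_assoc)
  also have "\<dots> = (\<Sum>(i, j)\<in>{(i, j). i + j \<le> n}. A i ** (B j ** C (n - i - j)))"
    by (simp add: sum.triangle_reindex_eq)
  also have "{(i, j). i + j \<le> n} = (SIGMA i:{..n}. {..n - i})" by auto
  also have "(\<Sum>(i, j)\<in>(SIGMA i:{..n}. {..n - i}). A i ** (B j ** C (n - i - j))) = sprod A (sprod B C) n"
    by (simp add: sprod_def matrix_sum_right sum.Sigma)
  finally show "sprod (sprod A B) C n = sprod A (sprod B C) n" .
qed

lemma sprod_sone [simp]: "sprod A sone = A" "sprod sone A = A"
proof -
  have "sprod A sone n = A n" for n
  proof -
    have "(\<Sum>i\<le>n. A i ** sone (n - i)) = (\<Sum>i\<in>{n}. A i ** sone (n - i))"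
      by (rule sum.mono_neutral_right) (auto simp: sone_def)
    then show ?thesis by (simp add: sprod_def sone_def)
  qed
  moreover have "sprod sone A n = A n" for n
  proof -
    have "(\<Sum>i\<le>n. sone i ** A (n - i)) = (\<Sum>i\<in>{0}. sone i ** A (n - i))"
      by (rule sum.mono_neutral_right) (auto simp: sone_def)
    then show ?thesis by (simp add: sprod_def sone_def)
  qed
  ultimately show "sprod A sone = A" "sprod sone A = A" by auto
qed

text \<open>The recursive left inverse of a series with constant term 1. It serves to show that a
  right inverse is also a left inverse.\<close>

fun linv :: "('n :: finite, 'k :: comm_ring_1) zseries \<Rightarrow> ('n, 'k) zseries" where
  "linv A n = (if n = 0 then mat 1 else - (\<Sum>i<n. linv A i ** A (n - i)))"

declare linv.simps [simp del]

lemma sprod_linv: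
  assumes "A 0 = mat 1"
  shows "sprod (linv A) A = sone"
proof
  fix n
  show "sprod (linv A) A n = sone n"
  proof (cases n)
    case (Suc m)
    have "{..n} = insert n {..<n}" by auto
    then have "sprod (linv A) A n = linv A n + (\<Sum>i<n. linv A i ** A (n - i))"
      by (simp add: sprod_def assms)
    then show ?thesis using Suc by (subst (asm) (1) linv.simps) (simp add: sone_def)
  qed (simp add: sprod_def sone_def assms linv.simps[of A 0])
qed

lemma sinv_eqI:
  assumes "sprod A B = sone" "A 0 = mat 1"
  shows "sinv B = A" "sprod B A = sone"
proof -
  have "linv A = sprod (linv A) (sprod A B)" by (simp add: assms)
  also have "\<dots> = B" unfolding sprod_assoc[symmetric] sprod_linv[of A, OF assms(2)] by simp
  finally have "linv A = B" .
  then show BA: "sprod B A = sone" using sprod_linv[of A] assms by simp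
  show "sinv B = A"
    unfolding sinv_def
  proof (rule the_equality)
    fix A' assume "sprod B A' = sone \<and> sprod A' B = sone"
    then have "sprod A (sprod B A') = A" by simp
    then show "A' = A" by (simp add: sprod_assoc[symmetric] assms)
  qed (use BA assms in simp)
qed

text \<open>Nondegeneracy is encoded as invertibility of the Gram matrix, a form that survives
  extension of scalars from \<open>complex\<close> to \<open>complex fps\<close>.\<close>

locale bilinear_form =
  fixes g :: "'k :: sum_ring ^ 'n ^ 'n :: finite"
  assumes g_sym: "transpose g = g"
    and g_inv: "g ** matrix_inv g = mat 1"
    and g_inv': "matrix_inv g ** g = mat 1"
begin

definition star :: "'k ^ 'n ^ 'n \<Rightarrow> 'k ^ 'n ^ 'n" where
  "star s = matrix_inv g ** transpose s ** g"

lemma g_star: "g ** star s = transpose s ** g"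
  by (simp add: star_def matrix_mul_assoc g_inv)

lemma adj_eq_star: "adj g s = star s"
  unfolding adj_def
proof (rule the_equality)
  show "\<forall>u v. bil g (s *v u) v = bil g u (star s *v v)"
    by (simp add: bil_left bil_right g_star)
  fix t assume "\<forall>u v. bil g (s *v u) v = bil g u (t *v v)"
  then have "g ** t = transpose s ** g"
    by (intro matrix_eqI_bil) (simp add: bil_left bil_right)
  then have "matrix_inv g ** (g ** t) = star s"
    by (simp add: star_def matrix_mul_assoc)
  then show "t = star s" by (simp add: matrix_mul_assoc g_inv')
qed

lemma matrix_inv_sym: "transpose (matrix_inv g) = matrix_inv g"
proof -
  have "transpose (matrix_inv g) ** g = mat 1"
    using arg_cong[OF g_inv, of transpose] by (simp add: matrix_transpose_mul g_sym)
  then have "transpose (matrix_inv g) ** g ** matrix_inv g = matrix_inv g" by simp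
  then show ?thesis by (simp add: matrix_mul_assoc[symmetric] g_inv)
qed

lemma star_mult: "star (A ** B) = star B ** star A"
proof -
  have "star B ** star A = matrix_inv g ** transpose B ** (g ** matrix_inv g) ** transpose A ** g"
    by (simp only: star_def matrix_mul_assoc)
  then show ?thesis by (simp add: star_def g_inv matrix_transpose_mul matrix_mul_assoc)
qed

lemma star_star [simp]: "star (star A) = A"
proof -
  have "transpose (star A) = g ** A ** matrix_inv g"
    by (simp add: star_def matrix_transpose_mul g_sym matrix_inv_sym matrix_mul_assoc)
  then have "star (star A) = (matrix_inv g ** g) ** A ** (matrix_inv g ** g)"
    by (simp only: star_def[of "star A"] matrix_mul_assoc)
  then show ?thesis by (simp add: g_inv')
qed

lemma star_1 [simp]: "star (mat 1) = mat 1" by (simp add: star_def g_inv')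
lemma star_0 [simp]: "star 0 = 0" by (simp add: star_def)
lemma star_minus: "star (- A) = - star A"
  by (simp add: star_def transpose_minus matrix_minus_left matrix_minus_right)
lemma star_sg: "star (sg i A) = sg i (star A)" by (simp add: sg_def star_minus)
lemma star_sum: "star (\<Sum>i\<in>I. f i) = (\<Sum>i\<in>I. star (f i))"
  by (simp add: star_def transpose_sum matrix_sum_left matrix_sum_right)
lemma star_add: "star (A + B) = star A + star B"
  by (simp add: star_def transpose_add matrix_add_ldistrib matrix_add_rdistrib)

lemma sprod_star: "sprod (\<lambda>i. star (B i)) (\<lambda>i. star (A i)) = (\<lambda>n. star (sprod A B n))"
proof
  fix n
  have "(\<Sum>i\<le>n. star (B i) ** star (A (n - i))) = (\<Sum>i\<le>n. star (B (n - i)) ** star (A i))"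
    by (rule sum.reindex_bij_witness[of _ "\<lambda>i. n - i" "\<lambda>i. n - i"]) auto
  then show "sprod (\<lambda>i. star (B i)) (\<lambda>i. star (A i)) n = star (sprod A B n)"
    by (simp add: sprod_def star_sum star_mult)
qed

end

section \<open>The inverse of a symplectic series and its family \<open>W\<close>\<close>

locale symplectic_series = bilinear_form g
  for g :: "'k :: sum_ring ^ 'n ^ 'n :: finite" +
  fixes S :: "('n, 'k) zseries" and e :: 'n
  assumes S: "S \<in> Gminus g"
begin

text \<open>The coefficients of the adjoint of \<open>S\<close> at \<open>-z\<close>; by the
  condition defining \<open>Gminus\<close> this is the inverse of \<open>S\<close>.\<close>

definition R :: "('n, 'k) zseries" where
  "R i = sg i (star (S i))"

lemma S0: "S 0 = mat 1" using S by (simp add: Gminus_def)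

lemma R0: "R 0 = mat 1" by (simp add: R_def S0)

lemma star_R: "star (R i) = sg i (S i)" by (simp add: R_def star_sg)

lemma R_eq: "sflip (sadj g S) = R"
  by (simp add: sflip_def sadj_def adj_eq_star R_def fun_eq_iff map_matrix_sg)

lemma RS: "sprod R S = sone"
  using S by (simp add: Gminus_def R_eq)

lemma sinv_S: "sinv S = R" and SR: "sprod S R = sone"
  using sinv_eqI[of R S] RS R0 by auto

lemma sinv_sadj: "sinv (sadj g S) = (\<lambda>i. star (R i))"
proof (rule sinv_eqI)
  have "sprod (\<lambda>i. star (R i)) (\<lambda>i. star (S i)) = (\<lambda>n. star (sone n))"
    by (simp add: sprod_star SR)
  then show "sprod (\<lambda>i. star (R i)) (sadj g S) = sone"
    by (simp add: sadj_def adj_eq_star sone_def fun_eq_iff)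
qed (simp add: R0)

text \<open>Obtained by solving the recursion: \<open>W k l\<close> is
  \<open>star (R l) ** R (k + 1)\<close> minus \<open>W (k + 1) (l - 1)\<close>, iterated until the
  second index reaches 0. This produces the alternating signs.\<close>

definition W :: "nat \<Rightarrow> nat \<Rightarrow> 'k ^ 'n ^ 'n" where
  "W k l = (\<Sum>j\<le>l. sg j (star (R (l - j)) ** R (k + 1 + j)))"

text \<open>Splitting off the first summand of \<open>V\<close> gives the recursion. The remaining
  content is the value of \<open>V\<close> at \<open>k = 0\<close>, the condition that the
  generating function be divisible by \<open>z^-1 + w^-1\<close>.\<close>

lemma W_rec:
  "(if k > 0 then W (k - 1) l else 0) + (if l > 0 then W k (l - 1) else 0) =
     star (R l) ** R k - (if k = 0 \<and> l = 0 then mat 1 else 0)"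
proof -
  define V where "V = (\<Sum>j\<le>l. sg j (star (R (l - j)) ** R (k + j)))"
  have split: "V = star (R l) ** R k - (if l > 0 then W k (l - 1) else 0)"
  proof (cases l)
    case (Suc l')
    then show ?thesis
      unfolding V_def W_def
      by (subst sum.atMost_Suc_shift[of _ l', folded Suc]) (simp add: sg_Suc sum_negf)
  qed (simp add: V_def)
  \<comment> \<open>For \<open>k = 0\<close>, replacing \<open>star (R i)\<close> by
    \<open>(-1)^i S i\<close> makes all signs equal, and \<open>V\<close> becomes up to sign a
    coefficient of \<open>S R\<close>, which is the identity series.\<close>
  have V0: "V = (if k > 0 then W (k - 1) l else if l = 0 then mat 1 else 0)"
  proof (cases k)
    case 0
    have "V = sg l (sprod S R l)"
    proof -
      have "sg j (star (R (l - j)) ** R j) = sg l (S (l - j) ** R j)" if "j \<le> l" for j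
        using that by (simp add: star_R matrix_sg_left sg_sg)
      then have "V = sg l (\<Sum>j\<le>l. S (l - j) ** R j)"
        unfolding V_def 0 by (simp add: sg_sum)
      also have "(\<Sum>j\<le>l. S (l - j) ** R j) = sprod S R l"
        unfolding sprod_def by (rule sum.reindex_bij_witness[of _ "\<lambda>i. l - i" "\<lambda>i. l - i"]) auto
      finally show ?thesis .
    qed
    then show ?thesis using 0 by (simp add: SR sone_def)
  qed (simp add: V_def W_def)
  show ?thesis using split V0 by (auto split: if_splits)
qed

text \<open>Read at \<open>k + 1\<close>, the recursion expresses the entry \<open>(k, l)\<close>
  through \<open>(k + 1, l - 1)\<close>, so the induction is on \<open>l\<close> for all
  \<open>k\<close> at once.\<close>

lemma is_W_family_unique:
  assumes "is_W_family g S U"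
  shows "U = W"
proof -
  have "U k l = W k l" for k l
  proof (induction l arbitrary: k)
    case 0
    show ?case
      using assms[unfolded is_W_family_def sinv_sadj sinv_S, rule_format, of "Suc k" 0] W_rec[of "Suc k" 0] by simp
  next
    case (Suc l)
    have "U k (Suc l) + U (Suc k) l = W k (Suc l) + W (Suc k) l"
      using assms[unfolded is_W_family_def sinv_sadj sinv_S, rule_format, of "Suc k" "Suc l"] W_rec[of "Suc k" "Suc l"] by simp
    then show ?case using Suc by simp
  qed
  then show ?thesis by auto
qed

lemma is_W_family_W: "is_W_family g S W"
  unfolding is_W_family_def sinv_sadj sinv_S using W_rec by blast

lemma Wop_eq: "Wop g S = W"
  unfolding Wop_def using is_W_family_W is_W_family_unique by blast

text \<open>The adjoint family with exchanged indices satisfies the same recursion, so uniqueness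
  gives the symmetry of the quadratic term.\<close>

lemma star_W: "star (W k l) = W l k"
proof -
  have "is_W_family g S (\<lambda>k l. star (W l k))"
    unfolding is_W_family_def sinv_sadj sinv_S
  proof (intro allI)
    fix k l
    have "(if k > 0 then star (W l (k - 1)) else 0) + (if l > 0 then star (W (l - 1) k) else 0) =
        star ((if l > 0 then W (l - 1) k else 0) + (if k > 0 then W l (k - 1) else 0))"
      by (simp add: star_add add.commute)
    also have "\<dots> = star (R l) ** R k - (if k = 0 \<and> l = 0 then mat 1 else 0)"
      unfolding W_rec diff_conv_add_uminus star_add star_minus star_mult by auto
    finally show "(if k > 0 then star (W l (k - 1)) else 0) + (if l > 0 then star (W (l - 1) k) else 0) =
        star (R l) ** R k - (if k = 0 \<and> l = 0 then mat 1 else 0)" .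
  qed
  from is_W_family_unique[OF this] have "star (W l k) = W k l" for k l by (simp add: fun_eq_iff)
  then show ?thesis by blast
qed

definition w :: "'n var \<Rightarrow> 'n var \<Rightarrow> 'k" where
  "w x y = (transpose (W (fst x) (fst y)) ** g) $ snd x $ snd y"

lemma w_sym: "w x y = w y x"
proof -
  have "transpose (W (fst x) (fst y)) ** g = g ** W (fst y) (fst x)"
    using g_star[of "W (fst x) (fst y)"] by (simp add: star_W)
  also have "\<dots> = transpose (transpose (W (fst y) (fst x)) ** g)"
    by (simp add: matrix_transpose_mul g_sym)
  finally show ?thesis by (simp add: w_def transpose_def)
qed

sublocale lin_subst R e
  by unfold_locales (rule R0)

sublocale gw_transform R e g w
proof
  fix x y :: "'n var"
  obtain k \<alpha> l' \<beta> where xy: "x = (k, \<alpha>)" "y = (l', \<beta>)" by (cases x; cases y)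
  let ?U = "(if k > 0 then W (k - 1) l' else 0) + (if l' > 0 then W k (l' - 1) else 0)"
  have "(if 1 \<le> fst x then w (fst x - 1, snd x) y else 0) + (if 1 \<le> fst y then w x (fst y - 1, snd y) else 0) =
      (transpose ?U ** g) $ \<alpha> $ \<beta>"
    by (auto simp: xy w_def transpose_def matrix_matrix_mult_def sum.distrib[symmetric] distrib_right)
  also have "transpose ?U ** g = transpose (R k) ** (g ** R l') - (if k = 0 \<and> l' = 0 then g else 0)"
  proof -
    have "transpose (star (R l')) ** g = g ** R l'"
      using g_star[of "star (R l')"] by simp
    then have "transpose (star (R l') ** R k) ** g = transpose (R k) ** (g ** R l')"
      by (simp add: matrix_transpose_mul matrix_mul_assoc[symmetric])
    moreover have "transpose (A - B) ** g = transpose A ** g - transpose B ** g" for A B :: "'k ^ 'n ^ 'n"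
      by (simp add: transpose_def matrix_matrix_mult_def vec_eq_iff left_diff_distrib sum_subtractf)
    ultimately show ?thesis unfolding W_rec by auto
  qed
  also have "(transpose (R k) ** (g ** R l') - (if k = 0 \<and> l' = 0 then g else 0)) $ \<alpha> $ \<beta> =
      (\<Sum>\<mu>\<in>UNIV. \<Sum>\<nu>\<in>UNIV. g $ \<mu> $ \<nu> * l (0, \<mu>) x * l (0, \<nu>) y) -
      (if fst x = 0 \<and> fst y = 0 then g $ snd x $ snd y else 0)"
    by (simp add: xy l_def transpose_def matrix_matrix_mult_def sum_distrib_left mult_ac)
  finally show "(if 1 \<le> fst x then w (fst x - 1, snd x) y else 0) + (if 1 \<le> fst y then w x (fst y - 1, snd y) else 0) =
      (\<Sum>\<mu>\<in>UNIV. \<Sum>\<nu>\<in>UNIV. g $ \<mu> $ \<nu> * l (0, \<mu>) x * l (0, \<nu>) y) -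
      (if fst x = 0 \<and> fst y = 0 then g $ snd x $ snd y else 0)" .
qed (rule g_inv, rule w_sym)

lemma quad_eq:
  "quad = msum (\<lambda>(k, l). bil (map_matrix mconst g) (map_matrix mconst (Wop g S k l) *v qvec e k) (qvec e l)) UNIV"
  by (simp add: quad_def Wop_eq bil_mconst w_def)

end

section \<open>Cones\<close>


lemma finite_multisets_bounded:
  assumes "finite X"
  shows "finite {s. set_mset s \<subseteq> X \<and> size s \<le> n}"
proof (rule finite_subset)
  show "{s. set_mset s \<subseteq> X \<and> size s \<le> n} \<subseteq> mset ` {xs. set xs \<subseteq> X \<and> length xs \<le> n}"
  proof
    fix s assume s: "s \<in> {s. set_mset s \<subseteq> X \<and> size s \<le> n}"
    obtain xs where "s = mset xs" by (metis ex_mset)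
    then show "s \<in> mset ` {xs. set xs \<subseteq> X \<and> length xs \<le> n}" using s by auto
  qed
  show "finite (mset ` {xs. set xs \<subseteq> X \<and> length xs \<le> n})"
    using assms by (intro finite_imageI finite_lists_length_le)
qed

text \<open>Without constant terms every factor uses up at least one variable of \<open>m\<close>,
  so \<open>size s \<le> size m\<close>; and the factors come from the finite set \<open>X m\<close>
  of those \<open>x\<close> whose series contains some part of \<open>m\<close>.\<close>

lemma finitaryI:
  assumes zero: "\<And>x. mcoeff (U x) {#} = 0" and fin: "\<And>m. finite {x. mcoeff (U x) m \<noteq> 0}"
  shows "finitary U"
  unfolding finitary_def
proof
  fix m
  define X where "X m = (\<Union>p\<in>{p. fst p + snd p = m}. {x. mcoeff (U x) (fst p) \<noteq> 0})" for m
  have "set_mset s \<subseteq> X m \<and> size s \<le> size m" if "mcoeff (pw U s) m \<noteq> 0" for s m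
    using that
  proof (induction s arbitrary: m)
    case (add x s)
    then obtain p where p: "fst p + snd p = m" "mcoeff (U x) (fst p) * mcoeff (pw U s) (snd p) \<noteq> 0"
      unfolding image_mset_add_mset prod_mset.add_mset mcoeff_times by (metis (mono_tags, lifting) mem_Collect_eq sum.neutral)
    then have nz: "mcoeff (U x) (fst p) \<noteq> 0" "mcoeff (pw U s) (snd p) \<noteq> 0"
      using mult_not_zero by auto
    then have IH: "set_mset s \<subseteq> X (snd p) \<and> size s \<le> size (snd p)" using add.IH by auto
    have "fst p \<noteq> {#}" using nz(1) zero[of x] by auto
    then have "size m > size (snd p)" using p(1) by (auto simp: nonempty_has_size)
    moreover have "x \<in> X m" using p(1) nz(1) by (auto simp: X_def)
    moreover have "X (snd p) \<subseteq> X m"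
    proof
      fix y assume "y \<in> X (snd p)"
      then obtain p' where "fst p' + snd p' = snd p" "mcoeff (U y) (fst p') \<noteq> 0" by (auto simp: X_def)
      then show "y \<in> X m" using p(1) unfolding X_def
        by (intro UN_I[of "(fst p', snd p' + fst p)"]) (auto simp: ac_simps)
    qed
    ultimately show ?case using IH by auto
  qed auto
  then have "{s. mcoeff (pw U s) m \<noteq> 0} \<subseteq> {s. set_mset s \<subseteq> X m \<and> size s \<le> size m}" by blast
  moreover have "finite (X m)" unfolding X_def using fin by auto
  ultimately show "finite {s. mcoeff (pw U s) m \<noteq> 0}"
    by (rule finite_subset[OF _ finite_multisets_bounded])
qed

section \<open>Multiplication by series in \<open>z^-1\<close> on the loop space\<close>

lemma lact_eq:
  assumes "\<And>j. j > K \<Longrightarrow> f j = 0" "K \<le> k + int M"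
  shows "lact A f k = (\<Sum>i\<le>M. A i *v f (k + int i))"
  unfolding lact_def
proof (rule sum.mono_neutral_left)
  show "{i. f (k + int i) \<noteq> 0} \<subseteq> {..M}"
  proof
    fix i assume "i \<in> {i. f (k + int i) \<noteq> 0}"
    then have "\<not> k + int i > K" using assms(1) by blast
    then show "i \<in> {..M}" using assms(2) by simp
  qed
qed auto

lemma lact_zero:
  assumes "\<And>j. j > K \<Longrightarrow> f j = 0" "k > K"
  shows "lact A f k = 0"
  using assms by (subst lact_eq[of K f k 0]) auto

lemma lact_nonneg:
  assumes K: "\<And>j. j > int K \<Longrightarrow> h j = 0"
  shows "lact A h (int n) = (\<Sum>k | n \<le> k \<and> k \<le> K. A (k - n) *v h (int k))"
proof -
  have "lact A h (int n) = (\<Sum>i\<le>K. A i *v h (int n + int i))"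
    by (rule lact_eq[OF K]) auto
  also have "\<dots> = (\<Sum>i | n + i \<le> K. A i *v h (int (n + i)))"
    by (rule sum.mono_neutral_cong_right) (auto simp: not_le K)
  also have "\<dots> = (\<Sum>k | n \<le> k \<and> k \<le> K. A (k - n) *v h (int k))"
    by (rule sum.reindex_bij_witness[of _ "\<lambda>k. k - n" "\<lambda>i. n + i"]) auto
  finally show ?thesis .
qed

lemma lact_loop_space:
  assumes "f \<in> loop_space"
  shows "lact A f \<in> loop_space"
proof -
  obtain K where "\<forall>j>K. f j = 0" using assms by (auto simp: loop_space_def)
  then have "\<forall>j>K. lact A f j = 0" using lact_zero[of K f] by blast
  then show ?thesis by (auto simp: loop_space_def)
qed

lemma lact_lact:
  assumes "f \<in> loop_space"
  shows "lact A (lact B f) = lact (sprod A B) f"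
proof
  fix k
  obtain K where K: "\<And>j. j > K \<Longrightarrow> f j = 0" using assms by (auto simp: loop_space_def)
  have K': "lact B f j = 0" if "j > K" for j using lact_zero[OF K that] .
  define M where "M = nat (K - k)"
  have "lact A (lact B f) k = (\<Sum>i\<le>M. A i *v lact B f (k + int i))"
    by (rule lact_eq[OF K']) (auto simp: M_def)
  also have "\<dots> = (\<Sum>i\<le>M. \<Sum>j\<le>M - i. (A i ** B j) *v f (k + int i + int j))"
  proof (rule sum.cong[OF refl])
    fix i assume i: "i \<in> {..M}"
    have "lact B f (k + int i) = (\<Sum>j\<le>M - i. B j *v f (k + int i + int j))"
      by (rule lact_eq[OF K]) (use i in \<open>auto simp: M_def\<close>)
    then show "A i *v lact B f (k + int i) = (\<Sum>j\<le>M - i. (A i ** B j) *v f (k + int i + int j))"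
      by (simp add: matrix_vector_sum_right matrix_vector_mul_assoc)
  qed
  also have "\<dots> = (\<Sum>(i, j)\<in>{(i, j). i + j \<le> M}. (A i ** B j) *v f (k + int i + int j))"
  proof -
    have "{(i, j). i + j \<le> M} = (SIGMA i:{..M}. {..M - i})" by auto
    then show ?thesis by (simp add: sum.Sigma)
  qed
  also have "\<dots> = (\<Sum>n\<le>M. \<Sum>i\<le>n. (A i ** B (n - i)) *v f (k + int i + int (n - i)))"
    by (rule sum.triangle_reindex_eq)
  also have "\<dots> = (\<Sum>n\<le>M. sprod A B n *v f (k + int n))"
    by (intro sum.cong refl) (simp add: sprod_def matrix_vector_sum_left)
  also have "\<dots> = lact (sprod A B) f k"
    by (rule lact_eq[symmetric, OF K]) (auto simp: M_def)
  finally show "lact A (lact B f) k = lact (sprod A B) f k" .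
qed

lemma lact_sone:
  assumes "f \<in> loop_space"
  shows "lact sone f = f"
proof
  fix k
  obtain K where K: "\<And>j. j > K \<Longrightarrow> f j = 0" using assms by (auto simp: loop_space_def)
  have "lact sone f k = (\<Sum>i\<le>nat (K - k). sone i *v f (k + int i))"
    by (rule lact_eq[OF K]) auto
  also have "\<dots> = (\<Sum>i\<in>{0}. sone i *v f (k + int i))"
    by (rule sum.mono_neutral_right) (auto simp: sone_def)
  finally show "lact sone f k = f k" by (simp add: sone_def)
qed

text \<open>The \<open>t\<close>-coordinates of a family, i.e. what is substituted into a series
  when it is evaluated there.\<close>

definition tpart :: "'n \<Rightarrow> ('n :: finite, 'k :: comm_ring_1) family \<Rightarrow> 'n var \<Rightarrow> ('n, 'k) fun_t" where
  "tpart e f x = qpart f (fst x) (snd x) + dilaton e x"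

lemma subst_eq_mcomp: "subst e F v = mcomp F (\<lambda>x. v (fst x) (snd x) + dilaton e x)"
  by (simp add: subst_def msum_def mcomp_def subst_term_def)

lemma subst_ok_iff: "subst_ok e F v \<longleftrightarrow> comp_ok F (\<lambda>x. v (fst x) (snd x) + dilaton e x)"
  by (simp add: subst_ok_def msummable_def comp_ok_def subst_term_def)

lemma mcoeff_qpart: "mcoeff (qpart f n \<alpha>) m = f m (int n) $ \<alpha>"
  by (simp add: qpart_def)

lemma vec_dilaton: "mcoeff (dilaton e x :: ('n, 'k :: comm_ring_1) fun_t) m = (if m = {#} \<and> x = (1, e) then 1 else 0)"
  by (auto simp: dilaton_def mcoeff_1)

lemma based_tpart: "f \<in> based e \<Longrightarrow> mcoeff (tpart e f x) {#} = 0"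
  by (cases x) (auto simp: tpart_def mcoeff_qpart based_def vec_dilaton axis_def)

lemma finitary_tpart:
  fixes f :: "('n :: finite, 'k :: sum_ring) family"
  assumes "f \<in> based e" "\<And>m. f m \<in> loop_space"
  shows "finitary (tpart e f)"
proof (rule finitaryI)
  fix m
  obtain K where K: "\<forall>j>K. f m j = 0" using assms(2)[of m] by (auto simp: loop_space_def)
  have "{x. mcoeff (tpart e f x) m \<noteq> 0} \<subseteq> vars (max 1 (nat K))"
  proof
    fix x assume "x \<in> {x. mcoeff (tpart e f x) m \<noteq> 0}"
    then have "f m (int (fst x)) \<noteq> 0 \<or> x = (1, e)"
      by (auto simp: tpart_def mcoeff_qpart vec_dilaton split: if_splits)
    then have "\<not> int (fst x) > K \<or> x = (1, e)" using K by blast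
    then show "x \<in> vars (max 1 (nat K))" by auto
  qed
  then show "finite {x. mcoeff (tpart e f x) m \<noteq> 0}" by (rule finite_subset) simp
qed (rule based_tpart[OF assms(1)])

text \<open>The formal series \<open>\<Sum> c_y q_y\<close>. It may have infinitely many terms, so
  it is described by its coefficients; the constant one is the dilaton shift.\<close>

definition lin_series :: "'n \<Rightarrow> ('n var \<Rightarrow> 'k) \<Rightarrow> ('n, 'k :: comm_ring_1) fun_t \<Rightarrow> bool" where
  "lin_series e c f \<longleftrightarrow> mcoeff f {#} = - c (1, e) \<and> (\<forall>y. mcoeff f {#y#} = c y) \<and>
     (\<forall>m. size m \<noteq> 0 \<longrightarrow> size m \<noteq> 1 \<longrightarrow> mcoeff f m = 0)"

lemma lin_series_mcomp:
  fixes h :: "('n :: finite, 'k :: sum_ring) family"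
  assumes f: "lin_series e c f" and fin: "finitary (tpart e h)"
    and K: "\<And>j. j > int K \<Longrightarrow> h m j = 0" "K \<ge> 1"
  shows "mcoeff (mcomp f (tpart e h)) m = (\<Sum>y\<in>vars K. c y * h m (int (fst y)) $ snd y)"
proof -
  let ?U = "tpart e h"
  let ?V = "vars K :: 'n var set"
  let ?a = "\<lambda>s. mcoeff f s * mcoeff (pw ?U s) m"
  have "has_comp f ?U (mcomp f ?U)" by (intro has_comp_mcomp finitary_comp_ok fin)
  then have "(?a has_sum mcoeff (mcomp f ?U) m) UNIV" by (simp add: has_comp_def)
  moreover have "(?a has_sum sum ?a (insert {#} ((\<lambda>y. {#y#}) ` ?V))) UNIV"
  proof (rule has_sum_finite_neutralI)
    fix s assume s: "s \<in> UNIV - insert {#} ((\<lambda>y. {#y#}) ` ?V)"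
    show "?a s = 0"
    proof (cases "size s = 1")
      case True
      then obtain y where y: "s = {#y#}" by (metis size_1_singleton_mset)
      then have "fst y > K" using s by auto
      then have "mcoeff (?U y) m = 0" using K by (auto simp: tpart_def mcoeff_qpart vec_dilaton)
      then show ?thesis by (simp add: y)
    next
      case False
      then show ?thesis using s f by (auto simp: lin_series_def)
    qed
  qed auto
  ultimately have "mcoeff (mcomp f ?U) m = sum ?a (insert {#} ((\<lambda>y. {#y#}) ` ?V))"
    by (rule has_sum_unique)
  also have "\<dots> = ?a {#} + (\<Sum>y\<in>?V. ?a {#y#})"
    by (subst sum.insert) (auto simp: sum.reindex inj_on_def)
  \<comment> \<open>The dilaton term of \<open>tpart\<close> contributes \<open>c (1, e)\<close> to
    the constant coefficient, and the constant term of \<open>f\<close> cancels it. The assumption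
    \<open>K \<ge> 1\<close> puts \<open>(1, e)\<close> into the range.\<close>
  also have "(\<Sum>y\<in>?V. ?a {#y#}) = (\<Sum>y\<in>?V. c y * h m (int (fst y)) $ snd y) +
      (\<Sum>y\<in>?V. if y = (1, e) then (if m = {#} then c y else 0) else 0)"
    unfolding sum.distrib[symmetric] using f
    by (intro sum.cong) (auto simp: lin_series_def tpart_def mcoeff_qpart vec_dilaton distrib_left)
  also have "(\<Sum>y\<in>?V. if y = (1, e) then (if m = {#} then c y else 0) else 0) = (if m = {#} then c (1, e) else 0)"
    using K(2) by simp
  also have "?a {#} = - (if m = {#} then c (1, e) else 0)"
    using f by (simp add: lin_series_def mcoeff_1)
  finally show ?thesis by simp
qed

section \<open>Cones as graphs, and uniqueness of the transformed function\<close>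

context bilinear_form
begin

lemma dual_basis_sum:
  "(\<Sum>\<alpha>\<in>UNIV. c $ \<alpha> *s dual_basis g \<alpha>) = matrix_inv g *v c"
proof -
  have "(\<Sum>\<alpha>\<in>UNIV. c $ \<alpha> *s dual_basis g \<alpha>) $ i = (matrix_inv g *v c) $ i" for i
  proof -
    have "dual_basis g \<alpha> $ i = matrix_inv g $ i $ \<alpha>" for \<alpha>
      using arg_cong[OF matrix_inv_sym, of "\<lambda>A. A $ i $ \<alpha>"]
      by (simp add: dual_basis_def axis_def transpose_def if_distrib cong: if_cong)
    then show ?thesis by (simp add: matrix_vector_mult_def mult.commute)
  qed
  then show ?thesis by (simp add: vec_eq_iff)
qed

definition grad :: "('n, 'k) fun_t \<Rightarrow> ('n var \<Rightarrow> ('n, 'k) fun_t) \<Rightarrow> 'n var multiset \<Rightarrow> nat \<Rightarrow> 'k ^ 'n" where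
  "grad F U m i = (\<chi> \<alpha>. mcoeff (mcomp (mderiv (i, \<alpha>) F) U) m)"

lemma cone_iff:
  "f \<in> cone g e F \<longleftrightarrow> (\<forall>m. f m \<in> loop_space) \<and> (\<forall>x. comp_ok (mderiv x F) (tpart e f)) \<and>
     (\<forall>m i. f m (- int i - 1) = sg (i + 1) (matrix_inv g *v grad F (tpart e f) m i))"
proof -
  have "(- 1) ^ (i + 1) *s v = sg (i + 1) v" for i and v :: "'k ^ 'n"
    by (simp add: sg_def vec_eq_iff)
  moreover have "(\<Sum>\<alpha>\<in>UNIV. mcoeff (mcomp (mderiv (i, \<alpha>) F) U) m *s dual_basis g \<alpha>) = matrix_inv g *v grad F U m i"
    for i U m
    using dual_basis_sum[of "grad F U m i"] by (simp add: grad_def)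
  ultimately show ?thesis
    unfolding cone_def subst_ok_iff subst_eq_mcomp tpart_def[symmetric] by (simp add: split_paired_All)
qed

lemma cone_unique:
  assumes "f \<in> cone g e F" "f' \<in> cone g e F" "\<And>m k. k \<ge> 0 \<Longrightarrow> f m k = f' m k"
  shows "f = f'"
proof (intro ext)
  fix m k
  have "tpart e f = tpart e f'" using assms(3) by (intro ext) (simp add: tpart_def qpart_def)
  then have "f m (- int i - 1) = f' m (- int i - 1)" for i
    using assms(1,2) unfolding cone_iff by metis
  from this[of "nat (- k - 1)"] show "f m k = f' m k"
    using assms(3)[of k m] by (cases "k \<ge> 0") auto
qed

text \<open>The point of the graph of \<open>dF\<close> over the \<open>q\<close>-part of
  \<open>h\<close>; the index \<open>nat (- k - 1)\<close> inverts
  \<open>k = - i - 1\<close>.\<close>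

definition lift_point :: "'n \<Rightarrow> ('n, 'k) fun_t \<Rightarrow> ('n, 'k) family \<Rightarrow> ('n, 'k) family" where
  "lift_point e F h = (\<lambda>m k. if k \<ge> 0 then h m k
     else sg (nat (- k - 1) + 1) (matrix_inv g *v grad F (tpart e h) m (nat (- k - 1))))"

lemma tpart_lift_point: "tpart e (lift_point e F h) = tpart e h"
  by (simp add: tpart_def qpart_def lift_point_def fun_eq_iff)

lemma lift_point_cone:
  assumes "\<And>m. h m \<in> loop_space" "\<And>x. comp_ok (mderiv x F) (tpart e h)"
  shows "lift_point e F h \<in> cone g e F"
  unfolding cone_iff tpart_lift_point
proof (intro conjI allI)
  fix m
  obtain K where "\<forall>j>K. h m j = 0" using assms(1)[of m] by (auto simp: loop_space_def)
  then have "\<forall>j>max K 0. lift_point e F h m j = 0" by (simp add: lift_point_def)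
  then show "lift_point e F h m \<in> loop_space" unfolding loop_space_def by blast
qed (use assms in \<open>auto simp: lift_point_def\<close>)

lemma tpart_univ_point: "tpart e (univ_point e :: ('n, 'k) family) = mvar"
proof
  fix x :: "'n var"
  show "tpart e (univ_point e) x = (mvar x :: ('n, 'k) fun_t)"
    by (rule mfps_eqI) (simp add: tpart_def mcoeff_qpart univ_point_def qvar_def)
qed

lemma is_hat_unique:
  assumes "is_hat g e A F G" "is_hat g e A F G'"
  shows "G = G'"
proof -
  have fin: "finitary (mvar :: 'n var \<Rightarrow> ('n, 'k) fun_t)"
    unfolding finitary_def by (simp add: mcoeff_pw_mvar)
  have comp: "mcomp F mvar = F" for F :: "('n, 'k) fun_t"
    using has_comp_ident[of F] by (simp add: has_comp_iff)
  have loop: "univ_point e m \<in> (loop_space :: (int \<Rightarrow> 'k ^ 'n) set)" for m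
  proof -
    obtain N where N: "N \<ge> 1" "set_mset m \<subseteq> vars N" using vars_exhaust by blast
    have "univ_point e m j = (0 :: 'k ^ 'n)" if "j > int N" for j
    proof -
      have "m \<noteq> {#(nat j, \<alpha>)#}" for \<alpha> using N(2) that by auto
      then show ?thesis using that N(1)
        by (auto simp: univ_point_def vec_eq_iff qvar_def mcoeff_mvar vec_dilaton)
    qed
    then show ?thesis by (auto simp: loop_space_def)
  qed
  let ?f = "lift_point e G (univ_point e)"
  have "?f \<in> cone g e G"
    by (rule lift_point_cone) (auto simp: loop tpart_univ_point intro: finitary_comp_ok fin)
  moreover have "?f \<in> based e"
    by (auto simp: based_def lift_point_def univ_point_def vec_eq_iff qvar_def mcoeff_mvar vec_dilaton axis_def)
  ultimately have "?f \<in> cone g e G'"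
    using assms by (auto simp: is_hat_def)
  then have "sg (i + 1) (matrix_inv g *v grad G' mvar m i) = ?f m (- int i - 1)" for m i
    by (simp add: cone_iff tpart_lift_point tpart_univ_point)
  also have "?f m (- int i - 1) = sg (i + 1) (matrix_inv g *v grad G mvar m i)" for m i
    using \<open>?f \<in> cone g e G\<close> by (simp add: cone_iff tpart_lift_point tpart_univ_point)
  finally have "matrix_inv g *v grad G mvar m i = matrix_inv g *v grad G' mvar m i" for m i
    by (metis sg_cancel)
  then have "g *v (matrix_inv g *v grad G mvar m i) = g *v (matrix_inv g *v grad G' mvar m i)" for m i
    by simp
  then have "grad G mvar m i = grad G' mvar m i" for m i
    by (simp add: matrix_vector_mul_assoc g_inv)
  then have d: "mderiv x G = mderiv x G'" for x
    by (cases x) (auto intro!: mfps_eqI simp: grad_def vec_eq_iff comp)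
  have "2 * G = 2 * G'"
    using assms by (simp add: is_hat_def GW0_def DE_def d)
  then show ?thesis by (metis half_times_2)
qed

end

section \<open>Transport of cones by \<open>S\<close>\<close>

context symplectic_series
begin

lemma lin_series_L: "lin_series e (l x) (L x)"
  by (auto simp: lin_series_def mcoeff_L)

lemma lin_series_half_quad: "lin_series e (w z) (mderiv z half_quad)"
  unfolding lin_series_def
proof (intro conjI allI impI)
  have main: "mcoeff (mderiv z half_quad) m = (\<Sum>y\<in>vars N. w z y * mcoeff (q e y) m)"
    if "N \<ge> 1" "fst z \<le> N" "set_mset m \<subseteq> vars N" for N m
    using trunc_mderiv_half_quad[OF that(1,2)] that(3) mcoeff_trunc[of "vars N" "mderiv z half_quad" m] by simp
  have ex: "\<exists>N. N \<ge> 1 \<and> fst z \<le> N \<and> set_mset m \<subseteq> vars N" for m :: "'n var multiset"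
  proof -
    obtain N where "N \<ge> 1" "set_mset m \<subseteq> vars N" using vars_exhaust by blast
    then show ?thesis by (intro exI[of _ "max N (fst z)"]) force
  qed
  show "mcoeff (mderiv z half_quad) {#} = - w z (1, e)"
  proof -
    obtain N where N: "N \<ge> 1" "fst z \<le> N" using ex[of "{#}"] by blast
    have "(\<Sum>y\<in>vars N. w z y * mcoeff (q e y) {#}) = (\<Sum>y\<in>vars N. if y = (1, e) then - w z y else 0)"
      by (rule sum.cong) (auto simp: mcoeff_q)
    then show ?thesis using main[OF N, of "{#}"] N by simp
  qed
  show "mcoeff (mderiv z half_quad) {#y#} = w z y" for y
  proof -
    obtain N where N: "N \<ge> 1" "fst z \<le> N" "set_mset {#y#} \<subseteq> vars N" using ex[of "{#y#}"] by blast
    have "(\<Sum>x\<in>vars N. w z x * mcoeff (q e x) {#y#}) = (\<Sum>x\<in>vars N. if x = y then w z x else 0)"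
      by (rule sum.cong) (auto simp: mcoeff_q)
    then show ?thesis using main[OF N] N by simp
  qed
  show "mcoeff (mderiv z half_quad) m = 0" if "size m \<noteq> 0" "size m \<noteq> 1" for m
  proof -
    obtain N where N: "N \<ge> 1" "fst z \<le> N" "set_mset m \<subseteq> vars N" using ex[of m] by blast
    have "mcoeff (q e y :: ('n, 'k) fun_t) m = 0" for y using that by (auto simp: mcoeff_q)
    then show ?thesis using main[OF N] by simp
  qed
qed

lemma lact_R_component:
  assumes K: "\<And>j. j > int K \<Longrightarrow> h j = 0"
  shows "lact R h (int n) $ \<mu> = (\<Sum>y\<in>vars K. l (n, \<mu>) y * h (int (fst y)) $ snd y)"
proof -
  have "lact R h (int n) = (\<Sum>k | n \<le> k \<and> k \<le> K. R (k - n) *v h (int k))"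
    by (rule lact_nonneg[OF K])
  also have "\<dots> = (\<Sum>k\<le>K. if n \<le> k then R (k - n) *v h (int k) else 0)"
    by (rule sum.mono_neutral_cong_left) auto
  also have "\<dots> $ \<mu> = (\<Sum>k\<le>K. \<Sum>\<beta>\<in>UNIV. l (n, \<mu>) (k, \<beta>) * h (int k) $ \<beta>)"
    by (auto simp: l_def matrix_vector_mult_def intro!: sum.cong)
  finally show ?thesis by (simp add: sum_vars)
qed

lemma loop_bound:
  assumes "h \<in> loop_space"
  obtains K where "K \<ge> 1" "\<And>j. j > int K \<Longrightarrow> h j = 0"
proof -
  obtain K where K: "\<forall>j>K. h j = 0" using assms by (auto simp: loop_space_def)
  have "h j = 0" if "j > int (max 1 (nat K))" for j
    using K that by auto
  then show ?thesis using that[of "max 1 (nat K)"] by auto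
qed

text \<open>\<open>R\<close> contains no positive powers of \<open>z\<close>, so the
  \<open>q\<close>-part of \<open>R h\<close> depends only on the \<open>q\<close>-part of
  \<open>h\<close>, and it does so through the linear forms in \<open>T\<close>.\<close>

lemma mcomp_T:
  assumes h: "h \<in> based e" "\<And>m. h m \<in> loop_space"
  shows "mcomp (T x) (tpart e h) = tpart e (fam_act R h) x"
proof (rule mfps_eqI)
  fix m
  have fin: "finitary (tpart e h)" using h by (rule finitary_tpart)
  obtain K where K: "K \<ge> 1" "\<And>j. j > int K \<Longrightarrow> h m j = 0" using loop_bound[OF h(2)[of m]] by blast
  have "has_comp (T x) (tpart e h) (mcomp (L x) (tpart e h) + dilaton e x)"
    unfolding T_def by (subst (1 2) dilaton_mconst)
      (intro has_comp_add has_comp_mcomp has_comp_mconst finitary_comp_ok fin)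
  then have "mcoeff (mcomp (T x) (tpart e h)) m =
      (\<Sum>y\<in>vars K. l x y * h m (int (fst y)) $ snd y) + mcoeff (dilaton e x) m"
    using lin_series_mcomp[OF lin_series_L fin K(2,1)] by (simp add: has_comp_iff)
  also have "(\<Sum>y\<in>vars K. l x y * h m (int (fst y)) $ snd y) = lact R (h m) (int (fst x)) $ snd x"
    by (simp add: lact_R_component[OF K(2)])
  also have "\<dots> + mcoeff (dilaton e x) m = mcoeff (tpart e (fam_act R h) x) m"
    by (simp add: tpart_def mcoeff_qpart fam_act_def)
  finally show "mcoeff (mcomp (T x) (tpart e h)) m = mcoeff (tpart e (fam_act R h) x) m" .
qed

lemma mcomp_mcomp_T:
  assumes h: "h \<in> based e" "\<And>m. h m \<in> loop_space" and F: "comp_ok F T"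
  shows "has_comp F (tpart e (fam_act R h)) (mcomp (mcomp F T) (tpart e h))"
proof -
  have "has_comp F (\<lambda>x. mcomp (T x) (tpart e h)) (mcomp (mcomp F T) (tpart e h))"
    using has_comp_mcomp[OF F] finitary_tpart[OF h] by (rule has_comp_compose)
  then show ?thesis by (simp add: mcomp_T[OF h])
qed

text \<open>The symmetry \<open>star_W\<close> moves the adjoint to the factor with the large index,
  where it becomes a coefficient of \<open>S\<close>; the signs \<open>j\<close> and
  \<open>j + n + 1\<close> leave the common sign \<open>n + 1\<close>.\<close>

lemma W_eq: "W k n = sg (n + 1) (\<Sum>j\<le>k. S (n + 1 + j) ** R (k - j))"
proof -
  have "W k n = star (W n k)" by (simp add: star_W)
  also have "\<dots> = (\<Sum>j\<le>k. sg j (star (R (n + 1 + j)) ** R (k - j)))"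
    unfolding W_def star_sum star_sg star_mult star_star ..
  also have "\<dots> = (\<Sum>j\<le>k. sg (j + (j + (n + 1))) (S (n + 1 + j) ** R (k - j)))"
    by (simp add: star_R matrix_sg_left sg_sg add_ac)
  finally show ?thesis by (simp only: sg_add_same sg_sum)
qed

text \<open>The chain rule multiplies gradients by transposes of \<open>R\<close>. Raising the index
  with \<open>matrix_inv g\<close> turns these into adjoints, hence into signed coefficients of
  \<open>S\<close>, as needed for the \<open>p\<close>-part of a point moved by
  \<open>S\<close>.\<close>

lemma grad_transform:
  assumes ok: "comp_ok F T" and h: "h \<in> based e" "\<And>m. h m \<in> loop_space"
    and K: "K \<ge> 1" "\<And>j. j > int K \<Longrightarrow> h m j = 0"
  shows "matrix_inv g *v grad (transform F) (tpart e h) m n =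
    (\<Sum>j\<le>n. sg (n - j) (S (n - j) *v (matrix_inv g *v grad F (tpart e (fam_act R h)) m j))) +
    (\<Sum>k\<le>K. W k n *v h m (int k))"
proof -
  let ?U = "tpart e h"
  let ?U' = "tpart e (fam_act R h)"
  have fin: "finitary ?U" using h by (rule finitary_tpart)
  have "grad (transform F) ?U m n $ \<alpha> = ((\<Sum>j\<le>n. transpose (R (n - j)) *v grad F ?U' m j) +
    (\<Sum>k\<le>K. (transpose (W n k) ** g) *v h m (int k))) $ \<alpha>" for \<alpha>
  proof -
    have "mderiv (n, \<alpha>) (transform F) = (\<Sum>x\<in>vars n. mconst (l x (n, \<alpha>)) * mcomp (mderiv x F) T) +
        mderiv (n, \<alpha>) half_quad"
      by (simp add: transform_def mderiv_add chain_rule(2)[OF ok])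
    moreover have "has_comp ((\<Sum>x\<in>vars n. mconst (l x (n, \<alpha>)) * mcomp (mderiv x F) T) +
        mderiv (n, \<alpha>) half_quad) ?U ((\<Sum>x\<in>vars n. mconst (l x (n, \<alpha>)) * mcomp (mcomp (mderiv x F) T) ?U) +
        mcomp (mderiv (n, \<alpha>) half_quad) ?U)"
      by (intro has_comp_add has_comp_sum has_comp_mconst_mult has_comp_mcomp finitary_comp_ok fin)
    ultimately have "mcomp (mderiv (n, \<alpha>) (transform F)) ?U =
        (\<Sum>x\<in>vars n. mconst (l x (n, \<alpha>)) * mcomp (mcomp (mderiv x F) T) ?U) +
        mcomp (mderiv (n, \<alpha>) half_quad) ?U"
      by (simp add: has_comp_iff)
    moreover have "mcomp (mcomp (mderiv x F) T) ?U = mcomp (mderiv x F) ?U'" for x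
      using mcomp_mcomp_T[OF h chain_rule(1)[OF ok]] by (simp add: has_comp_iff)
    moreover have "mcoeff (mcomp (mderiv (n, \<alpha>) half_quad) ?U) m =
        (\<Sum>y\<in>vars K. w (n, \<alpha>) y * h m (int (fst y)) $ snd y)"
      by (rule lin_series_mcomp[OF lin_series_half_quad fin K(2,1)])
    ultimately have "grad (transform F) ?U m n $ \<alpha> =
        (\<Sum>x\<in>vars n. l x (n, \<alpha>) * mcoeff (mcomp (mderiv x F) ?U') m) +
        (\<Sum>y\<in>vars K. w (n, \<alpha>) y * h m (int (fst y)) $ snd y)"
      by (simp add: grad_def)
    also have "(\<Sum>x\<in>vars n. l x (n, \<alpha>) * mcoeff (mcomp (mderiv x F) ?U') m) =
        (\<Sum>j\<le>n. (transpose (R (n - j)) *v grad F ?U' m j) $ \<alpha>)"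
      by (auto simp: sum_vars l_def matrix_vector_mult_def transpose_def grad_def
          simp del: transpose_matrix_vector intro!: sum.cong)
    also have "(\<Sum>y\<in>vars K. w (n, \<alpha>) y * h m (int (fst y)) $ snd y) =
        (\<Sum>k\<le>K. ((transpose (W n k) ** g) *v h m (int k)) $ \<alpha>)"
      by (simp add: sum_vars w_def matrix_vector_mult_def[of "_ ** _"])
    finally show ?thesis by (simp del: transpose_matrix_vector)
  qed
  then have "grad (transform F) ?U m n = (\<Sum>j\<le>n. transpose (R (n - j)) *v grad F ?U' m j) +
    (\<Sum>k\<le>K. (transpose (W n k) ** g) *v h m (int k))"
    by (simp add: vec_eq_iff)
  then have "matrix_inv g *v grad (transform F) ?U m n =
      (\<Sum>j\<le>n. (matrix_inv g ** transpose (R (n - j))) *v grad F ?U' m j) +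
      (\<Sum>k\<le>K. (matrix_inv g ** (transpose (W n k) ** g)) *v h m (int k))"
    by (simp add: matrix_vector_right_distrib matrix_vector_sum_right matrix_vector_mul_assoc del: transpose_matrix_vector)
  moreover have "matrix_inv g ** (transpose (W n k) ** g) = W k n" for k
    using star_W[of n k] by (simp add: star_def matrix_mul_assoc)
  moreover have "matrix_inv g ** transpose (R i) = sg i (S i) ** matrix_inv g" for i
  proof -
    have "sg i (S i) ** matrix_inv g = star (R i) ** matrix_inv g" by (simp add: star_R)
    also have "\<dots> = matrix_inv g ** transpose (R i) ** (g ** matrix_inv g)"
      by (simp only: star_def matrix_mul_assoc)
    finally show ?thesis by (simp add: g_inv)
  qed
  ultimately show ?thesis
    by (simp add: matrix_vector_mul_assoc[symmetric] matrix_vector_sg_left)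
qed

lemma fam_act_S_R: "(\<And>m. f m \<in> loop_space) \<Longrightarrow> fam_act S (fam_act R f) = f"
  by (simp add: fam_act_def lact_lact lact_sone SR)

lemma fam_act_R_S: "(\<And>m. f m \<in> loop_space) \<Longrightarrow> fam_act R (fam_act S f) = f"
  by (simp add: fam_act_def lact_lact lact_sone RS)

text \<open>The \<open>p\<close>-part of \<open>S f\<close> has two sources: the
  \<open>p\<close>-part of \<open>f\<close>, giving the chain rule terms of
  \<open>grad_transform\<close>, and the \<open>q\<close>-part of \<open>f\<close>, which is
  \<open>[R h]_+\<close> and gives the \<open>W\<close> terms.\<close>

lemma fam_act_cone:
  assumes ok: "comp_ok F T" and f: "f \<in> cone g e F" and based: "fam_act S f \<in> based e"
  shows "fam_act S f \<in> cone g e (transform F)"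
proof -
  define h where "h = fam_act S f"
  have loop: "f m \<in> loop_space" for m using f by (simp add: cone_iff)
  have h: "h \<in> based e" "h m \<in> loop_space" for m
    using based loop by (auto simp: h_def fam_act_def lact_loop_space)
  have fh: "f = fam_act R h" by (simp add: h_def fam_act_R_S loop)
  have fneg: "f m (- int i - 1) = sg (i + 1) (matrix_inv g *v grad F (tpart e f) m i)" for m i
    using f by (simp add: cone_iff)
  have "h m (- int n - 1) = sg (n + 1) (matrix_inv g *v grad (transform F) (tpart e h) m n)" for m n
  proof -
    obtain K where K: "K \<ge> 1" "\<And>j. j > int K \<Longrightarrow> h m j = 0" using loop_bound[OF h(2)[of m]] by blast
    have Kf: "f m j = 0" if "j > int K" for j
      unfolding fh fam_act_def using lact_zero[OF K(2) that] .
    have "h m (- int n - 1) = (\<Sum>i\<le>n + 1 + K. S i *v f m (- int n - 1 + int i))"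
      unfolding h_def fam_act_def by (rule lact_eq[OF Kf]) auto
    \<comment> \<open>For \<open>i < n + 1\<close> the exponent \<open>- n - 1 + i\<close> is
      negative and meets the \<open>p\<close>-part of \<open>f\<close>; from
      \<open>i = n + 1\<close> on it meets the \<open>q\<close>-part.\<close>
    also have "\<dots> = (\<Sum>i<n + 1. S i *v f m (- int n - 1 + int i)) +
        (\<Sum>i\<le>K. S (n + 1 + i) *v f m (- int n - 1 + int (n + 1 + i)))"
    proof -
      have "{..n + 1 + K} = {..<n + 1} \<union> (\<lambda>i. n + 1 + i) ` {..K}"
      proof -
        have "x \<in> {..<n + 1} \<union> (\<lambda>i. n + 1 + i) ` {..K}" if "x \<le> n + 1 + K" for x
          using that by (cases "x < n + 1") (auto simp: image_iff intro!: bexI[of _ "x - (n + 1)"])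
        then show ?thesis by auto
      qed
      moreover have "{..<n + 1} \<inter> (\<lambda>i. n + 1 + i) ` {..K} = {}" by auto
      ultimately show ?thesis
        by (simp only: sum.union_disjoint finite_lessThan finite_atMost finite_imageI)
          (simp add: sum.reindex inj_on_def)
    qed
    also have "(\<Sum>i<n + 1. S i *v f m (- int n - 1 + int i)) = (\<Sum>j\<le>n. S (n - j) *v f m (- int j - 1))"
      by (rule sum.reindex_bij_witness[of _ "\<lambda>j. n - j" "\<lambda>j. n - j"]) (auto simp: of_nat_diff algebra_simps)
    also have "\<dots> = sg (n + 1) (\<Sum>j\<le>n. sg (n - j) (S (n - j) *v (matrix_inv g *v grad F (tpart e f) m j)))"
    proof -
      have "sg (n + 1) (sg (n - j) v) = sg (j + 1) v" if "j \<le> n" for j and v :: "'k ^ 'n"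
        using that by (auto simp: sg_def)
      then show ?thesis unfolding sg_sum fneg matrix_vector_sg_right by (intro sum.cong) auto
    qed
    also have "(\<Sum>i\<le>K. S (n + 1 + i) *v f m (- int n - 1 + int (n + 1 + i))) =
        sg (n + 1) (\<Sum>k\<le>K. W k n *v h m (int k))"
    proof -
      have "f m (int i) = (\<Sum>k | i \<le> k \<and> k \<le> K. R (k - i) *v h m (int k))" for i
        unfolding fh fam_act_def by (rule lact_nonneg[OF K(2)])
      then have "(\<Sum>i\<le>K. S (n + 1 + i) *v f m (- int n - 1 + int (n + 1 + i))) =
          (\<Sum>i\<le>K. \<Sum>k | i \<le> k \<and> k \<le> K. (S (n + 1 + i) ** R (k - i)) *v h m (int k))"
        by (simp add: matrix_vector_sum_right matrix_vector_mul_assoc)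
      also have "\<dots> = (\<Sum>i\<in>{..K}. \<Sum>k\<in>{k. k \<in> {..K} \<and> i \<le> k}. (S (n + 1 + i) ** R (k - i)) *v h m (int k))"
        by (intro sum.cong) auto
      \<comment> \<open>After the exchange, each \<open>k\<close> collects the products that
        \<open>W_eq\<close> assembles into \<open>W k n\<close>.\<close>
      also have "\<dots> = (\<Sum>k\<in>{..K}. \<Sum>i\<in>{i. i \<in> {..K} \<and> i \<le> k}. (S (n + 1 + i) ** R (k - i)) *v h m (int k))"
        by (rule sum.swap_restrict) auto
      also have "\<dots> = (\<Sum>k\<le>K. \<Sum>i\<le>k. (S (n + 1 + i) ** R (k - i)) *v h m (int k))"
        by (intro sum.cong) auto
      also have "\<dots> = sg (n + 1) (\<Sum>k\<le>K. W k n *v h m (int k))"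
        by (simp only: W_eq sg_sum matrix_vector_sg_left matrix_vector_sum_left sg_sg sg_double)
      finally show ?thesis .
    qed
    finally show ?thesis
      using grad_transform[OF ok h K, of n] unfolding fh[symmetric] by (simp only: sg_add)
  qed
  then show ?thesis
    unfolding cone_iff h_def[symmetric] using h finitary_comp_ok finitary_tpart by blast
qed

lemma is_hat_transform:
  assumes ok: "comp_ok F T" and F: "F \<in> GW0 g e"
  shows "is_hat g e S F (transform F)"
  unfolding is_hat_def
proof (intro conjI set_eqI iffI)
  show "transform F \<in> GW0 g e" using ok F by (rule GW0_transform)
next
  fix h assume "h \<in> fam_act S ` cone g e F \<inter> based e"
  then show "h \<in> cone g e (transform F) \<inter> based e" using fam_act_cone[OF ok] by auto
next
  fix h assume "h \<in> cone g e (transform F) \<inter> based e"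
  then have h: "h \<in> cone g e (transform F)" "h \<in> based e" "h m \<in> loop_space" for m
    by (auto simp: cone_iff)
  \<comment> \<open>The candidate preimage is the point of the cone of \<open>F\<close> over the
    \<open>q\<close>-part of \<open>R h\<close>. The \<open>q\<close>-part of \<open>S f\<close>
    depends only on that of \<open>f\<close>, so \<open>S f\<close> and \<open>h\<close> agree in
    non-negative powers; both lie on the graph for \<open>transform F\<close> and therefore
    coincide.\<close>
  define f where "f = lift_point e F (fam_act R h)"
  have loopR: "fam_act R h m \<in> loop_space" for m by (simp add: fam_act_def lact_loop_space h)
  have f: "f \<in> cone g e F"
    unfolding f_def
  proof (rule lift_point_cone[OF loopR])
    show "comp_ok (mderiv x F) (tpart e (fam_act R h))" for x
      using mcomp_mcomp_T[OF h(2,3) chain_rule(1)[OF ok]] by (simp add: has_comp_iff)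
  qed
  have pos: "fam_act S f m k = h m k" if "k \<ge> 0" for m k
  proof -
    have "f m (k + int i) = fam_act R h m (k + int i)" for i
      using that by (simp add: f_def lift_point_def)
    then have "lact S (f m) k = lact S (fam_act R h m) k" by (simp add: lact_def)
    also have "\<dots> = h m k" using fam_act_S_R[of h] h(3) by (metis fam_act_def)
    finally show ?thesis by (simp add: fam_act_def)
  qed
  then have "fam_act S f \<in> based e" using h(2) by (simp add: based_def)
  then have "fam_act S f \<in> cone g e (transform F)" by (rule fam_act_cone[OF ok f])
  then have "fam_act S f = h" using cone_unique[OF _ h(1)] pos by blast
  then show "h \<in> fam_act S ` cone g e F \<inter> based e" using f h(2) by blast
qed

lemma subst_ok_T: "subst_ok e F (qpart (fam_act (sinv S) (univ_point e))) \<longleftrightarrow> comp_ok F T"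
proof -
  have "T = (\<lambda>x. qpart (fam_act R (univ_point e)) (fst x) (snd x) + dilaton e x)"
    by (simp add: T_def L_def fun_eq_iff)
  then show ?thesis by (simp only: subst_ok_iff sinv_S)
qed

lemma hat_formula:
  assumes "F \<in> GW0 g e" and "comp_ok F T"
  shows "\<exists>!G. is_hat g e S F G"
    and "hat g e S F = transform F"
proof -
  show "\<exists>!G. is_hat g e S F G" and "hat g e S F = transform F"
    using is_hat_transform[OF assms(2,1)] is_hat_unique unfolding hat_def by blast+
qed

end

section \<open>Extension of scalars to \<open>complex fps\<close>\<close>

lemma matrix_inv_eqI:
  fixes A B :: "'k :: comm_ring_1 ^ 'n ^ 'n"
  assumes "A ** B = mat 1" "B ** A = mat 1"
  shows "matrix_inv A = B"
proof -
  have "A ** matrix_inv A = mat 1 \<and> matrix_inv A ** A = mat 1"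
    unfolding matrix_inv_def by (rule someI[of _ B]) (use assms in simp)
  then have "B = B ** (A ** matrix_inv A)" by simp
  also have "\<dots> = matrix_inv A" by (simp add: matrix_mul_assoc assms)
  finally show ?thesis ..
qed

lemma bilinear_form_complex:
  fixes g :: "complex ^ 'n ^ 'n :: finite"
  assumes "symmetric_nondegenerate g"
  shows "bilinear_form g"
proof
  have "g $ i $ j = g $ j $ i" for i j
    using assms[unfolded symmetric_nondegenerate_def, THEN conjunct1, rule_format, of "axis i 1" "axis j 1"]
    unfolding bil_eq axis_sum unfolding matrix_axis .
  then show "transpose g = g" by (simp add: transpose_def vec_eq_iff)
  have "u = 0" if "g *v u = 0" for u
  proof -
    have "bil g u v = 0" for v
      using assms[unfolded symmetric_nondegenerate_def, THEN conjunct1, rule_format, of u v]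
      by (simp add: bil_eq that)
    then show ?thesis using assms by (simp add: symmetric_nondegenerate_def)
  qed
  then obtain B where B: "B ** g = mat 1"
    using matrix_left_invertible_ker[of g] by blast
  then have B': "g ** B = mat 1" by (simp add: matrix_left_right_inverse)
  have "matrix_inv g = B" by (rule matrix_inv_eqI[OF B' B])
  then show "g ** matrix_inv g = mat 1" "matrix_inv g ** g = mat 1" using B B' by auto
qed

lemma map_matrix_nth [simp]: "map_matrix f A $ i $ j = f (A $ i $ j)"
  by (simp add: map_matrix_def)

abbreviation mconv :: "complex ^ 'n ^ 'm \<Rightarrow> complex fps ^ 'n ^ 'm" where
  "mconv \<equiv> map_matrix fps_const"

lemma fps_const_sum': "fps_const (\<Sum>i\<in>I. f i) = (\<Sum>i\<in>I. fps_const (f i :: complex))"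
  by (induction I rule: infinite_finite_induct) (simp_all flip: fps_const_add)

lemma mconv_mult: "mconv (A ** B) = mconv A ** mconv B"
  by (simp add: vec_eq_iff matrix_matrix_mult_def fps_const_sum' flip: fps_const_mult)

lemma mconv_1: "mconv (mat 1) = mat 1"
  by (simp add: vec_eq_iff mat_def)

lemma mconv_inverse:
  assumes "bilinear_form g"
  shows "matrix_inv (mconv g) = mconv (matrix_inv g)"
    "mconv g ** mconv (matrix_inv g) = mat 1" "mconv (matrix_inv g) ** mconv g = mat 1"
proof -
  show *: "mconv g ** mconv (matrix_inv g) = mat 1" "mconv (matrix_inv g) ** mconv g = mat 1"
    using bilinear_form.g_inv[OF assms] bilinear_form.g_inv'[OF assms]
    by (simp_all flip: mconv_mult add: mconv_1)
  then show "matrix_inv (mconv g) = mconv (matrix_inv g)" by (rule matrix_inv_eqI)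
qed

lemma bilinear_form_mconv:
  assumes "bilinear_form g"
  shows "bilinear_form (mconv g)"
proof
  show "transpose (mconv g) = mconv g"
    using bilinear_form.g_sym[OF assms] by (simp add: transpose_def vec_eq_iff)
qed (use mconv_inverse[OF assms] in simp_all)

abbreviation conv :: "('v, complex) mfps \<Rightarrow> ('v, complex fps) mfps" where
  "conv \<equiv> mmap fps_const"

lemma conv_uminus: "conv (- f) = - conv f" by (rule mfps_eqI) simp
lemma conv_mult: "conv (f * h) = conv f * conv h"
  by (rule mfps_eqI) (simp add: mcoeff_times fps_const_sum' flip: fps_const_mult)
lemma conv_sum: "conv (\<Sum>i\<in>I. f i) = (\<Sum>i\<in>I. conv (f i))"
  by (rule mfps_eqI) (simp add: fps_const_sum')
lemma conv_mconst: "conv (mconst c) = mconst (fps_const c)"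
  by (rule mfps_eqI) (simp add: mcoeff_mconst)
lemma conv_mderiv: "conv (mderiv x f) = mderiv x (conv f)"
  by (rule mfps_eqI) (simp add: mcoeff_mderiv fps_of_nat flip: fps_const_mult fps_const_add)
lemma conv_qvar: "conv (qvar e n \<alpha>) = qvar e n \<alpha>"
  by (rule mfps_eqI) (simp add: qvar_def mcoeff_mvar vec_dilaton)
lemma conv_q: "conv (q e x) = q e x"
  by (simp add: q_def conv_qvar)
lemma conv_trunc: "conv (trunc A f) = trunc A (conv f)"
  by (rule mfps_eqI) (simp add: mcoeff_trunc)

text \<open>The two sides are sums in different topologies. After truncation both are finite, and
  \<open>fps_const\<close> respects finite sums.\<close>

lemma conv_euler: "conv (euler e d F) = euler e d (conv F)"
proof (rule trunc_eqI[of 0])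
  fix N :: nat assume N: "N \<ge> 1"
  have "trunc (vars N) (conv (euler e d F)) = conv (trunc (vars N) (\<Sum>y\<in>vars N. q e (up d y) * mderiv y F))"
    by (simp only: conv_trunc[symmetric] trunc_euler[OF N])
  also have "\<dots> = trunc (vars N) (euler e d (conv F))"
    by (simp only: trunc_euler[OF N] conv_trunc conv_sum conv_mult conv_q conv_mderiv)
  finally show "trunc (vars N) (conv (euler e d F)) = trunc (vars N) (euler e d (conv F))" .
qed

lemma inverse_two_fps: "inverse 2 = fps_const (inverse 2 :: complex)"
  by (simp only: numeral_fps_const fps_const_inverse)

lemma GW0_conv:
  assumes g: "bilinear_form g" and F: "F \<in> GW0 g e"
  shows "conv F \<in> GW0 (mconv g) e"
proof -
  have "DE e (conv F)"
  proof -
    have "euler e 0 F = mconst 2 * F" using F by (simp add: GW0_def DE_def euler_def mconst_2)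
    then have "euler e 0 (conv F) = conv (mconst 2 * F)" by (simp add: conv_euler[symmetric])
    also have "\<dots> = mconst (fps_const 2) * conv F" by (simp only: conv_mult conv_mconst)
    also have "\<dots> = 2 * conv F" by (simp only: numeral_fps_const[symmetric] mconst_2)
    finally show ?thesis by (simp add: DE_def euler_def)
  qed
  moreover have "SE (mconv g) e (conv F)"
  proof -
    have "euler e 1 F = - (mconst (inverse 2) * bil (map_matrix mconst g) (qvec e 0) (qvec e 0))"
      using F by (simp add: GW0_def SE_def euler_def)
    then have "euler e 1 (conv F) = conv (- (mconst (inverse 2) * bil (map_matrix mconst g) (qvec e 0) (qvec e 0)))"
      by (simp add: conv_euler[symmetric])
    also have "\<dots> = - (mconst (inverse 2) * bil (map_matrix mconst (mconv g)) (qvec e 0) (qvec e 0))"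
      by (simp add: conv_uminus conv_mult conv_mconst inverse_two_fps bil_def conv_sum qvec_def conv_qvar)
    finally show ?thesis by (simp add: SE_def euler_def)
  qed
  moreover have "TRR (mconv g) (conv F)"
    unfolding TRR_def
  proof (intro allI)
    fix k l m :: nat and \<alpha> \<beta> \<gamma>
    have "conv (mderiv (k + 1, \<alpha>) (mderiv (l, \<beta>) (mderiv (m, \<gamma>) F))) =
      conv (\<Sum>\<mu>\<in>UNIV. \<Sum>\<nu>\<in>UNIV. mderiv (k, \<alpha>) (mderiv (0, \<mu>) F) * mconst (matrix_inv g $ \<mu> $ \<nu>) *
        mderiv (0, \<nu>) (mderiv (l, \<beta>) (mderiv (m, \<gamma>) F)))"
      using F unfolding GW0_def TRR_def by auto
    then show "mderiv (k + 1, \<alpha>) (mderiv (l, \<beta>) (mderiv (m, \<gamma>) (conv F))) =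
      (\<Sum>\<mu>\<in>UNIV. \<Sum>\<nu>\<in>UNIV. mderiv (k, \<alpha>) (mderiv (0, \<mu>) (conv F)) * mconst (matrix_inv (mconv g) $ \<mu> $ \<nu>) *
        mderiv (0, \<nu>) (mderiv (l, \<beta>) (mderiv (m, \<gamma>) (conv F))))"
      by (simp add: conv_mderiv conv_sum conv_mult conv_mconst mconv_inverse[OF g])
  qed
  ultimately show ?thesis by (simp add: GW0_def)
qed

section \<open>The one-parameter group \<open>exp(\<epsilon> a)\<close>\<close>

definition cf :: "nat \<Rightarrow> complex fps ^ 'n ^ 'm \<Rightarrow> complex ^ 'n ^ 'm" where
  "cf k = map_matrix (\<lambda>x. fps_nth x k)"

lemma cf_nth [simp]: "cf k A $ i $ j = fps_nth (A $ i $ j) k"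
  by (simp add: cf_def)

lemma cf_eqI: "(\<And>k. cf k A = cf k B) \<Longrightarrow> A = B"
  by (auto simp: vec_eq_iff fps_eq_iff)

lemma cf_0 [simp]: "cf k 0 = 0" by (simp add: vec_eq_iff)
lemma cf_mat_1: "cf k (mat 1) = (if k = 0 then mat 1 else 0)"
  by (simp add: vec_eq_iff mat_def)
lemma cf_sum: "cf k (\<Sum>i\<in>I. f i) = (\<Sum>i\<in>I. cf k (f i))"
  by (simp add: vec_eq_iff fps_sum_nth)
lemma cf_sg: "cf k (sg i A) = sg i (cf k A)"
  by (simp add: vec_eq_iff sg_def)
lemma cf_transpose: "cf k (transpose A) = transpose (cf k A)"
  by (simp add: vec_eq_iff transpose_def)
lemma cf_mconv_left: "cf k (mconv A ** B) = A ** cf k B"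
  by (simp add: vec_eq_iff matrix_matrix_mult_def fps_sum_nth)
lemma cf_mconv_right: "cf k (A ** mconv B) = cf k A ** B"
  by (simp add: vec_eq_iff matrix_matrix_mult_def fps_sum_nth)
lemma cf_mult: "cf k (A ** B) = (\<Sum>a\<le>k. cf a A ** cf (k - a) B)"
proof -
  have "cf k (A ** B) $ i $ j = (\<Sum>a\<le>k. cf a A ** cf (k - a) B) $ i $ j" for i j
  proof -
    have "cf k (A ** B) $ i $ j = (\<Sum>\<mu>\<in>UNIV. \<Sum>a\<le>k. fps_nth (A $ i $ \<mu>) a * fps_nth (B $ \<mu> $ j) (k - a))"
      by (simp add: matrix_matrix_mult_def fps_sum_nth fps_mult_nth atLeast0AtMost)
    also have "\<dots> = (\<Sum>a\<le>k. \<Sum>\<mu>\<in>UNIV. fps_nth (A $ i $ \<mu>) a * fps_nth (B $ \<mu> $ j) (k - a))"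
      by (rule sum.swap)
    finally show ?thesis by (simp add: matrix_matrix_mult_def)
  qed
  then show ?thesis by (simp add: vec_eq_iff)
qed

primrec mpow :: "complex ^ 'n ^ 'n \<Rightarrow> nat \<Rightarrow> complex ^ 'n ^ 'n" where
  "mpow s 0 = mat 1"
| "mpow s (Suc k) = s ** mpow s k"

lemma mpow_add: "mpow s (a + b) = mpow s a ** mpow s b"
  by (induction a) (simp_all add: matrix_mul_assoc)

text \<open>Here \<open>d\<close> is the exponent \<open>l\<close> of the statement, and
  \<open>star_s\<close> says that \<open>s z^-d\<close> lies in the Lie algebra.\<close>

locale eps_exp = bilinear_form g
  for g :: "complex ^ 'n ^ 'n :: finite" +
  fixes s :: "complex ^ 'n ^ 'n" and d :: nat and e :: 'n
  assumes d: "d > 0" and star_s: "star s = sg (d + 1) s"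
begin

definition a :: "('n, complex) zseries" where
  "a = (\<lambda>i. if i = d then s else 0)"

lemma spow_a: "spow a k n = (if n = k * d then mpow s k else 0)"
proof (induction k arbitrary: n)
  case (Suc k)
  have "spow a (Suc k) n = (\<Sum>i\<le>n. a i ** spow a k (n - i))" by (simp add: sprod_def)
  also have "\<dots> = (\<Sum>i\<le>n. if i = d then s ** spow a k (n - d) else 0)"
    by (rule sum.cong) (auto simp: a_def)
  also have "\<dots> = (if d \<le> n then s ** spow a k (n - d) else 0)"
    by simp
  finally show ?case using Suc by auto
qed (simp add: sone_def)

lemma cf_exp: "cf k (exp_eps a n) = (if n = k * d then (1 / fact k) *\<^sub>R mpow s k else 0)"
proof -
  have "(1 / fact k) *\<^sub>R z = z / fact k" for z :: complex
    by (simp add: scaleR_conv_of_real field_simps)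
  then show ?thesis by (simp add: vec_eq_iff exp_eps_def spow_a)
qed

lemma star_mpow: "star (mpow s k) = sg (k * (d + 1)) (mpow s k)"
proof (induction k)
  case (Suc k)
  have "mpow s k ** s = s ** mpow s k"
    using mpow_add[of s k 1] mpow_add[of s 1 k] by (simp add: add.commute)
  then show ?case using Suc
    by (simp add: star_mult star_s matrix_sg_left matrix_sg_right sg_sg add_ac)
qed simp

lemma cf_adj: "cf k (adj (mconv g) A) = star (cf k A)"
proof -
  interpret fg: bilinear_form "mconv g" using bilinear_form_mconv bilinear_form_axioms by blast
  have "adj (mconv g) A = mconv (matrix_inv g) ** transpose A ** mconv g"
    by (simp add: fg.adj_eq_star fg.star_def mconv_inverse[OF bilinear_form_axioms])
  then show ?thesis by (simp add: cf_mconv_left cf_mconv_right cf_transpose star_def)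
qed

lemma star_scaleR: "star (c *\<^sub>R A) = c *\<^sub>R star A"
  by (simp add: star_def transpose_scalar matrix_scalar_ac scalar_matrix_assoc[symmetric])

text \<open>Only exponents \<open>n = k * d\<close> occur; the sign \<open>(-1)^(k d)\<close> from
  \<open>z \<mapsto> -z\<close> and the sign \<open>(-1)^(k (d + 1))\<close> from the adjoint
  combine to \<open>(-1)^k\<close>, so this series is \<open>exp(- \<epsilon> a)\<close>.\<close>

lemma cf_R: "cf k (sflip (sadj (mconv g) (exp_eps a)) n) =
    (if n = k * d then (1 / fact k) *\<^sub>R sg k (mpow s k) else 0)"
proof -
  have "sg (k * d) (sg (k * (d + 1)) A) = sg k A" for A :: "complex ^ 'n ^ 'n"
    by (simp add: sg_def)
  moreover have "sg i (c *\<^sub>R A) = c *\<^sub>R sg i A" for i c and A :: "complex ^ 'n ^ 'n"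
    by (simp add: sg_def)
  ultimately show ?thesis
    by (simp add: sflip_def sadj_def map_matrix_sg cf_sg cf_adj cf_exp star_scaleR star_mpow)
qed

text \<open>The coefficient of \<open>x^k\<close> in \<open>exp(-x) exp(x)\<close>.\<close>

lemma alternating_sum: "k > 0 \<Longrightarrow> (\<Sum>a\<le>k. (- 1) ^ a * (1 / fact a * (1 / fact (k - a)))) = (0 :: real)"
proof -
  assume "k > 0"
  have "(- 1) ^ a * (1 / fact a * (1 / fact (k - a))) = ((- 1) ^ a * of_nat (k choose a)) / (fact k :: real)"
    if "a \<le> k" for a
    using binomial_fact[OF that, where 'a = real] by simp
  then have "(\<Sum>a\<le>k. (- 1) ^ a * (1 / fact a * (1 / fact (k - a)))) = (\<Sum>a\<le>k. (- 1) ^ a * of_nat (k choose a)) / (fact k :: real)"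
    by (simp add: sum_divide_distrib)
  then show ?thesis using choose_alternating_sum[OF \<open>k > 0\<close>, where 'a = real] by simp
qed

lemma exp_eps_Gminus: "exp_eps a \<in> Gminus (mconv g)"
proof -
  let ?R = "sflip (sadj (mconv g) (exp_eps a))"
  have "exp_eps a 0 = mat 1"
    by (rule cf_eqI) (use d in \<open>auto simp: cf_exp cf_mat_1\<close>)
  moreover have "sprod ?R (exp_eps a) = sone"
  proof
    fix n
    show "sprod ?R (exp_eps a) n = sone n"
    proof (rule cf_eqI)
      fix k
      have eq: "(\<Sum>i\<le>n. cf b (?R i) ** cf (k - b) (exp_eps a (n - i))) =
          (if n = k * d then ((- 1) ^ b * (1 / fact b * (1 / fact (k - b)))) *\<^sub>R mpow s k else 0)" if "b \<le> k" for b
      proof -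
        have "(\<Sum>i\<le>n. cf b (?R i) ** cf (k - b) (exp_eps a (n - i))) =
            (\<Sum>i\<le>n. if i = b * d then cf b (?R (b * d)) ** cf (k - b) (exp_eps a (n - b * d)) else 0)"
          by (rule sum.cong) (auto simp: cf_R)
        also have "\<dots> = (if b * d \<le> n then cf b (?R (b * d)) ** cf (k - b) (exp_eps a (n - b * d)) else 0)"
          by simp
        also have "\<dots> = (if n = k * d then ((1 / fact b) *\<^sub>R sg b (mpow s b)) ** ((1 / fact (k - b)) *\<^sub>R mpow s (k - b)) else 0)"
        proof -
          have "b * d \<le> k * d" using that by simp
          then have "b * d \<le> n \<and> n - b * d = (k - b) * d \<longleftrightarrow> n = k * d"
            unfolding diff_mult_distrib by linarith
          then show ?thesis by (auto simp: cf_R cf_exp)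
        qed
        also have "((1 / fact b) *\<^sub>R sg b (mpow s b)) ** ((1 / fact (k - b)) *\<^sub>R mpow s (k - b)) =
            ((- 1) ^ b * (1 / fact b * (1 / fact (k - b)))) *\<^sub>R (mpow s b ** mpow s (k - b))"
          by (simp add: scalar_matrix_assoc[symmetric] matrix_scalar_ac sg_def matrix_minus_left)
        also have "mpow s b ** mpow s (k - b) = mpow s k"
          using that by (simp add: mpow_add[symmetric])
        finally show ?thesis .
      qed
      have "cf k (sprod ?R (exp_eps a) n) = (\<Sum>i\<le>n. \<Sum>b\<le>k. cf b (?R i) ** cf (k - b) (exp_eps a (n - i)))"
        by (simp add: sprod_def cf_sum cf_mult)
      also have "\<dots> = (\<Sum>b\<le>k. \<Sum>i\<le>n. cf b (?R i) ** cf (k - b) (exp_eps a (n - i)))"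
        by (rule sum.swap)
      also have "\<dots> = (\<Sum>b\<le>k. if n = k * d then ((- 1) ^ b * (1 / fact b * (1 / fact (k - b)))) *\<^sub>R mpow s k else 0)"
        by (rule sum.cong) (auto simp: eq)
      also have "\<dots> = (if n = k * d then (\<Sum>b\<le>k. (- 1) ^ b * (1 / fact b * (1 / fact (k - b)))) *\<^sub>R mpow s k else 0)"
        by (simp add: scaleR_sum_left)
      also have "\<dots> = cf k (sone n)"
      proof (cases "k = 0")
        case True
        then show ?thesis by (simp add: sone_def cf_mat_1)
      next
        case False
        then have "(\<Sum>b\<le>k. (- 1) ^ b * (1 / fact b * (1 / fact (k - b)))) = (0 :: real)"
          by (intro alternating_sum) simp
        then show ?thesis using False by (auto simp: sone_def cf_mat_1)
      qed
      finally show "cf k (sprod ?R (exp_eps a) n) = cf k (sone n)" .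
    qed
  qed
  ultimately show ?thesis by (simp add: Gminus_def)
qed

section \<open>Convergence of the substitution in the \<open>\<epsilon>\<close>-adic
  topology\<close>

sublocale fg: bilinear_form "mconv g"
  using bilinear_form_mconv bilinear_form_axioms by blast

sublocale fs: symplectic_series "mconv g" "exp_eps a" e
  by unfold_locales (rule exp_eps_Gminus)

lemma cf_fsR: "cf k (fs.R n) = (if n = k * d then (1 / fact k) *\<^sub>R sg k (mpow s k) else 0)"
  using cf_R by (simp add: fs.R_eq)

lemma cf0_R: "cf 0 (fs.R n) = (if n = 0 then mat 1 else 0)"
  by (simp add: cf_fsR)

lemma cf1_R: "cf 1 (fs.R n) = (if n = d then - s else 0)"
  by (simp add: cf_fsR sg_def)

text \<open>Give \<open>\<epsilon>\<close> and every variable weight 1. Since \<open>R\<close> is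
  the identity modulo \<open>\<epsilon>\<close>, the constant terms of \<open>T\<close> are
  divisible by \<open>\<epsilon>\<close>, so \<open>T\<close> has no part of weight 0.\<close>

lemma mcoeff_T_weight:
  assumes "fps_nth (mcoeff (fs.T x) m) k \<noteq> 0"
  shows "size m + k \<ge> 1"
proof (rule ccontr)
  assume "\<not> size m + k \<ge> 1"
  then have "size m = 0" "k = 0" by linarith+
  then have "m = {#}" by simp
  have "fps_nth (fs.R n $ i $ j) 0 = (if n = 0 \<and> i = j then 1 else 0)" for n i j
    using arg_cong[OF cf0_R, of "\<lambda>A. A $ i $ j" n] by (simp add: mat_def split: if_splits)
  then have "fps_nth (fs.l x (1, e)) 0 = (if x = (1, e) then 1 else 0)"
    by (cases x) (auto simp: fs.l_def)
  then have "fps_nth (mcoeff (fs.T x) {#}) 0 = 0"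
    by (simp add: fs.T_def fs.mcoeff_L vec_dilaton)
  then show False using assms \<open>m = {#}\<close> \<open>k = 0\<close> by simp
qed

lemma mcoeff_pw_T_weight:
  "fps_nth (mcoeff (pw fs.T t) m) k \<noteq> 0 \<Longrightarrow> size m + k \<ge> size t"
proof (induction t arbitrary: m k)
  case (add x t)
  have "fps_nth (mcoeff (fs.T x * pw fs.T t) m) k =
      (\<Sum>p | fst p + snd p = m. \<Sum>i=0..k. fps_nth (mcoeff (fs.T x) (fst p)) i * fps_nth (mcoeff (pw fs.T t) (snd p)) (k - i))"
    by (simp add: mcoeff_times fps_sum_nth fps_mult_nth)
  then have "(\<Sum>p | fst p + snd p = m. \<Sum>i=0..k. fps_nth (mcoeff (fs.T x) (fst p)) i * fps_nth (mcoeff (pw fs.T t) (snd p)) (k - i)) \<noteq> 0"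
    using add.prems by simp
  then obtain p where "p \<in> {p. fst p + snd p = m}" "(\<Sum>i=0..k. fps_nth (mcoeff (fs.T x) (fst p)) i * fps_nth (mcoeff (pw fs.T t) (snd p)) (k - i)) \<noteq> 0"
    by (rule sum.not_neutral_contains_not_neutral)
  moreover from this(2) obtain i where "i \<in> {0..k}" "fps_nth (mcoeff (fs.T x) (fst p)) i * fps_nth (mcoeff (pw fs.T t) (snd p)) (k - i) \<noteq> 0"
    by (rule sum.not_neutral_contains_not_neutral)
  ultimately have p: "fst p + snd p = m" "i \<le> k"
    and nz: "fps_nth (mcoeff (fs.T x) (fst p)) i \<noteq> 0" "fps_nth (mcoeff (pw fs.T t) (snd p)) (k - i) \<noteq> 0"
    by auto
  have "size m = size (fst p) + size (snd p)" using p(1) by auto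
  then show ?case
    using mcoeff_T_weight[OF nz(1)] add.IH[OF nz(2)] p(2) by simp
qed simp

text \<open>A fixed coefficient in the variables and in \<open>\<epsilon>\<close> bounds the size of
  contributing multisets by weight and their variables by level, leaving finitely many.\<close>

lemma comp_ok_T: "comp_ok (conv F) fs.T"
  unfolding comp_ok_def summable_on_fps_iff
proof (intro allI)
  fix m :: "'n var multiset" and n
  obtain N where N: "N \<ge> 1" "set_mset m \<subseteq> vars N" using vars_exhaust by blast
  have "{t \<in> UNIV. fps_nth (mcoeff (conv F) t * mcoeff (pw fs.T t) m) n \<noteq> 0} \<subseteq>
      {t. set_mset t \<subseteq> vars N \<and> size t \<le> size m + n}"
  proof
    fix t assume "t \<in> {t \<in> UNIV. fps_nth (mcoeff (conv F) t * mcoeff (pw fs.T t) m) n \<noteq> 0}"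
    then have nz: "fps_nth (mcoeff (pw fs.T t) m) n \<noteq> 0" by auto
    then have "mcoeff (pw fs.T t) m \<noteq> 0" by auto
    then show "t \<in> {t. set_mset t \<subseteq> vars N \<and> size t \<le> size m + n}"
      using fs.pw_T_outside[OF N] mcoeff_pw_T_weight[OF nz] by auto
  qed
  then show "finite {t \<in> UNIV. fps_nth (mcoeff (conv F) t * mcoeff (pw fs.T t) m) n \<noteq> 0}"
    using finite_subset finite_multisets_bounded[OF finite_vars] by blast
qed

end

section \<open>The infinitesimal action\<close>

text \<open>Calculation modulo \<open>\<epsilon>^2\<close>: \<open>eps0\<close> is a ring
  homomorphism and \<open>eps1\<close> a derivation along it.\<close>

definition eps0 :: "('v, complex fps) mfps \<Rightarrow> ('v, complex) mfps" where
  "eps0 = mmap (\<lambda>c. fps_nth c 0)"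

definition eps1 :: "('v, complex fps) mfps \<Rightarrow> ('v, complex) mfps" where
  "eps1 = mmap (\<lambda>c. fps_nth c 1)"

lemma mcoeff_eps0 [simp]: "mcoeff (eps0 f) m = fps_nth (mcoeff f m) 0" by (simp add: eps0_def)
lemma mcoeff_eps1 [simp]: "mcoeff (eps1 f) m = fps_nth (mcoeff f m) 1" by (simp add: eps1_def)

lemma eps0_1: "eps0 1 = 1" by (rule mfps_eqI) (simp add: mcoeff_1)
lemma eps1_1: "eps1 1 = 0" by (rule mfps_eqI) (simp add: mcoeff_1)
lemma eps0_mult: "eps0 (f * h) = eps0 f * eps0 h"
  by (rule mfps_eqI) (simp add: mcoeff_times fps_sum_nth)
lemma eps1_mult: "eps1 (f * h) = eps1 f * eps0 h + eps0 f * eps1 h"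
  by (rule mfps_eqI) (simp add: mcoeff_times fps_sum_nth fps_mult_nth_1 sum.distrib add.commute)
lemma eps1_add: "eps1 (f + h) = eps1 f + eps1 h" by (rule mfps_eqI) simp
lemma eps1_sum: "eps1 (\<Sum>i\<in>I. f i) = (\<Sum>i\<in>I. eps1 (f i))"
  by (rule mfps_eqI) (simp add: fps_sum_nth)
lemma eps1_trunc: "eps1 (trunc A f) = trunc A (eps1 f)"
  by (rule mfps_eqI) (simp add: mcoeff_trunc)
lemma eps1_mconst_conv: "eps1 (mconst c * conv f) = mconst (fps_nth c 1) * f"
  by (rule mfps_eqI) simp

lemma has_sum_mult_pw_mvar:
  fixes f h :: "('v, 'k :: sum_ring) mfps"
  shows "((\<lambda>t. mcoeff f t * mcoeff (h * pw mvar t) m) has_sum mcoeff (h * f) m) UNIV"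
proof -
  let ?P = "{p. fst p + snd p = m}"
  have eq: "mcoeff (h * pw mvar t) m = (\<Sum>p\<in>?P. if snd p = t then mcoeff h (fst p) else 0)" for t
    unfolding mcoeff_times by (rule sum.cong) (auto simp: mcoeff_pw_mvar)
  have "((\<lambda>t. mcoeff f t * mcoeff (h * pw mvar t) m) has_sum
      (\<Sum>t\<in>snd ` ?P. mcoeff f t * mcoeff (h * pw mvar t) m)) UNIV"
  proof (rule has_sum_finite_neutralI)
    fix t assume "t \<in> UNIV - snd ` ?P"
    then have "snd p \<noteq> t" if "p \<in> ?P" for p using that by blast
    then have "mcoeff (h * pw mvar t) m = 0" unfolding eq by (intro sum.neutral) simp
    then show "mcoeff f t * mcoeff (h * pw mvar t) m = 0" by simp
  qed auto
  also have "(\<Sum>t\<in>snd ` ?P. mcoeff f t * mcoeff (h * pw mvar t) m) =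
      (\<Sum>t\<in>snd ` ?P. \<Sum>p\<in>?P. if snd p = t then mcoeff h (fst p) * mcoeff f t else 0)"
    unfolding eq by (simp add: sum_distrib_left if_distrib mult.commute cong: if_cong)
  also have "\<dots> = (\<Sum>p\<in>?P. \<Sum>t\<in>snd ` ?P. if snd p = t then mcoeff h (fst p) * mcoeff f t else 0)"
    by (rule sum.swap)
  also have "\<dots> = mcoeff (h * f) m"
    unfolding mcoeff_times by (intro sum.cong refl) (simp add: sum.delta)
  finally show ?thesis .
qed

context eps_exp
begin

text \<open>The coefficients of \<open>[a q]_+\<close> for \<open>a = s z^-d\<close>; up to sign
  this is the first-order variation of \<open>T\<close>.\<close>

definition shift :: "'n var \<Rightarrow> ('n, complex) fun_t" where
  "shift x = (\<Sum>\<beta>\<in>UNIV. mconst (s $ snd x $ \<beta>) * q e (fst x + d, \<beta>))"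

text \<open>Minus the coefficient of \<open>\<epsilon>\<close> in the quadratic form
  \<open>fs.w\<close>, see \<open>nth_w\<close>.\<close>

definition b :: "'n var \<Rightarrow> 'n var \<Rightarrow> complex" where
  "b x y = (if fst x + fst y + 1 = d then sg (fst y) ((transpose s ** g) $ snd x $ snd y) else 0)"

definition inf_act :: "('n, complex) fun_t \<Rightarrow> ('n, complex) fun_t" where
  "inf_act F =
     - msum (\<lambda>n. \<Sum>\<beta>\<in>UNIV. (map_matrix mconst s *v qvec e (d + n)) $ \<beta> * mderiv (n, \<beta>) F) UNIV
     - mconst (1 / 2) *
         (\<Sum>n = 0..d - 1. (- 1) ^ n *
            bil (map_matrix mconst g) (map_matrix mconst s *v qvec e (d - 1 - n)) (qvec e n))"

lemma shift_eq: "(map_matrix mconst s *v qvec e (d + n)) $ \<beta> = shift (n, \<beta>)"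
  by (simp add: shift_def matrix_vector_mult_def qvec_def q_def add.commute)

lemma shift_outside: "N \<ge> 1 \<Longrightarrow> fst x > N \<Longrightarrow> trunc (vars N) (shift x) = 0"
  by (simp add: shift_def trunc_sum trunc_mult q_outside)

lemma quad_inf_act:
  assumes "N \<ge> d"
  shows "(\<Sum>n = 0..d - 1. (- 1) ^ n *
      bil (map_matrix mconst g) (map_matrix mconst s *v qvec e (d - 1 - n)) (qvec e n)) =
    (\<Sum>x\<in>vars N. \<Sum>y\<in>vars N. mconst (b x y) * (q e x * q e y))"
proof -
  define c where "c k n = (- 1) ^ n *
      bil (map_matrix mconst g) (map_matrix mconst s *v qvec e k) (qvec e n :: ('n, complex) fun_t ^ 'n)" for k n
  have c: "(\<Sum>\<alpha>\<in>UNIV. \<Sum>\<beta>\<in>UNIV. mconst (b (k, \<alpha>) (n, \<beta>)) * (q e (k, \<alpha>) * q e (n, \<beta>))) =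
      (if k = d - 1 - n \<and> n \<le> d - 1 then c k n else 0)" for k n
  proof -
    have sg: "mconst (sg n z) = (- 1) ^ n * mconst z" for z :: complex
      by (simp add: sg_def mconst_uminus)
    show ?thesis
    proof (cases "k + n + 1 = d")
      case True
      then have "(if k = d - 1 - n \<and> n \<le> d - 1 then c k n else 0) = c k n" by auto
      then show ?thesis
        using True by (simp add: c_def bil_mconst b_def sg sum_distrib_left mult.assoc)
    next
      case False
      then have "\<not> (k = d - 1 - n \<and> n \<le> d - 1)" using d by auto
      then have "(if k = d - 1 - n \<and> n \<le> d - 1 then c k n else 0) = 0" by (rule if_not_P)
      then show ?thesis using False by (simp add: b_def)
    qed
  qed
  have "(\<Sum>x\<in>vars N. \<Sum>y\<in>vars N. mconst (b x y) * (q e x * q e y)) =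
      (\<Sum>k\<le>N. \<Sum>n\<le>N. \<Sum>\<alpha>\<in>UNIV. \<Sum>\<beta>\<in>UNIV. mconst (b (k, \<alpha>) (n, \<beta>)) * (q e (k, \<alpha>) * q e (n, \<beta>)))"
    unfolding sum_vars by (rule sum.cong[OF refl], rule sum.swap)
  also have "\<dots> = (\<Sum>n\<le>N. \<Sum>k\<le>N. if k = d - 1 - n \<and> n \<le> d - 1 then c k n else 0)"
    unfolding c by (rule sum.swap)
  also have "\<dots> = (\<Sum>n\<le>N. if n \<le> d - 1 then c (d - 1 - n) n else 0)"
  proof (rule sum.cong[OF refl])
    fix n
    have "(\<Sum>k\<le>N. if k = d - 1 - n \<and> n \<le> d - 1 then c k n else 0) =
        (\<Sum>k\<le>N. if k = d - 1 - n then (if n \<le> d - 1 then c k n else 0) else 0)"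
      by (rule sum.cong) auto
    then show "(\<Sum>k\<le>N. if k = d - 1 - n \<and> n \<le> d - 1 then c k n else 0) = (if n \<le> d - 1 then c (d - 1 - n) n else 0)"
      using assms by simp
  qed
  also have "\<dots> = (\<Sum>n = 0..d - 1. c (d - 1 - n) n)"
    by (rule sum.mono_neutral_cong_right) (use assms in auto)
  finally show ?thesis by (simp add: c_def)
qed

lemma trunc_inf_act:
  assumes N: "N \<ge> 1" "N \<ge> d"
  shows "trunc (vars N) (inf_act F) = trunc (vars N) (- (\<Sum>x\<in>vars N. shift x * mderiv x F)
    - mconst (1 / 2) * (\<Sum>x\<in>vars N. \<Sum>y\<in>vars N. mconst (b x y) * (q e x * q e y)))"
proof -
  let ?f = "\<lambda>n. \<Sum>\<beta>\<in>UNIV. (map_matrix mconst s *v qvec e (d + n)) $ \<beta> * mderiv (n, \<beta>) F"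
  have "trunc (vars N) (msum ?f UNIV) = trunc (vars N) (\<Sum>x\<in>vars N. shift x * mderiv x F)"
  proof (rule trunc_cong)
    fix m :: "'n var multiset" assume m: "set_mset m \<subseteq> vars N"
    have "mcoeff (msum ?f UNIV) m = (\<Sum>n\<le>N. mcoeff (?f n) m)"
    proof (rule mcoeff_msum_finite)
      fix n assume "n \<in> UNIV - {..N}"
      then have "trunc (vars N) (?f n) = 0"
        by (simp add: trunc_sum trunc_mult shift_eq shift_outside[OF N(1)])
      then show "mcoeff (?f n) m = 0" using m by (rule trunc_0D)
    qed auto
    then show "mcoeff (msum ?f UNIV) m = mcoeff (\<Sum>x\<in>vars N. shift x * mderiv x F) m"
      by (simp add: sum_vars shift_eq)
  qed
  then show ?thesis
    unfolding inf_act_def trunc_diff trunc_uminus quad_inf_act[OF N(2)] by simp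
qed

lemma nth_R: "fps_nth (fs.R n $ i $ j) 0 = (if n = 0 \<and> i = j then 1 else 0)"
  "fps_nth (fs.R n $ i $ j) 1 = (if n = d then - s $ i $ j else 0)"
  using arg_cong[OF cf0_R, of "\<lambda>A. A $ i $ j" n] arg_cong[OF cf1_R, of "\<lambda>A. A $ i $ j" n]
  by (simp_all add: mat_def split: if_splits)

lemma nth_l: "fps_nth (fs.l x y) 0 = (if x = y then 1 else 0)"
  "fps_nth (fs.l x y) 1 = (if fst y = fst x + d then - s $ snd x $ snd y else 0)"
  using nth_R[of "fst y - fst x" "snd x" "snd y"] by (auto simp: fs.l_def prod_eq_iff)

lemma eps0_T: "eps0 (fs.T x) = mvar x"
proof (rule mfps_eqI)
  fix m :: "'n var multiset"
  show "mcoeff (eps0 (fs.T x)) m = mcoeff (mvar x) m"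
    by (cases m rule: multiset_cases_small) (auto simp: fs.T_def fs.mcoeff_L nth_l vec_dilaton mcoeff_mvar)
qed

lemma eps1_T: "eps1 (fs.T x) = - shift x"
proof (rule mfps_eqI)
  fix m :: "'n var multiset"
  show "mcoeff (eps1 (fs.T x)) m = mcoeff (- shift x) m"
  proof (cases m rule: multiset_cases_small)
    case 1
    have "(\<Sum>\<beta>\<in>UNIV. s $ snd x $ \<beta> * mcoeff (q e (fst x + d, \<beta>)) {#}) =
        (\<Sum>\<beta>\<in>UNIV. if \<beta> = e then (if fst x + d = 1 then - s $ snd x $ \<beta> else 0) else 0)"
      by (rule sum.cong) (auto simp: mcoeff_q)
    then show ?thesis using 1 nth_l(2)[of x "(1, e)"]
      by (auto simp: fs.T_def fs.mcoeff_L vec_dilaton shift_def)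
  next
    case (2 y)
    have "(\<Sum>\<beta>\<in>UNIV. s $ snd x $ \<beta> * mcoeff (q e (fst x + d, \<beta>)) {#y#}) =
        (\<Sum>\<beta>\<in>UNIV. if \<beta> = snd y then (if fst y = fst x + d then s $ snd x $ \<beta> else 0) else 0)"
      by (rule sum.cong) (auto simp: mcoeff_q prod_eq_iff)
    then show ?thesis using 2 nth_l(2)[of x y]
      by (auto simp: fs.T_def fs.mcoeff_L vec_dilaton shift_def)
  next
    case 3
    have "mcoeff (q e y :: ('n, complex) fun_t) m = 0" for y using 3 by (auto simp: mcoeff_q)
    then show ?thesis using 3 by (simp add: fs.T_def fs.mcoeff_L vec_dilaton shift_def)
  qed
qed

text \<open>The index set \<open>vars N\<close> does not depend on \<open>t\<close>, so that the
  infinite sum over \<open>t\<close> can afterwards be taken for each \<open>x\<close>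
  separately.\<close>

lemma mcoeff_eps1_pw:
  assumes N: "N \<ge> 1" "set_mset m \<subseteq> vars N"
  shows "fps_nth (mcoeff (pw fs.T t) m) 1 =
    (\<Sum>x\<in>vars N. of_nat (count t x) * mcoeff (- shift x * pw mvar (t - {#x#})) m)"
proof -
  let ?X = "vars N \<union> set_mset t"
  have "eps1 (pw fs.T t) = (\<Sum>x\<in>?X. of_nat (count t x) * (eps1 (fs.T x) * (\<Prod>y\<in>#t - {#x#}. eps0 (fs.T y))))"
    by (rule derivation_prod_mset) (simp_all add: eps0_1 eps1_1 eps0_mult eps1_mult)
  then have "fps_nth (mcoeff (pw fs.T t) m) 1 =
      mcoeff (\<Sum>x\<in>?X. of_nat (count t x) * (- shift x * pw mvar (t - {#x#}))) m"
    unfolding eps0_T eps1_T using mcoeff_eps1 by metis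
  also have "\<dots> = (\<Sum>x\<in>?X. of_nat (count t x) * mcoeff (- shift x * pw mvar (t - {#x#})) m)"
    by simp
  also have "\<dots> = (\<Sum>x\<in>vars N. of_nat (count t x) * mcoeff (- shift x * pw mvar (t - {#x#})) m)"
  proof (rule sum.mono_neutral_right)
    show "\<forall>x\<in>?X - vars N. of_nat (count t x) * mcoeff (- shift x * pw mvar (t - {#x#})) m = 0"
    proof
      fix x assume "x \<in> ?X - vars N"
      then have "trunc (vars N) (- shift x * pw mvar (t - {#x#})) = 0"
        using shift_outside[OF N(1), of x] by (simp add: trunc_mult trunc_uminus not_le)
      then have "mcoeff (- shift x * pw mvar (t - {#x#})) m = 0" using N(2) by (rule trunc_0D)
      then show "of_nat (count t x) * mcoeff (- shift x * pw mvar (t - {#x#})) m = 0" by simp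
    qed
  qed auto
  finally show ?thesis .
qed

text \<open>Modulo \<open>\<epsilon>^2\<close> the substitution is
  \<open>t_x \<mapsto> t_x - \<epsilon> shift x\<close>, so the first-order term is the derivative
  of \<open>F\<close> along \<open>- shift\<close>. It is extracted monomial by monomial from the
  convergent sum.\<close>

lemma eps1_mcomp:
  assumes N: "N \<ge> 1"
  shows "trunc (vars N) (eps1 (mcomp (conv F) fs.T)) =
    trunc (vars N) (- (\<Sum>x\<in>vars N. shift x * mderiv x F))"
proof (rule trunc_cong)
  fix m :: "'n var multiset" assume m: "set_mset m \<subseteq> vars N"
    have "((\<lambda>t. mcoeff (conv F) t * mcoeff (pw fs.T t) m) has_sum mcoeff (mcomp (conv F) fs.T) m) UNIV"
      using has_comp_mcomp[OF comp_ok_T[of F]] unfolding has_comp_def by blast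
    then have "((\<lambda>t. fps_nth (mcoeff (conv F) t * mcoeff (pw fs.T t) m) 1) has_sum
        fps_nth (mcoeff (mcomp (conv F) fs.T) m) 1) UNIV"
      by (rule has_sum_fps_nth)
    also have "(\<lambda>t. fps_nth (mcoeff (conv F) t * mcoeff (pw fs.T t) m) 1) =
        (\<lambda>t. \<Sum>x\<in>vars N. of_nat (count t x) * mcoeff F t * mcoeff (- shift x * pw mvar (t - {#x#})) m)"
      by (simp add: mcoeff_eps1_pw[OF N m, unfolded One_nat_def] sum_distrib_left mult_ac)
    finally have 1: "((\<lambda>t. \<Sum>x\<in>vars N. of_nat (count t x) * mcoeff F t * mcoeff (- shift x * pw mvar (t - {#x#})) m)
        has_sum fps_nth (mcoeff (mcomp (conv F) fs.T) m) 1) UNIV" .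
    have 2: "((\<lambda>t. \<Sum>x\<in>vars N. of_nat (count t x) * mcoeff F t * mcoeff (- shift x * pw mvar (t - {#x#})) m)
        has_sum (\<Sum>x\<in>vars N. mcoeff (- shift x * mderiv x F) m)) UNIV"
    proof (rule has_sum_sum)
      fix x :: "'n var"
      show "((\<lambda>t. of_nat (count t x) * mcoeff F t * mcoeff (- shift x * pw mvar (t - {#x#})) m)
        has_sum mcoeff (- shift x * mderiv x F) m) UNIV"
        unfolding has_sum_mderiv_reindex[where a = "\<lambda>t. mcoeff (- shift x * pw mvar t) m"]
        by (rule has_sum_mult_pw_mvar)
    qed
  show "mcoeff (eps1 (mcomp (conv F) fs.T)) m = mcoeff (- (\<Sum>x\<in>vars N. shift x * mderiv x F)) m"
    using has_sum_unique[OF 1 2] by (simp add: sum_negf)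
qed

text \<open>The factor \<open>R (k + 1 + j)\<close> has positive index and so starts in order
  \<open>\<epsilon>\<close>. The other factor must then be of order 0, which leaves only
  \<open>j = n\<close>.\<close>

lemma cf1_W: "cf 1 (fs.W k n) = (if k + n + 1 = d then sg n (- s) else 0)"
proof -
  have star_cf: "cf j (fg.star A) = star (cf j A)" for j A
    using cf_adj by (simp add: fg.adj_eq_star)
  have "cf 1 (fg.star (fs.R (n - j)) ** fs.R (k + 1 + j)) =
      (if j = n then (if k + n + 1 = d then - s else 0) else 0)" if "j \<le> n" for j
  proof -
    have "{..1 :: nat} = {0, 1}" by auto
    then have "cf 1 (fg.star (fs.R (n - j)) ** fs.R (k + 1 + j)) =
        star (cf 0 (fs.R (n - j))) ** cf 1 (fs.R (k + 1 + j))"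
      unfolding cf_mult star_cf using cf0_R[of "k + 1 + j"] by simp
    then show ?thesis using that
      unfolding cf0_R cf1_R by auto
  qed
  then have "cf 1 (fs.W k n) = (\<Sum>j\<le>n. sg j (if j = n then (if k + n + 1 = d then - s else 0) else 0))"
    unfolding fs.W_def cf_sum cf_sg by (intro sum.cong refl) simp
  also have "\<dots> = (\<Sum>j\<le>n. if j = n then sg n (if k + n + 1 = d then - s else 0) else 0)"
    by (rule sum.cong) auto
  finally show ?thesis by simp
qed

lemma nth_w: "fps_nth (fs.w x y) 1 = - b x y"
proof -
  have "fps_nth (fs.w x y) 1 = cf 1 (transpose (fs.W (fst x) (fst y)) ** mconv g) $ snd x $ snd y"
    by (simp add: fs.w_def)
  also have "\<dots> = (transpose (cf 1 (fs.W (fst x) (fst y))) ** g) $ snd x $ snd y"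
    by (simp only: cf_mconv_right cf_transpose)
  finally show ?thesis
    unfolding cf1_W by (simp add: b_def sg_def transpose_minus matrix_minus_left)
qed

lemma eps1_half_quad:
  assumes N: "N \<ge> 1"
  shows "trunc (vars N) (eps1 fs.half_quad) =
    - (mconst (1 / 2) * (\<Sum>x\<in>vars N. \<Sum>y\<in>vars N. mconst (b x y) * (q e x * q e y)))"
proof -
  have "trunc (vars N) fs.half_quad =
      (\<Sum>x\<in>vars N. \<Sum>y\<in>vars N. mconst (fps_const (1 / 2) * fs.w x y) * conv (q e x * q e y))"
    by (simp add: fs.half_quad_def trunc_mult fs.trunc_quad[OF N] sum_distrib_left mconst_mult
        conv_mult conv_q inverse_two_fps mult.assoc)
  then have "trunc (vars N) (eps1 fs.half_quad) =
      (\<Sum>x\<in>vars N. \<Sum>y\<in>vars N. mconst (fps_nth (fps_const (1 / 2) * fs.w x y) 1) * (q e x * q e y))"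
    unfolding eps1_trunc[symmetric] by (simp only: eps1_sum eps1_mconst_conv)
  also have "\<dots> = (\<Sum>x\<in>vars N. \<Sum>y\<in>vars N. - (mconst (1 / 2) * (mconst (b x y) * (q e x * q e y))))"
    unfolding fps_mult_left_const_nth nth_w mult_minus_right mconst_uminus mconst_mult
    by (simp add: mult.assoc)
  finally show ?thesis by (simp add: sum_negf sum_distrib_left)
qed

lemma eps1_transform: "eps1 (fs.transform (conv F)) = inf_act F"
proof (rule trunc_eqI[of d])
  fix N :: nat assume N: "N \<ge> 1" "d \<le> N"
  have "trunc (vars N) (- (mconst (1 / 2) * (\<Sum>x\<in>vars N. \<Sum>y\<in>vars N. mconst (b x y) * (q e x * q e y)))) =
      - (mconst (1 / 2) * (\<Sum>x\<in>vars N. \<Sum>y\<in>vars N. mconst (b x y) * (q e x * q e y)))"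
    using eps1_half_quad[OF N(1)] trunc_trunc by metis
  then show "trunc (vars N) (eps1 (fs.transform (conv F))) = trunc (vars N) (inf_act F)"
    unfolding fs.transform_def eps1_add trunc_add trunc_inf_act[OF N] eps1_half_quad[OF N(1)] eps1_mcomp[OF N(1)]
    by (simp add: trunc_diff trunc_uminus)
qed

lemma hat_exp_unique_existence:
  assumes "F \<in> GW0 g e"
  shows "\<exists>!G. hat_exp g e a F G" and "inf_action g e a F = inf_act F"
proof -
  note F = GW0_conv[OF bilinear_form_axioms assms]
  show "\<exists>!G. hat_exp g e a F G"
    unfolding hat_exp_def by (rule fs.hat_formula[OF F comp_ok_T])
  have "inf_action g e a F = eps1 (hat (mconv g) e (exp_eps a) (conv F))"
    by (simp add: inf_action_def eps1_def)
  then show "inf_action g e a F = inf_act F"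
    by (simp only: fs.hat_formula(2)[OF F comp_ok_T] eps1_transform)
qed

end

section \<open>Quantized Hamiltonians\<close>

lemma minus_one_powi: "(- 1 :: complex) powi n = (if even n then 1 else - 1)"
  by (cases n rule: int_cases2) (auto simp: power_int_minus)

text \<open>Both kinds of Darboux vectors are single monomials \<open>dvec z^deg\<close>; this
  treats \<open>P\<close> and \<open>Q\<close> uniformly.\<close>

fun deg :: "'n darboux \<Rightarrow> int" where
  "deg (P i \<alpha>) = - int i - 1"
| "deg (Q i \<alpha>) = int i"

fun dvec :: "complex ^ 'n ^ 'n \<Rightarrow> 'n :: finite darboux \<Rightarrow> complex ^ 'n" where
  "dvec g (P i \<alpha>) = (- 1) ^ (i + 1) *s dual_basis g \<alpha>"
| "dvec g (Q i \<alpha>) = axis \<alpha> 1"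

lemma darboux_vec_eq: "darboux_vec g I = (\<lambda>k. if k = deg I then dvec g I else 0)"
  by (cases I) auto

lemma bil_add_left: "bil g (u + v) x = bil g u x + bil g v x"
  by (simp add: bil_def algebra_simps sum.distrib)
lemma bil_add_right: "bil g x (u + v) = bil g x u + bil g x v"
  by (simp add: bil_def algebra_simps sum.distrib)
lemma bil_0_left [simp]: "bil g 0 x = 0" by (simp add: bil_def)
lemma bil_0_right [simp]: "bil g x 0 = 0" by (simp add: bil_def)
lemma bil_scale_right: "bil g x (c *s u) = c * bil g x u"
  by (simp add: bil_def sum_distrib_left mult_ac)

definition hcoeff :: "('v, complex fls) mfps \<Rightarrow> ('v, complex) mfps" where
  "hcoeff = mmap (\<lambda>c. fls_nth c (- 1))"

lemma mcoeff_hcoeff [simp]: "mcoeff (hcoeff f) m = fls_nth (mcoeff f m) (- 1)"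
  by (simp add: hcoeff_def)

lemma hcoeff_mconst_mult: "hcoeff (mconst (fls_const c) * f) = mconst c * hcoeff f"
  by (rule mfps_eqI) simp

lemma hcoeff_mderiv: "hcoeff (mderiv x f) = mderiv x (hcoeff f)"
proof (rule mfps_eqI)
  fix m
  have "fls_nth (of_nat (Suc n) * c) k = of_nat (Suc n) * fls_nth c k" for n c and k :: int
    by (rule fls_mult_of_nat_nth)
  then show "mcoeff (hcoeff (mderiv x f)) m = mcoeff (mderiv x (hcoeff f)) m"
    by (simp only: mcoeff_hcoeff mcoeff_mderiv)
qed

lemma hcoeff_conv_mult: "hcoeff (mmap fls_const f * h) = f * hcoeff h"
  by (rule mfps_eqI) (simp add: mcoeff_times fls_nth_sum)

lemma conv_q_fls: "mmap fls_const (q e x) = q e x"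
  by (rule mfps_eqI) (simp add: mcoeff_q)

lemma hcoeff_q_mult: "hcoeff (q e x * h) = q e x * hcoeff h"
  using hcoeff_conv_mult[of "q e x" h] by (simp add: conv_q_fls)

lemma hcoeff_total_potential: "hcoeff (total_potential Fg) = Fg 0"
  by (rule mfps_eqI) (simp add: total_potential_def)

lemma hcoeff_inverse_X: "hcoeff (mconst (inverse fls_X)) = 1"
  by (rule mfps_eqI) (auto simp: mcoeff_mconst mcoeff_1 fls_inverse_X)

context eps_exp
begin

lemma lact_a: "f \<in> loop_space \<Longrightarrow> lact a f j = s *v f (j + int d)"
proof -
  assume "f \<in> loop_space"
  then obtain K where K: "\<And>j. j > K \<Longrightarrow> f j = 0" by (auto simp: loop_space_def)
  have "lact a f j = (\<Sum>i\<le>max d (nat (K - j)). a i *v f (j + int i))"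
    by (rule lact_eq[OF K]) auto
  also have "\<dots> = (\<Sum>i\<le>max d (nat (K - j)). if i = d then s *v f (j + int d) else 0)"
    by (rule sum.cong) (auto simp: a_def)
  finally show ?thesis by simp
qed

lemma Hamiltonian_a:
  assumes "f \<in> loop_space" "finite X" "\<And>i. f (i + int d) \<noteq> 0 \<Longrightarrow> i \<in> X"
  shows "Hamiltonian g a f = 1 / 2 * (\<Sum>i\<in>X. (- 1) powi i * bil g (s *v f (i + int d)) (f (- 1 - i)))"
proof -
  have "Omega g (lact a f) f = (\<Sum>i\<in>X. (- 1) powi i * bil g (s *v f (i + int d)) (f (- 1 - i)))"
    unfolding Omega_def lact_a[OF assms(1)]
  proof (rule sum.mono_neutral_left)
    show "{i. s *v f (i + int d) \<noteq> 0 \<and> f (- 1 - i) \<noteq> 0} \<subseteq> X" using assms(3) by force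
  qed (use assms(2) in auto)
  then show ?thesis by (simp add: Hamiltonian_def)
qed

text \<open>The Lie algebra condition on \<open>s\<close>, in the form that makes the polarized
  Hamiltonian symmetric.\<close>

lemma bil_s_sym: "bil g (s *v v) u = (- 1) ^ (d + 1) * bil g (s *v u) v"
proof -
  have sym: "bil g x y = bil g y x" for x y
  proof -
    have "g $ i $ j = g $ j $ i" for i j
      using arg_cong[OF g_sym, of "\<lambda>A. A $ i $ j"] by (simp add: transpose_def)
    then show ?thesis unfolding bil_def by (subst sum.swap) (simp add: mult_ac)
  qed
  have "bil g (s *v v) u = bil g v (star s *v u)"
    by (simp add: bil_left bil_right g_star)
  also have "\<dots> = bil g (star s *v u) v" by (rule sym)
  also have "star s *v u = (- 1) ^ (d + 1) *s (s *v u)"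
    unfolding star_s matrix_vector_sg_left by (simp add: sg_def)
  also have "bil g ((- 1) ^ (d + 1) *s (s *v u)) v = (- 1) ^ (d + 1) * bil g (s *v u) v"
    by (subst (1 2) sym) (rule bil_scale_right)
  finally show ?thesis .
qed

text \<open>Polarization leaves the two cross terms \<open>B ?f ?h\<close> and
  \<open>B ?h ?f\<close> with factor 1/4. They are equal because \<open>a\<close> is infinitesimally
  symplectic, which gives the factor 1/2.\<close>

lemma quad_coeff_a:
  "quad_coeff g (Hamiltonian g a) I J =
    (if deg I + deg J = int d - 1
     then 1 / 2 * (- 1) powi (deg I - int d) * bil g (s *v dvec g I) (dvec g J) else 0)"
proof -
  let ?f = "darboux_vec g I" and ?h = "darboux_vec g J"
  let ?X = "{deg I - int d, deg J - int d}"
  define B where "B u v = (\<Sum>i\<in>?X. (- 1) powi i * bil g (s *v u (i + int d)) (v (- 1 - i)))" for u v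
  have loop: "(\<lambda>k. ?f k + ?h k) \<in> loop_space" "?f \<in> loop_space" "?h \<in> loop_space"
    unfolding darboux_vec_eq loop_space_def mem_Collect_eq
    by (rule exI[of _ "max (deg I) (deg J)"], simp)+
  have Ham: "Hamiltonian g a (\<lambda>k. ?f k + ?h k) = 1 / 2 * B (\<lambda>k. ?f k + ?h k) (\<lambda>k. ?f k + ?h k)"
    "Hamiltonian g a ?f = 1 / 2 * B ?f ?f" "Hamiltonian g a ?h = 1 / 2 * B ?h ?h"
    unfolding B_def by (rule Hamiltonian_a; use loop in \<open>auto simp: darboux_vec_eq split: if_splits\<close>)+
  have "B (\<lambda>k. ?f k + ?h k) (\<lambda>k. ?f k + ?h k) = B ?f ?f + B ?f ?h + B ?h ?f + B ?h ?h"
    unfolding B_def by (simp only: matrix_vector_right_distrib bil_add_left bil_add_right distrib_left sum.distrib add_ac)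
  then have 1: "quad_coeff g (Hamiltonian g a) I J = 1 / 4 * (B ?f ?h + B ?h ?f)"
    unfolding quad_coeff_def Ham by (simp add: field_simps)
  have single: "B (darboux_vec g I') (darboux_vec g J') =
      (if deg I' + deg J' = int d - 1 then (- 1) powi (deg I' - int d) * bil g (s *v dvec g I') (dvec g J') else 0)"
    if "deg I' - int d \<in> ?X" for I' J'
  proof -
    have "B (darboux_vec g I') (darboux_vec g J') = (\<Sum>i\<in>?X. if i = deg I' - int d then
        (if deg I' + deg J' = int d - 1 then (- 1) powi (deg I' - int d) * bil g (s *v dvec g I') (dvec g J') else 0) else 0)"
      unfolding B_def darboux_vec_eq by (rule sum.cong) auto
    then show ?thesis using that by (simp only: sum.delta finite.emptyI finite.insertI if_True)
  qed
  have "B ?h ?f = B ?f ?h"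
  proof (cases "deg I + deg J = int d - 1")
    case True
    \<comment> \<open>In this case \<open>deg J - d\<close> equals \<open>- 1 - deg I\<close>, so
      the change of exponent compensates the sign from exchanging the arguments of the form.\<close>
    have "(- 1) powi (deg J - int d) * (- 1) ^ (d + 1) = ((- 1) powi (deg I - int d) :: complex)"
    proof -
      have "even (deg J - int d) \<longleftrightarrow> even (deg I + 1)"
        using True by presburger
      moreover have "even (deg I - int d) \<longleftrightarrow> (even (deg I) \<longleftrightarrow> even d)" by simp
      ultimately show ?thesis by (auto simp: minus_one_powi)
    qed
    note sign = this
    have "B ?h ?f = (- 1) powi (deg J - int d) * bil g (s *v dvec g J) (dvec g I)"
      using True by (simp add: single add.commute)
    also have "\<dots> = (- 1) powi (deg J - int d) * (- 1) ^ (d + 1) * bil g (s *v dvec g I) (dvec g J)"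
      unfolding bil_s_sym[of "dvec g J" "dvec g I"] by (simp only: mult.assoc)
    also have "\<dots> = B ?f ?h"
      unfolding sign using True by (simp add: single)
    finally show ?thesis .
  qed (simp add: single add.commute)
  then show ?thesis unfolding 1 by (simp add: single)
qed

lemma quad_coeff_sym: "quad_coeff g h I J = quad_coeff g h J I"
  by (simp add: quad_coeff_def add.commute)

text \<open>Two negative degrees cannot add up to \<open>d - 1\<close>, so no second derivatives
  occur in the quantization.\<close>

lemma quad_coeff_PP: "quad_coeff g (Hamiltonian g a) (P i \<alpha>) (P j \<beta>) = 0"
  by (simp add: quad_coeff_a)

text \<open>The factor 1/2 appears because the orders \<open>Q P\<close> and \<open>P Q\<close>
  share the coefficient. The sign \<open>(-1)^i\<close> of the residue and
  \<open>(-1)^(i + 1)\<close> of the Darboux vector multiply to -1.\<close>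

lemma quad_coeff_QP:
  "quad_coeff g (Hamiltonian g a) (Q j \<beta>) (P i \<alpha>) = (if j = i + d then - (1 / 2) * s $ \<alpha> $ \<beta> else 0)"
proof (cases "j = i + d")
  case True
  have dual: "bil g v (dual_basis g \<alpha>) = v $ \<alpha>" for v
  proof -
    have "dual_basis g \<alpha> = matrix_inv g *v axis \<alpha> 1"
      using dual_basis_sum[of "axis \<alpha> 1"] by (simp add: axis_def if_distrib if_distribR vec_eq_iff cong: if_cong)
    then have "g *v dual_basis g \<alpha> = axis \<alpha> 1"
      by (simp add: matrix_vector_mul_assoc g_inv)
    then show ?thesis by (simp add: bil_eq axis_def if_distrib cong: if_cong)
  qed
  have val: "bil g (s *v axis \<beta> 1) (dvec g (P i \<alpha>)) = (- 1) ^ (i + 1) * s $ \<alpha> $ \<beta>"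
    by (simp only: dvec.simps bil_scale_right dual matrix_axis)
  show ?thesis
    unfolding quad_coeff_a dvec.simps(2) val using True by (simp add: minus_one_powi)
qed (simp add: quad_coeff_a)

lemma quad_coeff_QQ:
  "quad_coeff g (Hamiltonian g a) (Q i \<alpha>) (Q j \<beta>) = - (1 / 2) * b (i, \<alpha>) (j, \<beta>)"
proof (cases "i + j + 1 = d")
  case True
  have "bil g (s *v axis \<alpha> 1) (axis \<beta> 1) = (transpose s ** g) $ \<alpha> $ \<beta>"
    unfolding bil_left axis_sum by (rule matrix_axis)
  moreover have "(- 1) powi (int i - int d) = (if even j then - 1 else 1 :: complex)"
    using True by (auto simp: minus_one_powi)
  moreover have "int i + int j = int d - 1" using True by simp
  ultimately show ?thesis
    using True by (simp add: quad_coeff_a b_def sg_def)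
next
  case False
  then have "int i + int j \<noteq> int d - 1" by linarith
  then show ?thesis using False by (simp add: quad_coeff_a b_def)
qed

lemma trunc_shift:
  assumes N: "N \<ge> 1"
  shows "trunc (vars N) (shift x) =
    (\<Sum>y\<in>vars N. mconst (if fst y = fst x + d then s $ snd x $ snd y else 0) * q e y)"
proof -
  have "(\<Sum>y\<in>vars N. mconst (if fst y = fst x + d then s $ snd x $ snd y else 0) * q e y) =
      (\<Sum>k\<le>N. if k = fst x + d then \<Sum>\<beta>\<in>UNIV. mconst (s $ snd x $ \<beta>) * q e (k, \<beta>) else 0)"
    unfolding sum_vars by (rule sum.cong) auto
  also have "\<dots> = trunc (vars N) (shift x)"
    by (cases "fst x + d \<le> N") (simp_all add: shift_def trunc_sum trunc_mult q_inside q_outside[OF N])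
  finally show ?thesis ..
qed

definition quant_term :: "('n, complex fls) fun_t \<Rightarrow> 'n darboux \<Rightarrow> 'n darboux \<Rightarrow> ('n, complex fls) fun_t" where
  "quant_term \<Phi> I J = mconst (fls_const (quad_coeff g (Hamiltonian g a) I J)) * quant_rule e \<Phi> I J 1"

definition PV :: "'n var \<Rightarrow> 'n darboux" where "PV x = P (fst x) (snd x)"
definition QV :: "'n var \<Rightarrow> 'n darboux" where "QV x = Q (fst x) (snd x)"

lemma quant_term_simps:
  "quant_term \<Phi> (PV x) (PV y) = 0"
  "quant_term \<Phi> (QV y) (PV x) = mconst (fls_const (if fst y = fst x + d then - (1 / 2) * s $ snd x $ snd y else 0)) *
     (q e y * mderiv x \<Phi>)"
  "quant_term \<Phi> (PV x) (QV y) = quant_term \<Phi> (QV y) (PV x)"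
  "quant_term \<Phi> (QV x) (QV y) = mconst (fls_const (- (1 / 2) * b x y)) * (q e x * (q e y * mconst (inverse fls_X)))"
  by (simp_all add: quant_term_def PV_def QV_def quad_coeff_PP quad_coeff_QP quad_coeff_QQ exp_deriv_def q_def
      quad_coeff_sym[of "Hamiltonian g a" "P _ _" "Q _ _"] mult_ac)

lemma darboux_cases:
  obtains x where "I = PV x" | x where "I = QV x"
  by (cases I) (auto simp: PV_def QV_def)

text \<open>A derivative in a high variable is no obstacle: it only comes with a \<open>q\<close>
  that is \<open>d\<close> levels higher still, and truncation kills that factor.\<close>

lemma trunc_quant_term_outside:
  assumes N: "N \<ge> 1" and "I \<notin> PV ` vars N \<union> QV ` vars N \<or> J \<notin> PV ` vars N \<union> QV ` vars N"
  shows "trunc (vars N) (quant_term \<Phi> I J) = 0"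
proof -
  have QP: "trunc (vars N) (quant_term \<Phi> (QV y) (PV x)) = 0" if "fst x > N \<or> fst y > N" for x y
  proof (cases "fst y > N")
    case True
    then show ?thesis by (simp add: quant_term_simps trunc_mult q_outside[OF N])
  next
    case False
    then have "fst y \<noteq> fst x + d" using that by auto
    then show ?thesis by (simp add: quant_term_simps)
  qed
  have QQ: "trunc (vars N) (quant_term \<Phi> (QV y) (QV x)) = 0" if "fst x > N \<or> fst y > N" for x y
    using that by (auto simp: quant_term_simps trunc_mult q_outside[OF N])
  show ?thesis
    using assms(2)
    by (cases I rule: darboux_cases; cases J rule: darboux_cases)
      (auto simp: quant_term_simps(1,3) not_le intro!: QP QQ)
qed

text \<open>Applied to 1, a single \<open>exp_deriv\<close> gives the derivative of the total
  potential. Without second derivatives the result is affine in the potential, so its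
  \<open>\<hbar>^-1\<close> coefficient sees only \<open>Fg 0\<close>.\<close>

lemma hcoeff_quant_term:
  "hcoeff (quant_term (total_potential Fg) (QV y) (PV x)) =
     mconst (if fst y = fst x + d then - (1 / 2) * s $ snd x $ snd y else 0) * (q e y * mderiv x (Fg 0))"
  "hcoeff (quant_term (total_potential Fg) (QV x) (QV y)) = mconst (- (1 / 2) * b x y) * (q e x * q e y)"
  unfolding quant_term_simps hcoeff_mconst_mult hcoeff_q_mult hcoeff_mderiv hcoeff_total_potential hcoeff_inverse_X
  by simp_all

lemma genus0_action_eq:
  assumes "Fg 0 = F"
  shows "genus0_action g e a Fg = inf_act F"
proof (rule trunc_eqI[of d])
  fix N :: nat assume N: "N \<ge> 1" "d \<le> N"
  let ?V = "vars N :: 'n var set"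
  let ?t = "quant_term (total_potential Fg)"
  let ?c = "\<lambda>x y. mconst (if fst y = fst x + d then - (1 / 2) * s $ snd x $ snd y else 0) :: ('n, complex) fun_t"
  let ?D = "PV ` ?V \<union> QV ` ?V"
  have sumD: "sum f ?D = (\<Sum>x\<in>?V. f (PV x)) + (\<Sum>x\<in>?V. f (QV x))" for f :: "'n darboux \<Rightarrow> ('n, complex) fun_t"
  proof -
    have "inj_on PV ?V" "inj_on QV ?V" "PV ` ?V \<inter> QV ` ?V = {}"
      by (auto simp: inj_on_def PV_def QV_def prod_eq_iff)
    then show ?thesis by (simp add: sum.union_disjoint sum.reindex)
  qed
  have "trunc ?V (genus0_action g e a Fg) = trunc ?V (\<Sum>I\<in>?D. \<Sum>J\<in>?D. hcoeff (?t I J))"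
  proof (rule trunc_cong)
    fix m :: "'n var multiset" assume m: "set_mset m \<subseteq> ?V"
    have "mcoeff (quantize g e (Hamiltonian g a) (total_potential Fg) 1) m =
        (\<Sum>p\<in>?D \<times> ?D. mcoeff (case p of (I, J) \<Rightarrow> ?t I J) m)"
      unfolding quantize_def quant_term_def[symmetric]
    proof (rule mcoeff_msum_finite)
      fix p assume p: "p \<in> UNIV - ?D \<times> ?D"
      obtain I J where IJ: "p = (I, J)" by (cases p)
      have "trunc ?V (?t I J) = 0"
        by (rule trunc_quant_term_outside[OF N(1)]) (use p IJ in blast)
      then show "mcoeff (case p of (I, J) \<Rightarrow> ?t I J) m = 0"
        using m trunc_0D by (auto simp: IJ)
    qed auto
    then show "mcoeff (genus0_action g e a Fg) m = mcoeff (\<Sum>I\<in>?D. \<Sum>J\<in>?D. hcoeff (?t I J)) m"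
      by (simp add: genus0_action_def fls_nth_sum sum.cartesian_product case_prod_unfold)
  qed
  also have "(\<Sum>I\<in>?D. \<Sum>J\<in>?D. hcoeff (?t I J)) =
      (\<Sum>x\<in>?V. \<Sum>y\<in>?V. ?c x y * (q e y * mderiv x F)) +
      (\<Sum>y\<in>?V. \<Sum>x\<in>?V. ?c x y * (q e y * mderiv x F)) +
      (\<Sum>x\<in>?V. \<Sum>y\<in>?V. mconst (- (1 / 2) * b x y) * (q e x * q e y))"
  proof -
    have "hcoeff 0 = (0 :: ('n, complex) fun_t)" by (rule mfps_eqI) simp
    then show ?thesis
      unfolding sumD quant_term_simps(1,3) hcoeff_quant_term assms by (simp add: sum.distrib add_ac)
  qed
  also have "(\<Sum>y\<in>?V. \<Sum>x\<in>?V. ?c x y * (q e y * mderiv x F)) =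
      (\<Sum>x\<in>?V. \<Sum>y\<in>?V. ?c x y * (q e y * mderiv x F))"
    by (rule sum.swap)
  \<comment> \<open>The equal contributions of the orders \<open>Q P\<close> and \<open>P Q\<close>
    add up and remove the factor 1/2.\<close>
  also have "(\<Sum>x\<in>?V. \<Sum>y\<in>?V. ?c x y * (q e y * mderiv x F)) +
      (\<Sum>x\<in>?V. \<Sum>y\<in>?V. ?c x y * (q e y * mderiv x F)) =
      - (\<Sum>x\<in>?V. trunc ?V (shift x) * mderiv x F)"
  proof -
    have half: "mconst (- (1 / 2) * c) + mconst (- (1 / 2) * c) = - (mconst c :: ('n, complex) fun_t)" for c :: complex
      by (simp flip: mconst_add mconst_uminus)
    have two: "mconst (- (1 / 2) * c) * f + mconst (- (1 / 2) * c) * f = - (mconst c * f)"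
      for c :: complex and f :: "('n, complex) fun_t"
      unfolding distrib_right[symmetric] half by (rule mult_minus_left)
    have "?c x y * (q e y * mderiv x F) +
        ?c x y * (q e y * mderiv x F) =
        - (mconst (if fst y = fst x + d then s $ snd x $ snd y else 0) * q e y * mderiv x F)" for x y
      using two[of "s $ snd x $ snd y" "q e y * mderiv x F"] by (simp only: mult.assoc split: if_split) simp
    then show ?thesis
      unfolding trunc_shift[OF N(1)] sum.distrib[symmetric] sum_distrib_right by (simp only: sum_negf)
  qed
  also have "(\<Sum>x\<in>?V. \<Sum>y\<in>?V. mconst (- (1 / 2) * b x y) * (q e x * q e y)) =
      - (mconst (1 / 2) * (\<Sum>x\<in>?V. \<Sum>y\<in>?V. mconst (b x y) * (q e x * q e y)))"
  proof -
    have "mconst (- (1 / 2) * c) * f = - (mconst (1 / 2) * (mconst c * f))"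
      for c :: complex and f :: "('n, complex) fun_t"
      by (simp only: mult_minus_left mconst_uminus mconst_mult mult.assoc)
    then show ?thesis by (simp only: sum_negf sum_distrib_left)
  qed
  finally have "trunc ?V (genus0_action g e a Fg) = trunc ?V (- (\<Sum>x\<in>?V. trunc ?V (shift x) * mderiv x F) +
      - (mconst (1 / 2) * (\<Sum>x\<in>?V. \<Sum>y\<in>?V. mconst (b x y) * (q e x * q e y))))" .
  moreover have "trunc ?V (\<Sum>x\<in>?V. trunc ?V (shift x) * mderiv x F) = trunc ?V (\<Sum>x\<in>?V. shift x * mderiv x F)"
    by (simp add: trunc_sum trunc_mult)
  ultimately show "trunc ?V (genus0_action g e a Fg) = trunc ?V (inf_act F)"
    unfolding trunc_inf_act[OF N] trunc_add trunc_diff trunc_uminus by simp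
qed

end

theorem theorem2p1:
  fixes g :: "complex ^ 'n ^ 'n" and e :: "'n :: finite"
  assumes g: "symmetric_nondegenerate g"
  shows
    "(\<forall>S F. S \<in> Gminus g \<and> F \<in> GW0 g e \<and> subst_ok e F (qpart (fam_act (sinv S) (univ_point e))) \<longrightarrow>
       (\<exists>!W. is_W_family g S W) \<and>
       (\<exists>!G. is_hat g e S F G) \<and>
       hat g e S F =
         subst e F (qpart (fam_act (sinv S) (univ_point e))) +
         mconst (1 / 2) *
           msum (\<lambda>(k, l). bil (map_matrix mconst g)
                    (map_matrix mconst (Wop g S k l) *v qvec e k) (qvec e l)) UNIV) \<and>
     (\<forall>l s F. l > 0 \<and> adj g s = map_matrix (\<lambda>x. (- 1) ^ (l + 1) * x) s \<and> F \<in> GW0 g e \<longrightarrow>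
       (let a = (\<lambda>i. if i = l then s else 0) in
         (\<exists>!G. hat_exp g e a F G) \<and>
         inf_action g e a F =
           - msum (\<lambda>n. \<Sum>\<beta>\<in>UNIV. (map_matrix mconst s *v qvec e (l + n)) $ \<beta> * mderiv (n, \<beta>) F) UNIV
           - mconst (1 / 2) *
               (\<Sum>n = 0..l - 1. (- 1) ^ n *
                  bil (map_matrix mconst g) (map_matrix mconst s *v qvec e (l - 1 - n)) (qvec e n)) \<and>
         (\<forall>Fg. Fg 0 = F \<longrightarrow> genus0_action g e a Fg = inf_action g e a F)))"
proof -
  interpret bilinear_form g using g by (rule bilinear_form_complex)
  show ?thesis
  proof (rule conjI, goal_cases)
    case 1
    show ?case
    proof (intro allI impI, goal_cases)
      case (1 S F)
      interpret symplectic_series g S e by unfold_locales (use 1 in blast)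
      have ok: "comp_ok F T" and F: "F \<in> GW0 g e" using 1 subst_ok_T by blast+
      have "subst e F (qpart (fam_act (sinv S) (univ_point e))) = mcomp F T"
        by (simp add: subst_eq_mcomp sinv_S T_def[abs_def] L_def)
      moreover have "\<exists>!W. is_W_family g S W" using is_W_family_W is_W_family_unique by blast
      ultimately show ?case
        using hat_formula[OF F ok] unfolding transform_def half_quad_def quad_eq
        by (simp add: inverse_eq_divide)
    qed
  next
    case 2
    show ?case
    proof (intro allI impI, goal_cases)
      case (1 l s F)
      interpret eps_exp g s l e
        by unfold_locales (use 1 in \<open>simp_all add: adj_eq_star map_matrix_sg del: power_Suc add_Suc_right\<close>)
      show ?case
        unfolding Let_def a_def[symmetric] inf_act_def[symmetric]
        using hat_exp_unique_existence 1 genus0_action_eq by auto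
    qed
  qed
qed

end
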